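(* Let $n\ge 2$ and $N\ge 2$ be coprime integers and let the crossing parameter be $w=\frac{n}{N}$. Let $\mathcal{A}$ be the algebra of monodromy matrices associated with the $\mathbb{Z}_n$ R-matrix $R(u)$ with crossing parameter $w$, with generators $L_{kl}(v)$. For a generic vector $a\in\mathbb{C}^n$, let $\Lambda^i_j(u)\in\mathcal{A}$ ($i,j=1,\dots,n$) be the elements defined by $$\mathcal{L}^{(s)}_{1\cdots N}(u)\,\Psi_a^i(u)=\sum_{j=1}^n\Lambda^i_j(u)\,\Psi_a^j(u).$$ Then the elements $\{\Lambda^i_j(u)\mid i,j=1,\dots,n\}$ are central elements of $\mathcal{A}$, namely $$[\Lambda^i_j(u),\,L_{kl}(v)]=0\qquad (i,j,k,l=1,\dots,n).$$
   Context: Fix $\tau\in\mathbb{C}$ with $\mathrm{Im}\,\tau>0$. Define $\theta\begin{bmatrix}a\\ b\end{bmatrix}(u,\tau)=\sum_{m\in\mathbb{Z}}\exp\{\sqrt{-1}\pi[(m+a)^2\tau+2(m+a)(u+b)]\}$, $\theta^{(j)}(u)=\theta\begin{bmatrix}\frac12-\frac jn\\ \frac12\end{bmatrix}(u,n\tau)$ (depends only on $j$ mod $n$), and $\bar\theta^{(j)}(u)=e^{\sqrt{-1}\pi u}\theta^{(j)}(u)$. R-matrix. Let $e_1,\dots,e_n$ be the standard orthonormal basis of $\mathbb{C}^n$ and $E_{ij}$ the matrix units ($E_{ij}e_k=\delta_{jk}e_i$). Then $R(u)=\sum_{i,j,k,l}R^{kl}_{ij}(u)E_{ik}\otimes E_{jl}$,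 where $R^{kl}_{ij}(u)=\dfrac{h(u)\,\theta^{(i-j)}(u+w)}{\theta^{(i-k)}(w)\,\theta^{(k-j)}(u)}$ if $i+j\equiv k+l$ mod $n$ and $0$ otherwise, with $h(u)=\prod_{j=0}^{n-1}\theta^{(j)}(u)\big/\prod_{j=1}^{n-1}\theta^{(j)}(0)$. It satisfies the quantum Yang–Baxter equation $R_{12}(u-v)R_{13}(u)R_{23}(v)=R_{23}(v)R_{13}(u)R_{12}(u-v)$. Algebra. $\mathcal{A}$ is the associative algebra generated by the matrix elements $L_{ij}(u)$ ($1\le i,j\le n$) of the L-operator $L(u)$, with defining relations $R_{12}(u-v)L_1(u)L_2(v)=L_2(v)L_1(u)R_{12}(u-v)$, where $L_1(u)=L(u)\otimes 1$, $L_2(u)=1\otimes L(u)$. Fused L-operator. On $V_1\otimes\cdots\otimes V_N$, $V_i=\mathbb{C}^n$, put $\mathcal{L}_{1\cdots N}(u)=L_1(u+(N-1)w)L_2(u+(N-2)w)\cdots L_N(u)$ (entries in $\mathcal{A}$), let $P_N^{(+)}=\frac1{N!}\sum_{P\in\mathcal{P}_N}P$ be the full symmetrizer ($\mathcal{P}_N$ the symmetric group permuting tensor factors), and $\mathcal{L}^{(s)}_{1\cdots N}(u)=P^{(+)}_N\mathcal{L}_{1\cdots N}(u)P^{(+)}_N$. Vectors. For $\lambda\in\mathbb{C}^n$, $\lambda_i=\langle\lambda,e_i\rangle$ and $\bar\lambda_j=\lambda_j-\frac1n\sum_k\lambda_k$. The intertwining vector $\phi_{\lambda,\lambda+e_j}(u)\in\mathbb{C}^n$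 has $k$-th component $\bar\theta^{(k)}(u-nw\bar\lambda_j)$, $k=1,\dots,n$. Set $$\Psi_a^i(u)=P_N^{(+)}\Big(\phi_{a,a+e_i}(u+(N-1)w)\otimes\phi_{a+e_i,a+2e_i}(u+(N-2)w)\otimes\cdots\otimes\phi_{a+(N-1)e_i,a+Ne_i}(u)\Big).$$ For $w=n/N$ and generic $a$, the span $\overline W$ of $\Psi_a^1(u),\dots,\Psi_a^n(u)$ is $n$-dimensional, independent of the choice of $a$, and invariant under $\mathcal{L}^{(s)}_{1\cdots N}(u)$; the $\Lambda^i_j(u)$ are the matrix entries of the restriction of $\mathcal{L}^{(s)}_{1\cdots N}(u)$ to $\overline W$.
   Formalization: Commutation is claimed only for v with h(u+mw−v)≠0 for m=0,…,N−1 (it can fail at the excluded v, e.g. N=2, n odd, v=u, as the generators L(v) are independent symbols), and "generic a" means that Ψ_a^1(u),…,Ψ_a^n(u) are linearly independent at the given u. *)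

theory Defs
  imports
    "HOL-Analysis.Analysis"
    "HOL-Library.Poly_Mapping"
    "HOL-Combinatorics.List_Permutation"
    "HOL-Number_Theory.Cong"
    "HOL-Algebra.QuotRing"
begin

section \<open>Theta functions and the R-matrix\<close>

definition theta_char :: "complex \<Rightarrow> complex \<Rightarrow> complex \<Rightarrow> complex \<Rightarrow> complex" where
  "theta_char a b u \<tau> =
     (\<Sum>\<^sub>\<infinity>m::int. exp (\<i> * of_real pi * ((of_int m + a)\<^sup>2 * \<tau> + 2 * (of_int m + a) * (u + b))))"

definition theta_j :: "nat \<Rightarrow> complex \<Rightarrow> int \<Rightarrow> complex \<Rightarrow> complex" where
  "theta_j n \<tau> j u = theta_char (1/2 - of_int j / of_nat n) (1/2) u (of_nat n * \<tau>)"

definition theta_bar :: "nat \<Rightarrow> complex \<Rightarrow> int \<Rightarrow> complex \<Rightarrow> complex" where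
  "theta_bar n \<tau> j u = exp (\<i> * of_real pi * u) * theta_j n \<tau> j u"

definition h_fun :: "nat \<Rightarrow> complex \<Rightarrow> complex \<Rightarrow> complex" where
  "h_fun n \<tau> u = (\<Prod>j=0..<n. theta_j n \<tau> (int j) u) / (\<Prod>j=1..<n. theta_j n \<tau> (int j) 0)"

text \<open>
  The quotient of \<open>h u\<close> by the theta function with index \<open>m\<close> is an entire function of \<open>u\<close>: the
  denominator is one of the factors of \<open>h u\<close>.  It is defined here with this factor cancelled, as
  division would return the value 0 at the removable singularities (in particular at \<open>u = 0\<close>).
\<close>
definition h_quot :: "nat \<Rightarrow> complex \<Rightarrow> int \<Rightarrow> complex \<Rightarrow> complex" where
  "h_quot n \<tau> m u =
     (\<Prod>j\<in>{j\<in>{0..<n}. \<not> [int j = m] (mod int n)}. theta_j n \<tau> (int j) u)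
     / (\<Prod>j=1..<n. theta_j n \<tau> (int j) 0)"

text \<open>\<open>R_coeff n \<tau> w u i j k l\<close> has lower indices \<open>i, j\<close> and upper indices \<open>k, l\<close>.\<close>
definition R_coeff ::
  "nat \<Rightarrow> complex \<Rightarrow> complex \<Rightarrow> complex \<Rightarrow> nat \<Rightarrow> nat \<Rightarrow> nat \<Rightarrow> nat \<Rightarrow> complex" where
  "R_coeff n \<tau> w u i j k l =
     (if [i + j = k + l] (mod n)
      then h_quot n \<tau> (int k - int j) u * theta_j n \<tau> (int i - int j) (u + w)
           / theta_j n \<tau> (int i - int k) w
      else 0)"

lemma theta_j_add: "theta_j n \<tau> (j + int n * m) u = theta_j n \<tau> j u" if "n > 0"
proof -
  have eq: "1/2 - of_int (j + int n * m) / of_nat n = (1/2 - of_int j / of_nat n :: complex) - of_int m"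
    using that by (simp add: field_simps)
  have bij: "bij_betw (\<lambda>k::int. k + m) UNIV UNIV"
    by (rule bij_betwI[where g = "\<lambda>k. k - m"]) auto
  show ?thesis
    unfolding theta_j_def theta_char_def eq
    by (subst infsum_reindex_bij_betw[OF bij, symmetric]) (simp add: algebra_simps)
qed

lemma theta_j_cong:
  assumes "n > 0" and "[j = k] (mod int n)"
  shows "theta_j n \<tau> j u = theta_j n \<tau> k u"
proof -
  obtain m where "k = j + int n * m"
    using assms(2) by (metis cong_iff_lin)
  then show ?thesis by (simp add: theta_j_add[OF assms(1)])
qed

lemma R_coeff_eq:
  assumes "n > 0" and "[i + j = k + l] (mod n)" and nz: "theta_j n \<tau> (int k - int j) u \<noteq> 0"
  shows "R_coeff n \<tau> w u i j k l = h_fun n \<tau> u * theta_j n \<tau> (int i - int j) (u + w)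
           / (theta_j n \<tau> (int i - int k) w * theta_j n \<tau> (int k - int j) u)"
proof -
  define m where "m = int k - int j"
  define r where "r = nat (m mod int n)"
  have r: "r \<in> {0..<n}" "[int r = m] (mod int n)"
    using assms(1) by (auto simp: r_def cong_def nat_less_iff)
  have "[int q = m] (mod int n) \<longleftrightarrow> q = r" if "q < n" for q
    using that r(2) by (auto simp: r_def cong_def)
  then have eq: "{q\<in>{0..<n}. \<not> [int q = m] (mod int n)} = {0..<n} - {r}"
    by auto
  have "(\<Prod>j=0..<n. theta_j n \<tau> (int j) u)
      = theta_j n \<tau> m u * (\<Prod>j\<in>{0..<n} - {r}. theta_j n \<tau> (int j) u)"
    using r theta_j_cong[OF assms(1) r(2)] by (subst prod.remove[of _ r]) auto
  then have "h_quot n \<tau> m u = h_fun n \<tau> u / theta_j n \<tau> m u"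
    using nz unfolding m_def[symmetric] h_quot_def h_fun_def eq by simp
  then show ?thesis
    using assms(2) by (simp add: R_coeff_def m_def)
qed

section \<open>Matrices on tensor powers\<close>

text \<open>
  The basis of the \<open>N\<close>-fold tensor power of the space of \<open>n\<close>-vectors is indexed by the lists of
  length \<open>N\<close> over \<open>{1..n}\<close>.  Tensors and operators are given by their components, which are
  relevant on this index set only; the tensor factors are numbered from 0.
\<close>
definition tidx :: "nat \<Rightarrow> nat \<Rightarrow> nat list set" where
  "tidx n N = {x. length x = N \<and> set x \<subseteq> {1..n}}"

type_synonym 'r tmat = "nat list \<Rightarrow> nat list \<Rightarrow> 'r"

definition tmul :: "nat \<Rightarrow> nat \<Rightarrow> 'r::ring_1 tmat \<Rightarrow> 'r tmat \<Rightarrow> 'r tmat" where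
  "tmul n N A B = (\<lambda>x y. \<Sum>z\<in>tidx n N. A x z * B z y)"

definition tone :: "'r::ring_1 tmat" where
  "tone = (\<lambda>x y. if x = y then 1 else 0)"

text \<open>The matrix \<open>M\<close> acting on tensor factor \<open>s\<close>, with the identity on the other factors.\<close>
definition leg :: "nat \<Rightarrow> nat \<Rightarrow> (nat \<Rightarrow> nat \<Rightarrow> 'r::ring_1) \<Rightarrow> 'r tmat" where
  "leg N s M = (\<lambda>x y. if \<forall>t<N. t \<noteq> s \<longrightarrow> x ! t = y ! t then M (x ! s) (y ! s) else 0)"

definition R_mat :: "nat \<Rightarrow> complex \<Rightarrow> complex \<Rightarrow> complex \<Rightarrow> complex tmat" where
  "R_mat n \<tau> w u = (\<lambda>x y. R_coeff n \<tau> w u (x ! 0) (x ! 1) (y ! 0) (y ! 1))"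

definition symmetrizer :: "nat \<Rightarrow> complex tmat" where
  "symmetrizer N =
     (\<lambda>x y. (\<Sum>\<pi> | \<pi> permutes {..<N}. if x = permute_list \<pi> y then 1 else 0) / fact N)"

section \<open>The algebra of monodromy matrices\<close>

text \<open>Words form the free monoid, written additively so that finitely supported functions on
  words, with the convolution product, are the free associative algebra.\<close>
datatype 'g word = Word (letters: "'g list")

instantiation word :: (type) monoid_add
begin
definition zero_word :: "'a word" where "0 = Word []"
definition plus_word :: "'a word \<Rightarrow> 'a word \<Rightarrow> 'a word" where
  "v + w = Word (letters v @ letters w)"
instance by standard (simp_all add: zero_word_def plus_word_def)
end

text \<open>The letter \<open>(i, j, u)\<close> stands for the generator $L_{ij}(u)$.\<close>
type_synonym gen = "nat \<times> nat \<times> complex"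
type_synonym falg = "gen word \<Rightarrow>\<^sub>0 complex"

definition scal :: "complex \<Rightarrow> falg" where
  "scal c = Poly_Mapping.single 0 c"

definition gen_L :: "complex \<Rightarrow> nat \<Rightarrow> nat \<Rightarrow> falg" where
  "gen_L u i j = Poly_Mapping.single (Word [(i, j, u)]) 1"

definition smat :: "complex tmat \<Rightarrow> falg tmat" where
  "smat A = (\<lambda>x y. scal (A x y))"

definition free_alg :: "nat \<Rightarrow> falg ring" where
  "free_alg n =
     \<lparr>carrier = {p. \<forall>v\<in>Poly_Mapping.keys p. set (letters v) \<subseteq> {1..n} \<times> {1..n} \<times> UNIV},
      mult = (*), one = 1, zero = 0, add = (+)\<rparr>"

definition RLL_rels :: "nat \<Rightarrow> complex \<Rightarrow> complex \<Rightarrow> falg set" where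
  "RLL_rels n \<tau> w =
     (\<Union>u. \<Union>v. \<Union>x\<in>tidx n 2. \<Union>y\<in>tidx n 2.
        {tmul n 2 (smat (R_mat n \<tau> w (u - v))) (tmul n 2 (leg 2 0 (gen_L u)) (leg 2 1 (gen_L v))) x y
       - tmul n 2 (tmul n 2 (leg 2 1 (gen_L v)) (leg 2 0 (gen_L u))) (smat (R_mat n \<tau> w (u - v))) x y})"

lemma free_alg_mult_closed:
  "p \<in> carrier (free_alg n) \<Longrightarrow> q \<in> carrier (free_alg n) \<Longrightarrow> p * q \<in> carrier (free_alg n)"
  using keys_mult[of p q] by (fastforce simp: free_alg_def plus_word_def)

lemma free_alg_add_closed:
  "p \<in> carrier (free_alg n) \<Longrightarrow> q \<in> carrier (free_alg n) \<Longrightarrow> p + q \<in> carrier (free_alg n)"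
  using keys_add[of p q] by (fastforce simp: free_alg_def)

lemma free_alg_diff_closed:
  "p \<in> carrier (free_alg n) \<Longrightarrow> q \<in> carrier (free_alg n) \<Longrightarrow> p - q \<in> carrier (free_alg n)"
  using free_alg_add_closed[of p n "- q"] by (simp add: free_alg_def)

lemma free_alg_sum_closed:
  "(\<And>z. z \<in> Z \<Longrightarrow> f z \<in> carrier (free_alg n)) \<Longrightarrow> sum f Z \<in> carrier (free_alg n)"
proof (induction Z rule: infinite_finite_induct)
  case (insert z Z)
  then show ?case by (simp add: free_alg_add_closed)
qed (simp_all add: free_alg_def)

lemma free_alg_ring: "ring (free_alg n)"
proof -
  note mult = free_alg_mult_closed and add = free_alg_add_closed
  have neg: "\<exists>q\<in>carrier (free_alg n). p + q = 0" if "p \<in> carrier (free_alg n)" for p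
    by (rule bexI[of _ "- p"]) (use that in \<open>auto simp: free_alg_def\<close>)
  have zero: "0 \<in> carrier (free_alg n)" and one: "1 \<in> carrier (free_alg n)"
    by (auto simp: free_alg_def zero_word_def simp flip: single_one)
  have ops: "mult (free_alg n) = (*)" "one (free_alg n) = 1" "zero (free_alg n) = 0"
      "add (free_alg n) = (+)"
    by (simp_all add: free_alg_def)
  show ?thesis
  proof (rule ringI)
    show "abelian_group (free_alg n)"
      by (rule abelian_groupI) (simp_all add: ops add neg zero add.assoc add.commute)
    show "monoid (free_alg n)"
      by (rule monoidI) (simp_all add: ops mult one mult.assoc)
  qed (simp_all add: ops distrib_left distrib_right)
qed

definition RLL_ideal :: "nat \<Rightarrow> complex \<Rightarrow> complex \<Rightarrow> falg set" where
  "RLL_ideal n \<tau> w = Idl\<^bsub>free_alg n\<^esub> (RLL_rels n \<tau> w)"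

definition mono_alg :: "nat \<Rightarrow> complex \<Rightarrow> complex \<Rightarrow> falg set ring" where
  "mono_alg n \<tau> w = free_alg n Quot RLL_ideal n \<tau> w"

lemma RLL_rels_subset: "RLL_rels n \<tau> w \<subseteq> carrier (free_alg n)"
proof -
  have tmul: "tmul n 2 A B x y \<in> carrier (free_alg n)"
    if "x \<in> tidx n 2" "y \<in> tidx n 2"
      "\<And>x y. x \<in> tidx n 2 \<Longrightarrow> y \<in> tidx n 2 \<Longrightarrow> A x y \<in> carrier (free_alg n)"
      "\<And>x y. x \<in> tidx n 2 \<Longrightarrow> y \<in> tidx n 2 \<Longrightarrow> B x y \<in> carrier (free_alg n)"
    for A B x y
    unfolding tmul_def by (intro free_alg_sum_closed free_alg_mult_closed that)
  have scal: "smat A x y \<in> carrier (free_alg n)" for A x y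
    by (simp add: smat_def scal_def free_alg_def zero_word_def)
  have leg: "leg 2 s (gen_L u) x y \<in> carrier (free_alg n)"
    if "x \<in> tidx n 2" "y \<in> tidx n 2" "s < 2" for s u x y
  proof -
    have "x ! s \<in> {1..n}" "y ! s \<in> {1..n}"
      using that by (auto simp: tidx_def simp del: atLeastAtMost_iff intro!: subsetD[OF _ nth_mem])
    then show ?thesis
      by (simp add: leg_def gen_L_def free_alg_def)
  qed
  show ?thesis
    unfolding RLL_rels_def by (auto intro!: free_alg_diff_closed tmul scal leg)
qed

lemma mono_alg_ring: "ring (mono_alg n \<tau> w)"
  unfolding mono_alg_def RLL_ideal_def
  by (intro ideal.quotient_is_ring ring.genideal_ideal free_alg_ring RLL_rels_subset)

definition cls :: "nat \<Rightarrow> complex \<Rightarrow> complex \<Rightarrow> falg \<Rightarrow> falg set" where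
  "cls n \<tau> w p = RLL_ideal n \<tau> w +>\<^bsub>free_alg n\<^esub> p"

definition L_elt :: "nat \<Rightarrow> complex \<Rightarrow> complex \<Rightarrow> complex \<Rightarrow> nat \<Rightarrow> nat \<Rightarrow> falg set" where
  "L_elt n \<tau> w v k l = cls n \<tau> w (gen_L v k l)"

section \<open>The fused L-operator and the intertwining vectors\<close>

text \<open>The entries of the fused L-operator are given by representatives in the free algebra.\<close>
definition fused_L :: "nat \<Rightarrow> nat \<Rightarrow> complex \<Rightarrow> complex \<Rightarrow> falg tmat" where
  "fused_L n N w u =
     foldr (tmul n N) (map (\<lambda>s. leg N s (gen_L (u + of_nat (N - 1 - s) * w))) [0..<N]) tone"

definition fused_L_sym :: "nat \<Rightarrow> nat \<Rightarrow> complex \<Rightarrow> complex \<Rightarrow> falg tmat" where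
  "fused_L_sym n N w u =
     tmul n N (smat (symmetrizer N)) (tmul n N (fused_L n N w u) (smat (symmetrizer N)))"

text \<open>Vectors are functions on \<open>{1..n}\<close>. \<open>ivec n \<tau> w a j u\<close> is the intertwining vector from
  \<open>a\<close> to \<open>a + e\<^sub>j\<close>.\<close>
definition bar :: "nat \<Rightarrow> (nat \<Rightarrow> complex) \<Rightarrow> nat \<Rightarrow> complex" where
  "bar n a j = a j - (\<Sum>k=1..n. a k) / of_nat n"

definition ivec ::
  "nat \<Rightarrow> complex \<Rightarrow> complex \<Rightarrow> (nat \<Rightarrow> complex) \<Rightarrow> nat \<Rightarrow> complex \<Rightarrow> nat \<Rightarrow> complex" where
  "ivec n \<tau> w a j u k = theta_bar n \<tau> (int k) (u - of_nat n * w * bar n a j)"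

text \<open>The vector \<open>a + s e\<^sub>i\<close>.\<close>
definition shift :: "(nat \<Rightarrow> complex) \<Rightarrow> nat \<Rightarrow> nat \<Rightarrow> (nat \<Rightarrow> complex)" where
  "shift a i s = (\<lambda>k. a k + (if k = i then of_nat s else 0))"

definition Psi ::
  "nat \<Rightarrow> nat \<Rightarrow> complex \<Rightarrow> complex \<Rightarrow> (nat \<Rightarrow> complex) \<Rightarrow> complex \<Rightarrow> nat \<Rightarrow> nat list \<Rightarrow> complex" where
  "Psi n N \<tau> w a u i = (\<lambda>x. \<Sum>y\<in>tidx n N. symmetrizer N x y *
     (\<Prod>s<N. ivec n \<tau> w (shift a i s) i (u + of_nat (N - 1 - s) * w) (y ! s)))"

text \<open>
  Genericity of \<open>a\<close>: the vectors \<open>\<Psi>\<close> with indices 1 to n span an n-dimensional space, so that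
  matrix entries with respect to them make sense.  The condition involves \<open>u\<close> as well: the entries
  of \<open>bar n a\<close> add up to 0, and for isolated values of \<open>u\<close> no choice of \<open>a\<close> satisfies it.
\<close>
definition generic_at ::
  "nat \<Rightarrow> nat \<Rightarrow> complex \<Rightarrow> complex \<Rightarrow> complex \<Rightarrow> (nat \<Rightarrow> complex) \<Rightarrow> bool" where
  "generic_at n N \<tau> w u a \<longleftrightarrow>
     (\<forall>c :: nat \<Rightarrow> complex.
        (\<forall>x\<in>tidx n N. (\<Sum>i=1..n. c i * Psi n N \<tau> w a u i x) = 0) \<longrightarrow> (\<forall>i\<in>{1..n}. c i = 0))"

text \<open>\<open>\<Lambda> i j\<close> are the matrix entries of the symmetrized fused L-operator at \<open>u\<close> with respect to the
  vectors \<open>\<Psi>\<close>: the equation is an identity of tensors with components in the algebra.\<close>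
definition is_Lambda ::
  "nat \<Rightarrow> nat \<Rightarrow> complex \<Rightarrow> complex \<Rightarrow> (nat \<Rightarrow> complex) \<Rightarrow> complex \<Rightarrow> (nat \<Rightarrow> nat \<Rightarrow> falg set) \<Rightarrow> bool"
where
  "is_Lambda n N \<tau> w a u \<Lambda> \<longleftrightarrow>
     (\<forall>i\<in>{1..n}. \<forall>j\<in>{1..n}. \<Lambda> i j \<in> carrier (mono_alg n \<tau> w)) \<and>
     (\<forall>i\<in>{1..n}. \<forall>x\<in>tidx n N.
        cls n \<tau> w (\<Sum>y\<in>tidx n N. fused_L_sym n N w u x y * scal (Psi n N \<tau> w a u i y))
        = (\<Oplus>\<^bsub>mono_alg n \<tau> w\<^esub>j\<in>{1..n}.
             \<Lambda> i j \<otimes>\<^bsub>mono_alg n \<tau> w\<^esub> cls n \<tau> w (scal (Psi n N \<tau> w a u j x))))"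

text \<open>
  \<open>h\<close> vanishes exactly on the lattice spanned by 1 and \<open>\<tau>\<close>, so for given \<open>u\<close> this excludes a discrete
  set of values \<open>v\<close>, where the fused R-matrix relating the L-operators at \<open>u, u + w, \<dots>\<close> to the one
  at \<open>v\<close> vanishes on the span of the vectors \<open>\<Psi>\<close>.  The generators for different values of the
  spectral parameter are independent symbols, so relations do not extend to these \<open>v\<close> by continuity.
\<close>
definition generic_pair :: "nat \<Rightarrow> nat \<Rightarrow> complex \<Rightarrow> complex \<Rightarrow> complex \<Rightarrow> complex \<Rightarrow> bool" where
  "generic_pair n N \<tau> w u v \<longleftrightarrow> (\<forall>m<N. h_fun n \<tau> (u + of_nat m * w - v) \<noteq> 0)"

end

theory Submission
  imports Defs "HOL-Complex_Analysis.Complex_Analysis"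
begin

text \<open>
  Write $\varphi(z)$ for the vector with components $\bar\theta^{(k)}(z)$.  The matrix $R(\xi)$ maps
  $\varphi(p) \otimes \varphi(y)$ to a combination of $\varphi(p + w) \otimes \varphi(y - w)$ (``passing'') and
  $\varphi(y + \xi) \otimes \varphi(p - \xi)$ (``exchange''), and in $\Psi$ the arguments of the factors $\varphi$ form
  an arithmetic progression with step $n w$.  When the product of the R-matrices
  $R_{s0}(u + (N - s) w - v)$ over all tensor factors $s$ acts on $\Psi \otimes \varphi(y)$ and the result is
  symmetrized, all exchange terms give the same vector, and the three-term identity sums up their
  weights to a multiple of $h(N w) = h(n) = 0$.  The passing term shifts all arguments by $w$; since
  $n$ and $N$ are coprime, this permutes them modulo $n$, so that it is a multiple of
  $\Psi \otimes \varphi(y)$, with a factor not depending on $\Psi$ or $y$.  Hence the product of R-matrices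
  is a nonzero scalar on the span of the $\Psi$'s, and the fused RLL relation says that the fused
  L-operator commutes with $L(v)$ there.

  That symmetrization is compatible with the products of R- and L-matrices follows from the same
  correspondence: it shows that $R(-w)$ maps onto the antisymmetric tensors.
\<close>

section \<open>Entire functions with theta multipliers\<close>

text \<open>Generators at different spectral parameters are unrelated symbols, so no relation of the
  algebra can be continued in a parameter: all continuation concerns scalar functions. Identities
  between tensors are tested on vectors phi(y) with y outside a countable set; finitely many such y
  recover each component, by a combination that also works modulo the ideal of relations.

  The scalar identities come from one abstract odd theta function, with two quasi-periods in use: n
  \<tau> for \<open>theta_j\<close> of index 0, and \<tau> for the product \<open>h\<close>. Its
  zeros are hard to read off the series, which is therefore compared with the Jacobi product. Zeros
  are not counted by integrals: dividing by a theta function lowers the degree until constant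
  multipliers remain.

  The arithmetic progression in Psi makes the sum over exchanges manageable. Once an exchange has
  happened, the passing weight at every later factor contains h(0) = 0, so exchanges are forced from
  then on; there is one term for each place of the first exchange, and a closed form for the partial
  sums is proved by induction.\<close>

lemma entire_mult_eq_0:
  fixes f g :: "complex \<Rightarrow> complex"
  assumes f: "f holomorphic_on UNIV" and g: "g holomorphic_on UNIV"
    and eq: "\<And>z. f z * g z = 0" and nz: "g z0 \<noteq> 0"
  shows "f z = 0"
proof -
  have "open (g -` (- {0}))"
    by (rule open_vimage) (use g holomorphic_on_imp_continuous_on in auto)
  moreover have "g -` (- {0}) \<noteq> {}"
    using nz by auto
  moreover have "f z = 0" if "z \<in> g -` (- {0})" for z
    using eq[of z] that by auto
  ultimately show ?thesis
    using analytic_continuation_open[of "g -` (- {0})" UNIV f "\<lambda>_. 0" z] f by auto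
qed

text \<open>At a zero \<open>a\<close> of \<open>s\<close> both functions lose a factor
  \<open>z - a\<close>. The difference quotients \<open>D f\<close> and \<open>D s\<close> are
  entire, \<open>D s\<close> is nonzero at \<open>a\<close> because the zero is simple, and their
  quotient extends \<open>f / s\<close> across \<open>a\<close>.\<close>

lemma entire_divide:
  fixes f s :: "complex \<Rightarrow> complex"
  assumes f: "f holomorphic_on UNIV" and s: "s holomorphic_on UNIV"
    and zero: "\<And>z. s z = 0 \<Longrightarrow> f z = 0 \<and> deriv s z \<noteq> 0"
  obtains g where "g holomorphic_on UNIV" "\<And>z. f z = s z * g z"
proof
  define g where "g = (\<lambda>z. if s z = 0 then deriv f z / deriv s z else f z / s z)"
  show "f z = s z * g z" for z
    using zero[of z] by (auto simp: g_def)
  have "g field_differentiable (at a)" for a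
  proof (cases "s a = 0")
    case False
    define U where "U = s -` (- {0})"
    have U: "open U" "a \<in> U"
      unfolding U_def using False s holomorphic_on_imp_continuous_on by (auto intro!: open_vimage)
    have "(\<lambda>z. f z / s z) holomorphic_on U"
      by (intro holomorphic_intros holomorphic_on_subset[OF f] holomorphic_on_subset[OF s])
         (auto simp: U_def)
    then have "g holomorphic_on U"
      by (rule holomorphic_transform) (auto simp: U_def g_def)
    then show ?thesis
      using U holomorphic_on_imp_differentiable_at by blast
  next
    case True
    define D where "D = (\<lambda>(p :: complex \<Rightarrow> complex) z. if z = a then deriv p a else (p z - p a) / (z - a))"
    have D: "D p holomorphic_on UNIV" if "p holomorphic_on UNIV" for p
      unfolding D_def using pole_lemma[OF that, of a] by simp
    have Da: "D s a \<noteq> 0"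
      using zero[OF True] by (simp add: D_def)
    define U where "U = D s -` (- {0})"
    have U: "open U" "a \<in> U"
      unfolding U_def using Da D[OF s] holomorphic_on_imp_continuous_on by (auto intro!: open_vimage)
    have "(\<lambda>z. D f z / D s z) holomorphic_on U"
      by (intro holomorphic_intros holomorphic_on_subset[OF D[OF f]] holomorphic_on_subset[OF D[OF s]])
         (auto simp: U_def)
    moreover have "D f z / D s z = g z" if "z \<in> U" for z
      using that zero[OF True] True by (auto simp: U_def D_def g_def)
    ultimately have "g holomorphic_on U"
      by (rule holomorphic_transform)
    then show ?thesis
      using U holomorphic_on_imp_differentiable_at by blast
  qed
  then show "g holomorphic_on UNIV"
    by (simp add: holomorphic_on_def)
qed

text \<open>Phrased for a predicate, so that it serves zero sets, equality of values and simplicity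
  of zeros alike.\<close>

lemma lattice_shift_int:
  assumes "\<And>a :: complex. P (a + c) \<longleftrightarrow> P a"
  shows "P (a + of_int k * c) \<longleftrightarrow> P a"
proof (induction k rule: int_induct[where k = 0])
  case (step1 i)
  then show ?case using assms[of "a + of_int i * c"] by (simp add: algebra_simps)
next
  case (step2 i)
  then show ?case using assms[of "a + of_int (i - 1) * c"] by (simp add: algebra_simps)
qed simp

lemma lattice_shift:
  assumes "\<And>a :: complex. P (a + 1) \<longleftrightarrow> P a" and "\<And>a. P (a + \<omega>) \<longleftrightarrow> P a"
  shows "P (a + of_int m + of_int k * \<omega>) \<longleftrightarrow> P a"
  using lattice_shift_int[of P \<omega>, OF assms(2)] lattice_shift_int[of P 1, OF assms(1)] by auto

lemma elliptic_entire_const: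
  assumes om: "Im \<omega> > 0" and f: "f holomorphic_on UNIV"
    and per: "\<And>u. f (u + 1) = f u" "\<And>u. f (u + \<omega>) = f u"
  shows "f u = f v"
proof -
  \<comment> \<open>A rectangle instead of the period parallelogram: multiples of \<omega> bring the
    imaginary part into range, then integers the real part, so it still meets every coset of the
    lattice.\<close>
  define K where "K = cbox 0 (Complex 1 (Im \<omega>))"
  have "\<exists>z\<in>K. f z = f u" for u
  proof -
    define k where "k = \<lfloor>Im u / Im \<omega>\<rfloor>"
    define u' where "u' = u - of_int k * \<omega>"
    define m where "m = \<lfloor>Re u'\<rfloor>"
    define z where "z = u' - of_int m"
    have "of_int k \<le> Im u / Im \<omega>" "Im u / Im \<omega> < of_int k + 1"
      unfolding k_def by linarith+
    then have "of_int k * Im \<omega> \<le> Im u" "Im u \<le> (of_int k + 1) * Im \<omega>"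
      using om by (auto simp: field_simps)
    then have "z \<in> K"
      unfolding K_def z_def u'_def m_def
      by (simp add: in_cbox_complex_iff algebra_simps) linarith
    moreover have "f (z + of_int m + of_int k * \<omega>) = f u"
      by (simp add: z_def u'_def)
    then have "f z = f u"
      using lattice_shift[of "\<lambda>a. f a = f u" \<omega> z m k] per by simp
    ultimately show ?thesis by blast
  qed
  then have "f u \<in> f ` K" for u by (metis imageI)
  then have "range f = f ` K" by auto
  moreover have "compact (f ` K)"
    unfolding K_def by (intro compact_continuous_image holomorphic_on_imp_continuous_on
        holomorphic_on_subset[OF f]) auto
  ultimately have "bounded (range f)"
    using compact_imp_bounded by auto
  from Liouville_theorem[OF f this] show ?thesis
    by (auto simp: constant_on_def)
qed

text \<open>Reflecting one factor turns constant multipliers into genuine periods.\<close>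

lemma const_multiplier_mult:
  assumes om: "Im \<omega> > 0" and f: "f holomorphic_on UNIV"
    and per: "\<And>u. f (u + 1) = A * f u" "\<And>u. f (u + \<omega>) = B * f u"
  shows "f (u + v) * f 0 = f u * f v"
proof (cases "A = 0 \<or> B = 0")
  case True
  then have "f u = 0" for u
    using per(1)[of "u - 1"] per(2)[of "u - \<omega>"] by auto
  then show ?thesis by simp
next
  case False
  define s where "s = u + v"
  define F where "F = (\<lambda>z. f z * f (s - z))"
  have f': "f \<circ> (\<lambda>z. s - z) holomorphic_on UNIV"
    by (rule holomorphic_on_compose_gen[OF _ f]) (auto intro!: holomorphic_intros)
  have "F holomorphic_on UNIV"
    using holomorphic_on_mult[OF f f'] by (simp add: F_def o_def)
  moreover have "f (s - (z + 1)) = f (s - z) / A" "f (s - (z + \<omega>)) = f (s - z) / B" for z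
    using per(1)[of "s - (z + 1)"] per(2)[of "s - (z + \<omega>)"] False by (simp_all add: field_simps)
  then have "F (z + 1) = F z" "F (z + \<omega>) = F z" for z
    using False by (simp_all add: F_def per)
  ultimately have "F s = F u"
    using elliptic_entire_const[OF om] by blast
  then show ?thesis
    by (simp add: F_def s_def)
qed

text \<open>By the multiplication law a zero at \<open>z\<close> gives \<open>f 0 = 0\<close>, and
  then every \<open>f u * f u\<close> vanishes.\<close>

lemma const_multiplier_zero:
  assumes om: "Im \<omega> > 0" and f: "f holomorphic_on UNIV"
    and per: "\<And>u. f (u + 1) = A * f u" "\<And>u. f (u + \<omega>) = B * f u"
    and zero: "f z = 0"
  shows "f u = 0"
proof -
  note * = const_multiplier_mult[OF om f per]
  have "f 0 = 0"
    using *[of z "- z"] zero by simp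
  then show ?thesis
    using *[of u u] by simp
qed

text \<open>Differentiating the multiplication law at \<open>v = 0\<close> gives
  \<open>f' = c f\<close>, so \<open>f\<close> is an exponential. The resulting constraint on the
  pair of multipliers is what later pins down the zero of a function of degree 1.\<close>

lemma const_multiplier_exp:
  assumes om: "Im \<omega> > 0" and f: "f holomorphic_on UNIV"
    and per: "\<And>u. f (u + 1) = A * f u" "\<And>u. f (u + \<omega>) = B * f u"
    and nz: "f z \<noteq> 0"
  obtains c where "A = exp c" "B = exp (c * \<omega>)"
proof -
  note * = const_multiplier_mult[OF om f per]
  have nz0: "f 0 \<noteq> 0"
    using const_multiplier_zero[OF om f per] nz by blast
  have df: "(f has_field_derivative deriv f u) (at u)" for u
    using f holomorphic_derivI by blast
  define c where "c = deriv f 0 / f 0"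
  have der: "deriv f u = c * f u" for u
  proof -
    have "((\<lambda>v. f (u + v)) has_field_derivative deriv f u) (at 0)"
      using DERIV_shift[of f "deriv f u" 0 u] df[of u] by (simp add: add.commute)
    then have "((\<lambda>v. f (u + v) * f 0) has_field_derivative deriv f u * f 0) (at 0)"
      by (rule DERIV_cmult_right)
    moreover have "((\<lambda>v. f (u + v) * f 0) has_field_derivative f u * deriv f 0) (at 0)"
      unfolding * by (rule DERIV_cmult[OF df])
    ultimately have "deriv f u * f 0 = f u * deriv f 0"
      by (rule DERIV_unique)
    then show ?thesis
      using nz0 by (simp add: c_def field_simps)
  qed
  have "((\<lambda>u. f u * exp (- c * u)) has_field_derivative 0) (at u)" for u
  proof -
    have "((\<lambda>u. f u * exp (- c * u)) has_field_derivative
        deriv f u * exp (- c * u) + (- c * exp (- c * u)) * f u) (at u)"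
      by (rule DERIV_mult[OF df]) (auto intro!: derivative_eq_intros)
    then show ?thesis by (simp add: der)
  qed
  then obtain k where k: "\<And>u. f u * exp (- c * u) = k"
    using has_field_derivative_zero_constant[of UNIV "\<lambda>u. f u * exp (- c * u)"] by auto
  have fu: "f u = f 0 * exp (c * u)" for u
  proof -
    have "f u = f u * exp (- c * u) * exp (c * u)"
      by (simp add: mult.assoc flip: exp_add)
    also have "f u * exp (- c * u) = f 0"
      using k[of u] k[of 0] by simp
    finally show ?thesis .
  qed
  have "f 0 * A = f 0 * exp c" "f 0 * B = f 0 * exp (c * \<omega>)"
    unfolding fu[of 1, symmetric, simplified] fu[of \<omega>, symmetric]
    using per(1)[of 0] per(2)[of 0] by (simp_all add: mult.commute)
  then have "A = exp c" "B = exp (c * \<omega>)"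
    using nz0 by simp_all
  then show ?thesis by (rule that)
qed

section \<open>Odd theta functions, axiomatically\<close>

locale theta_like =
  fixes \<sigma> :: "complex \<Rightarrow> complex" and \<omega> :: complex
  assumes Im_pos: "Im \<omega> > 0"
    and hol: "\<sigma> holomorphic_on UNIV"
    and plus1: "\<sigma> (u + 1) = - \<sigma> u"
    and plus_period: "\<sigma> (u + \<omega>) = - exp (- (\<i> * of_real pi * (\<omega> + 2 * u))) * \<sigma> u"
    and odd: "\<sigma> (- u) = - \<sigma> u"
    and zeroD: "\<sigma> u = 0 \<Longrightarrow> \<exists>m k :: int. u = of_int m + of_int k * \<omega>"
    and deriv0: "deriv \<sigma> 0 \<noteq> 0"
begin

lemma holomorphic [holomorphic_intros]: "f holomorphic_on A \<Longrightarrow> (\<lambda>z. \<sigma> (f z)) holomorphic_on A"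
  using holomorphic_on_compose_gen[of f A \<sigma> UNIV] hol by (simp add: o_def)

lemma zero [simp]: "\<sigma> 0 = 0"
  using odd[of 0] by simp

lemma diff_swap: "\<sigma> (a - b) = - \<sigma> (b - a)"
  using odd[of "b - a"] by simp

lemma has_deriv: "(\<sigma> has_field_derivative deriv \<sigma> u) (at u)"
  using hol holomorphic_derivI by blast

lemma eq_0_iff: "\<sigma> u = 0 \<longleftrightarrow> (\<exists>m k :: int. u = of_int m + of_int k * \<omega>)"
proof
  assume "\<exists>m k :: int. u = of_int m + of_int k * \<omega>"
  then obtain m k :: int where "u = 0 + of_int m + of_int k * \<omega>" by auto
  then show "\<sigma> u = 0"
    using lattice_shift[of "\<lambda>u. \<sigma> u = 0" \<omega> 0 m k] by (simp add: plus1 plus_period)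
qed (rule zeroD)

text \<open>Simplicity spreads from 0 along the lattice. In the direction of \<omega> the derivative
  of the exponential multiplier drops out, being multiplied by
  \<open>\<sigma> u = 0\<close>.\<close>

lemma simple_zero:
  assumes "\<sigma> u = 0"
  shows "deriv \<sigma> u \<noteq> 0"
proof -
  define P where "P = (\<lambda>u. \<sigma> u = 0 \<and> deriv \<sigma> u \<noteq> 0)"
  have P1: "P (u + 1) \<longleftrightarrow> P u" for u
  proof -
    have "((\<lambda>z. \<sigma> (z + 1)) has_field_derivative deriv \<sigma> (u + 1)) (at u)"
      using DERIV_shift[of \<sigma> _ u 1] has_deriv by blast
    moreover have "((\<lambda>z. \<sigma> (z + 1)) has_field_derivative - deriv \<sigma> u) (at u)"
      unfolding plus1 by (intro DERIV_minus has_deriv)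
    ultimately have "deriv \<sigma> (u + 1) = - deriv \<sigma> u"
      by (rule DERIV_unique)
    then show ?thesis by (simp add: P_def plus1)
  qed
  have P2: "P (u + \<omega>) \<longleftrightarrow> P u" for u
  proof (cases "\<sigma> u = 0")
    case True
    define E where "E = (\<lambda>u. - exp (- (\<i> * of_real pi * (\<omega> + 2 * u))))"
    have E: "(E has_field_derivative - (E u * (- 2 * \<i> * of_real pi)) * (-1)) (at u)"
      unfolding E_def by (auto intro!: derivative_eq_intros)
    have "((\<lambda>z. \<sigma> (z + \<omega>)) has_field_derivative deriv \<sigma> (u + \<omega>)) (at u)"
      using DERIV_shift[of \<sigma> _ u \<omega>] has_deriv by blast
    moreover have "((\<lambda>z. \<sigma> (z + \<omega>)) has_field_derivative E u * deriv \<sigma> u) (at u)"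
      using DERIV_mult[OF E has_deriv[of u]] True by (simp add: plus_period E_def mult.commute)
    ultimately have "deriv \<sigma> (u + \<omega>) = E u * deriv \<sigma> u"
      by (rule DERIV_unique)
    then show ?thesis using True by (simp add: P_def plus_period E_def)
  qed (simp add: P_def plus_period)
  obtain m k :: int where "u = 0 + of_int m + of_int k * \<omega>"
    using assms by (auto simp: eq_0_iff)
  then have "P u"
    using lattice_shift[of P \<omega> 0 m k] P1 P2 deriv0 by (simp add: P_def)
  then show ?thesis by (simp add: P_def)
qed

lemma ex_nonzero: "\<exists>u. \<sigma> u \<noteq> 0"
proof (rule ccontr)
  assume "\<not> ?thesis"
  then have "\<sigma> = (\<lambda>_. 0)" by auto
  then show False using deriv0 by simp
qed

text \<open>Splitting off a zero lowers the degree \<open>d\<close> by one and records the place of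
  the zero in the constant \<open>exp (\<i> * of_real pi * (\<omega> - 2 * z))\<close>. The
  multipliers of \<open>g\<close> are first found after multiplication by
  \<open>\<sigma> (u - z)\<close> and then freed from this factor by the identity theorem.\<close>

lemma divide_zero:
  assumes f: "f holomorphic_on UNIV"
    and per: "\<And>u. f (u + 1) = A * f u" "\<And>u. f (u + \<omega>) = B * exp (- 2 * \<i> * of_real pi * d * u) * f u"
    and z: "f z = 0"
  obtains g where "g holomorphic_on UNIV" "\<And>u. f u = \<sigma> (u - z) * g u"
    "\<And>u. g (u + 1) = - A * g u"
    "\<And>u. g (u + \<omega>) = - B * exp (\<i> * of_real pi * (\<omega> - 2 * z)) * exp (- 2 * \<i> * of_real pi * (d - 1) * u) * g u"
proof (cases "A = 0 \<or> B = 0")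
  \<comment> \<open>A vanishing multiplier forces \<open>f\<close> to be identically 0; otherwise
    the zeros of \<open>f\<close> are invariant under the lattice.\<close>
  case True
  then have "f u = 0" for u
    using per(1)[of "u - 1"] per(2)[of "u - \<omega>"] by auto
  then show ?thesis by (intro that[of "\<lambda>_. 0"]) auto
next
  case False
  have dz: "deriv (\<lambda>u. \<sigma> (u - z)) a = deriv \<sigma> (a - z)" for a
    by (rule DERIV_imp_deriv) (use DERIV_shift[of \<sigma> "deriv \<sigma> (a - z)" a "- z"] has_deriv[of "a - z"] in simp)
  have "f a = 0" if a: "\<sigma> (a - z) = 0" for a
  proof -
    obtain m k :: int where "a - z = of_int m + of_int k * \<omega>"
      using zeroD[OF a] by blast
    then have "a = z + of_int m + of_int k * \<omega>"
      by (simp add: algebra_simps)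
    then show ?thesis
      using lattice_shift[of "\<lambda>u. f u = 0" \<omega> z m k] z False per by simp
  qed
  then have zs: "f a = 0 \<and> deriv (\<lambda>u. \<sigma> (u - z)) a \<noteq> 0" if "\<sigma> (a - z) = 0" for a
    using that simple_zero[of "a - z"] by (simp add: dz)
  have s: "(\<lambda>u. \<sigma> (u - z)) holomorphic_on UNIV"
    by (intro holomorphic_intros)
  obtain g where g: "g holomorphic_on UNIV" and fg: "\<And>u. f u = \<sigma> (u - z) * g u"
    using entire_divide[OF f s zs] by blast
  obtain z0 where z0: "\<sigma> z0 \<noteq> 0"
    using ex_nonzero by auto
  then have nz: "\<sigma> (z0 + z - z) \<noteq> 0" by simp
  have shift: "(\<lambda>u. g (u + c)) holomorphic_on UNIV" for c
    using holomorphic_on_compose_gen[of "\<lambda>u. u + c" UNIV g UNIV] g by (simp add: o_def holomorphic_intros)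
  have "(g (u + 1) - (- A * g u)) * \<sigma> (u - z) = 0" for u
  proof -
    have "\<sigma> (u + 1 - z) = - \<sigma> (u - z)"
      using plus1[of "u - z"] by (simp add: algebra_simps)
    then have "A * (\<sigma> (u - z) * g u) = - (\<sigma> (u - z) * g (u + 1))"
      using per(1)[of u] by (simp add: fg)
    moreover have "(x + A * y) * s = A * (s * y) + s * x" for x y s
      by (simp add: algebra_simps)
    ultimately show ?thesis by simp
  qed
  moreover have "(\<lambda>u. g (u + 1) - (- A * g u)) holomorphic_on UNIV"
    by (intro holomorphic_intros shift g)
  ultimately have "g (u + 1) - (- A * g u) = 0" for u
    using entire_mult_eq_0[OF _ s, of "\<lambda>u. g (u + 1) - (- A * g u)" "z0 + z"] nz by blast
  then have g1: "g (u + 1) = - A * g u" for u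
    unfolding right_minus_eq .
  define C where "C = (\<lambda>u. - B * exp (\<i> * of_real pi * (\<omega> - 2 * z)) * exp (- 2 * \<i> * of_real pi * (d - 1) * u))"
  have "(g (u + \<omega>) - C u * g u) * \<sigma> (u - z) = 0" for u
  proof -
    define E where "E = exp (- (\<i> * of_real pi * (\<omega> + 2 * (u - z))))"
    have E0: "E \<noteq> 0" by (simp add: E_def)
    have "\<sigma> (u + \<omega> - z) = - E * \<sigma> (u - z)"
      using plus_period[of "u - z"] by (simp add: E_def algebra_simps)
    then have "- E * \<sigma> (u - z) * g (u + \<omega>) = B * exp (- 2 * \<i> * of_real pi * d * u) * \<sigma> (u - z) * g u"
      using per(2)[of u] by (simp add: fg)
    also have "B * exp (- 2 * \<i> * of_real pi * d * u) = - E * C u"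
      by (simp add: E_def C_def mult_exp_exp algebra_simps flip: exp_add)
    finally have "E * (\<sigma> (u - z) * g (u + \<omega>) - C u * \<sigma> (u - z) * g u) = 0"
      by (simp add: algebra_simps)
    then show ?thesis using E0 by (simp add: algebra_simps)
  qed
  moreover have "(\<lambda>u. g (u + \<omega>) - C u * g u) holomorphic_on UNIV"
    unfolding C_def by (intro holomorphic_intros shift g)
  ultimately have "g (u + \<omega>) - C u * g u = 0" for u
    using entire_mult_eq_0[OF _ s, of "\<lambda>u. g (u + \<omega>) - C u * g u" "z0 + z"] nz by blast
  then have "g (u + \<omega>) = C u * g u" for u
    unfolding right_minus_eq .
  then show ?thesis
    using that[OF g fg g1] by (simp add: C_def)
qed

text \<open>The multipliers are those of \<open>exp (c * u) * \<sigma> (u - z0)\<close>. Dividing by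
  \<open>\<sigma> (u - z)\<close> leaves constant multipliers; if the quotient were nonzero, they
  would be \<open>exp b\<close> and \<open>exp (b * \<omega>)\<close> for one \<open>b\<close>, and
  comparing exponents would put \<open>z - z0\<close> into the lattice.\<close>

lemma degree1_eq_0:
  assumes f: "f holomorphic_on UNIV"
    and per: "\<And>u. f (u + 1) = - exp c * f u"
      "\<And>u. f (u + \<omega>) = - exp (c * \<omega>) * exp (- (\<i> * of_real pi * (\<omega> + 2 * (u - z0)))) * f u"
    and z: "f z = 0" and nz: "\<sigma> (z - z0) \<noteq> 0"
  shows "f u = 0"
proof -
  define B where "B = - exp (c * \<omega>) * exp (- (\<i> * of_real pi * (\<omega> - 2 * z0)))"
  have "f (u + \<omega>) = B * exp (- 2 * \<i> * of_real pi * 1 * u) * f u" for u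
  proof -
    have "exp (c * \<omega>) * exp (- (\<i> * of_real pi * (\<omega> + 2 * (u - z0))))
        = exp (c * \<omega>) * exp (- (\<i> * of_real pi * (\<omega> - 2 * z0))) * exp (- 2 * \<i> * of_real pi * 1 * u)"
      by (simp add: algebra_simps flip: exp_add)
    then show ?thesis by (simp add: per(2) B_def)
  qed
  from divide_zero[OF f per(1) this z] obtain g where g: "g holomorphic_on UNIV"
    and fg: "\<And>u. f u = \<sigma> (u - z) * g u" and g1: "\<And>u. g (u + 1) = exp c * g u"
    and g2: "\<And>u. g (u + \<omega>) = - B * exp (\<i> * of_real pi * (\<omega> - 2 * z)) * g u"
    by (auto simp: mult.assoc)
  have "g u = 0"
  proof (rule ccontr)
    assume "g u \<noteq> 0"
    then obtain b where b: "exp c = exp b" "- B * exp (\<i> * of_real pi * (\<omega> - 2 * z)) = exp (b * \<omega>)"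
      using const_multiplier_exp[OF Im_pos g g1 g2] by metis
    \<comment> \<open>The exponents agree only up to multiples of 2 pi i: the ambiguity
      \<open>m\<close> becomes the \<omega>-component of \<open>z - z0\<close>, the ambiguity
      \<open>k\<close> below its integer component.\<close>
    obtain m :: int where m: "c = b + of_int (2 * m) * pi * \<i>"
      using b(1) by (auto simp: exp_eq)
    have "- B * exp (\<i> * of_real pi * (\<omega> - 2 * z)) = exp (c * \<omega> + 2 * \<i> * of_real pi * (z0 - z))"
      by (simp add: B_def algebra_simps flip: exp_add)
    then obtain k :: int where "c * \<omega> + 2 * \<i> * of_real pi * (z0 - z) = b * \<omega> + of_int (2 * k) * pi * \<i>"
      using b(2) by (auto simp: exp_eq)
    then have "(2 * \<i> * of_real pi) * (z - z0) = (2 * \<i> * of_real pi) * (of_int (- k) + of_int m * \<omega>)"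
      by (simp add: m algebra_simps)
    then have "z - z0 = of_int (- k) + of_int m * \<omega>"
      by (subst (asm) mult_cancel_left) auto
    then show False using nz eq_0_iff[of "z - z0"] by blast
  qed
  then show ?thesis by (simp add: fg)
qed

text \<open>Dividing out two of the zeros leaves constant multipliers, and the third zero then
  forces the quotient to vanish.\<close>

lemma degree2_eq_0:
  assumes f: "f holomorphic_on UNIV"
    and per: "\<And>u. f (u + 1) = A * f u" "\<And>u. f (u + \<omega>) = B * exp (- 2 * \<i> * of_real pi * 2 * u) * f u"
    and z: "f a = 0" "f b = 0" "f c = 0"
    and nz: "\<sigma> (b - a) \<noteq> 0" "\<sigma> (c - a) \<noteq> 0" "\<sigma> (c - b) \<noteq> 0"
  shows "f u = 0"
proof -
  obtain g where g: "g holomorphic_on UNIV" and fg: "\<And>u. f u = \<sigma> (u - a) * g u"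
    and g1: "\<And>u. g (u + 1) = - A * g u"
    and g2: "\<And>u. g (u + \<omega>) = - B * exp (\<i> * of_real pi * (\<omega> - 2 * a)) * exp (- 2 * \<i> * of_real pi * (2 - 1) * u) * g u"
    using divide_zero[OF f per z(1)] by metis
  have gz: "g b = 0" "g c = 0"
    using z nz by (auto simp: fg)
  obtain k where k: "k holomorphic_on UNIV" and gk: "\<And>u. g u = \<sigma> (u - b) * k u"
    and k1: "\<And>u. k (u + 1) = - (- A) * k u"
    and k2: "\<And>u. k (u + \<omega>) = - (- B * exp (\<i> * of_real pi * (\<omega> - 2 * a))) * exp (\<i> * of_real pi * (\<omega> - 2 * b))
          * exp (- 2 * \<i> * of_real pi * ((2 - 1) - 1) * u) * k u"
    using divide_zero[OF g g1 g2 gz(1)] by metis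
  have "k c = 0" using gz nz by (auto simp: gk)
  then have "k u = 0"
    using const_multiplier_zero[OF Im_pos k, of A "B * exp (\<i> * of_real pi * (\<omega> - 2 * a)) * exp (\<i> * of_real pi * (\<omega> - 2 * b))" c u]
      k1 k2 by simp
  then show ?thesis by (simp add: fg gk)
qed

text \<open>This is the Weierstrass three-term identity. As functions of \<open>a\<close> the three
  products share their multipliers, of degree 2, and their combination vanishes at \<open>b\<close>,
  \<open>c\<close> and \<open>d\<close>.\<close>

theorem three_term:
  "\<sigma> (a + b) * \<sigma> (a - b) * \<sigma> (c + d) * \<sigma> (c - d)
   - \<sigma> (a + c) * \<sigma> (a - c) * \<sigma> (b + d) * \<sigma> (b - d)
   + \<sigma> (a + d) * \<sigma> (a - d) * \<sigma> (b + c) * \<sigma> (b - c) = 0"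
proof -
  define D where "D = (\<lambda>a b c d. \<sigma> (a + b) * \<sigma> (a - b) * (\<sigma> (c + d) * \<sigma> (c - d))
   - \<sigma> (a + c) * \<sigma> (a - c) * (\<sigma> (b + d) * \<sigma> (b - d))
   + \<sigma> (a + d) * \<sigma> (a - d) * (\<sigma> (b + c) * \<sigma> (b - c)))"
  have p1: "\<sigma> (a + 1 + x) * \<sigma> (a + 1 - x) = \<sigma> (a + x) * \<sigma> (a - x)" for a x
    using plus1[of "a + x"] plus1[of "a - x"] by (simp add: algebra_simps)
  have p2: "\<sigma> (a + \<omega> + x) * \<sigma> (a + \<omega> - x)
      = exp (- 2 * \<i> * of_real pi * \<omega>) * exp (- 2 * \<i> * of_real pi * 2 * a) * (\<sigma> (a + x) * \<sigma> (a - x))" for a x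
  proof -
    have "a + \<omega> + x = a + x + \<omega>" "a + \<omega> - x = a - x + \<omega>" by simp_all
    then have "\<sigma> (a + \<omega> + x) * \<sigma> (a + \<omega> - x)
      = exp (- (\<i> * of_real pi * (\<omega> + 2 * (a + x)))) * exp (- (\<i> * of_real pi * (\<omega> + 2 * (a - x)))) * (\<sigma> (a + x) * \<sigma> (a - x))"
      by (simp only: plus_period) (simp add: mult_ac)
    also have "exp (- (\<i> * of_real pi * (\<omega> + 2 * (a + x)))) * exp (- (\<i> * of_real pi * (\<omega> + 2 * (a - x))))
        = exp (- 2 * \<i> * of_real pi * \<omega>) * exp (- 2 * \<i> * of_real pi * 2 * a)"
      by (simp add: algebra_simps flip: exp_add)
    finally show ?thesis .
  qed
  have factor: "k * p * x - k * q * y + k * r * z = k * (p * x - q * y + r * z)" for k p x q y r z :: complex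
    by (simp add: algebra_simps)
  have gen: "D a b c d = 0" if "\<sigma> (b - c) \<noteq> 0" "\<sigma> (b - d) \<noteq> 0" "\<sigma> (c - d) \<noteq> 0" for a b c d
  proof (rule degree2_eq_0[where f = "\<lambda>a. D a b c d" and A = 1 and B = "exp (- 2 * \<i> * of_real pi * \<omega>)"
        and a = b and b = c and c = d])
    show "(\<lambda>a. D a b c d) holomorphic_on UNIV"
      unfolding D_def by (intro holomorphic_intros)
    show "D (u + 1) b c d = 1 * D u b c d" for u
      by (simp only: D_def p1 mult_1)
    show "D (u + \<omega>) b c d = exp (- 2 * \<i> * of_real pi * \<omega>) * exp (- 2 * \<i> * of_real pi * 2 * u) * D u b c d" for u
      by (simp only: D_def p2 factor)
    show "D b b c d = 0" by (simp add: D_def mult_ac)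
    show "D c b c d = 0"
      by (simp add: D_def mult_ac diff_swap[of c b] add.commute[of c b])
    show "D d b c d = 0"
      by (simp add: D_def mult_ac diff_swap[of d b] diff_swap[of d c] add.commute[of d b] add.commute[of d c])
    show "\<sigma> (c - b) \<noteq> 0" "\<sigma> (d - b) \<noteq> 0" "\<sigma> (d - c) \<noteq> 0"
      using that diff_swap[of c b] diff_swap[of d b] diff_swap[of d c] by simp_all
  qed
  obtain z0 where z0: "\<sigma> z0 \<noteq> 0" using ex_nonzero by auto
  have D_hol: "(\<lambda>b. D a b c d) holomorphic_on UNIV" "(\<lambda>c. D a b c d) holomorphic_on UNIV" for a b c d
    unfolding D_def by (intro holomorphic_intros)+
  have s_hol: "(\<lambda>b. \<sigma> (b - c)) holomorphic_on UNIV" for c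
    by (intro holomorphic_intros)
  have nz: "\<sigma> (z0 + c - c) \<noteq> 0" for c
    using z0 by simp
  \<comment> \<open>The conditions that \<open>b\<close>, \<open>c\<close>, \<open>d\<close> are
    distinct modulo the lattice are removed by continuation, first in \<open>b\<close>, then in
    \<open>c\<close>.\<close>
  have gen2: "D a b c d = 0" if "\<sigma> (c - d) \<noteq> 0" for a b c d
  proof -
    have "D a b c d * \<sigma> (b - c) * \<sigma> (b - d) = 0" for b
      using gen[of b c d a] that by auto
    from entire_mult_eq_0[OF holomorphic_on_mult[OF D_hol(1) s_hol] s_hol this nz]
    have "D a b c d * \<sigma> (b - c) = 0" for b .
    from entire_mult_eq_0[OF D_hol(1) s_hol this nz] show ?thesis .
  qed
  have "D a b c d * \<sigma> (c - d) = 0" for c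
    using gen2[of c d a b] by auto
  from entire_mult_eq_0[OF D_hol(2) s_hol this nz]
  have "D a b c d = 0" .
  then show ?thesis by (simp add: D_def mult.assoc)
qed

end

section \<open>Existence of theta-like functions\<close>

text \<open>\<open>G\<close> is the infinite product of the factors \<open>1 - q ^ k * x\<close>.
  Taking Euler's power series for it as the definition turns the functional equation into the
  recursion of the coefficients.\<close>

lemma q_pochhammer_exists:
  fixes q :: complex
  assumes q: "norm q < 1"
  obtains G where "G holomorphic_on UNIV" "G 0 = 1" "\<And>x. G x = (1 - x) * G (q * x)"
proof
  define g where "g = rec_nat (1 :: complex) (\<lambda>k r. - (q ^ k) / (1 - q ^ Suc k) * r)"
  define G where "G = (\<lambda>x. suminf (\<lambda>k. g k * x ^ k))"
  have g0: "g 0 = 1" and gS: "g (Suc k) = - (q ^ k) / (1 - q ^ Suc k) * g k" for k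
    by (simp_all add: g_def)
  have q1: "q ^ Suc k \<noteq> 1" for k
    using q power_less_one_iff[of "norm q" "Suc k"] by (metis norm_ge_zero norm_one norm_power order_less_irrefl power_less_one_iff zero_less_Suc)
  have summ: "summable (\<lambda>k. g k * x ^ k)" for x
  proof -
    have "(\<lambda>k. norm (q ^ k / (1 - q ^ Suc k) * x)) \<longlonglongrightarrow> norm (0 / (1 - 0) * x)"
      by (intro tendsto_intros LIMSEQ_power_zero q LIMSEQ_Suc) auto
    then have "eventually (\<lambda>k. norm (q ^ k / (1 - q ^ Suc k) * x) < 1 / 2) sequentially"
      by (rule order_tendstoD) simp
    then obtain N where N: "\<And>k. k \<ge> N \<Longrightarrow> norm (q ^ k / (1 - q ^ Suc k) * x) < 1 / 2"
      by (auto simp: eventually_sequentially)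
    have "norm (g (Suc k) * x ^ Suc k) \<le> 1 / 2 * norm (g k * x ^ k)" if "k \<ge> N" for k
    proof -
      have "norm (g (Suc k) * x ^ Suc k) = norm (q ^ k / (1 - q ^ Suc k) * x) * norm (g k * x ^ k)"
        by (simp add: gS norm_mult norm_divide mult_ac)
      also have "\<dots> \<le> 1 / 2 * norm (g k * x ^ k)"
        using N[OF that] by (intro mult_right_mono) auto
      finally show ?thesis .
    qed
    then show ?thesis
      by (intro summable_ratio_test[of "1/2" N]) auto
  qed
  then have sums: "(\<lambda>k. g k * x ^ k) sums G x" for x
    by (simp add: G_def summable_sums)
  have "G field_differentiable (at x)" for x
  proof -
    have "G holomorphic_on ball 0 (norm x + 1)"
      by (rule power_series_holomorphic) (use sums in auto)
    then show ?thesis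
      by (rule holomorphic_on_imp_differentiable_at) auto
  qed
  then show "G holomorphic_on UNIV"
    by (simp add: holomorphic_on_def)
  show "G 0 = 1"
    using sums[of 0] powser_sums_zero_iff[of g "G 0"] g0 by simp
  show "G x = (1 - x) * G (q * x)" for x
  proof -
    have rec: "g (Suc k) * x ^ Suc k = g (Suc k) * (q * x) ^ Suc k - x * (g k * (q * x) ^ k)" for k
    proof -
      have "g (Suc k) * (1 - q ^ Suc k) = - (q ^ k) * g k"
        using q1[of k] by (simp add: gS)
      then have "g (Suc k) * (1 - q ^ Suc k) * x ^ Suc k = - (q ^ k) * g k * x ^ Suc k"
        by simp
      then show ?thesis
        by (simp add: power_mult_distrib algebra_simps)
    qed
    have "(\<lambda>k. g (Suc k) * (q * x) ^ Suc k) sums (G (q * x) - 1)"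
      using sums[of "q * x"] sums_Suc_iff[of "\<lambda>k. g k * (q * x) ^ k"] g0 by simp
    then have "(\<lambda>k. g (Suc k) * x ^ Suc k) sums (G (q * x) - 1 - x * G (q * x))"
      unfolding rec by (intro sums_diff sums_mult sums)
    moreover have "(\<lambda>k. g (Suc k) * x ^ Suc k) sums (G x - 1)"
      using sums[of x] sums_Suc_iff[of "\<lambda>k. g k * x ^ k"] g0 by simp
    ultimately have "G x - 1 = G (q * x) - 1 - x * G (q * x)"
      using sums_unique2 by blast
    then show ?thesis by (simp add: algebra_simps)
  qed
qed

text \<open>As long as no factor \<open>1 - q ^ k * x\<close> vanishes, the functional equation
  carries a zero from \<open>x\<close> to \<open>q * x\<close> and on to all
  \<open>q ^ k * x\<close>; these tend to 0, where \<open>G\<close> is 1.\<close>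

lemma q_pochhammer_zero:
  fixes q :: complex
  assumes q: "norm q < 1" and G: "G holomorphic_on UNIV" "G 0 = 1" "\<And>x. G x = (1 - x) * G (q * x)"
    and zero: "G x = 0"
  shows "\<exists>k. q ^ k * x = 1"
proof (rule ccontr)
  assume nz: "\<not> ?thesis"
  have "G (q ^ k * x) = 0" for k
  proof (induction k)
    case (Suc k)
    then have "(1 - q ^ k * x) * G (q * (q ^ k * x)) = 0"
      using G(3)[of "q ^ k * x"] by simp
    then show ?case using nz by (auto simp: mult.assoc)
  qed (use zero in simp)
  moreover have "(\<lambda>k. G (q ^ k * x)) \<longlonglongrightarrow> G (0 * x)"
  proof (rule isCont_tendsto_compose[of _ G])
    show "isCont G (0 * x)"
      using G(1) holomorphic_on_imp_continuous_on continuous_on_eq_continuous_at by blast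
    show "(\<lambda>k. q ^ k * x) \<longlonglongrightarrow> 0 * x"
      by (intro tendsto_intros LIMSEQ_power_zero q)
  qed
  ultimately have "(\<lambda>_. 0) \<longlonglongrightarrow> (1 :: complex)"
    using G(2) by simp
  then show False
    by (simp add: LIMSEQ_const_iff)
qed

lemma exp_eq_1_int: "exp (2 * \<i> * of_real pi * x) = 1 \<Longrightarrow> \<exists>m :: int. x = of_int m"
proof -
  assume "exp (2 * \<i> * of_real pi * x) = 1"
  then obtain m :: int where m: "Re (2 * \<i> * of_real pi * x) = 0" "Im (2 * \<i> * of_real pi * x) = of_int (2 * m) * pi"
    by (auto simp: exp_eq_1)
  have "x = of_int m"
    by (rule complex_eqI) (use m in auto)
  then show ?thesis by blast
qed

text \<open>The Jacobi product without its constant: every zero of \<open>F\<close> is a zero of one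
  of the two factors \<open>G\<close>, hence a lattice point.\<close>

lemma theta_like_exists:
  assumes om: "Im \<omega> > 0"
  obtains F where "theta_like F \<omega>"
proof -
  define e where "e = (\<lambda>u. exp (2 * \<i> * of_real pi * u))"
  define q where "q = e \<omega>"
  have q: "norm q < 1"
    using om by (simp add: q_def e_def)
  obtain G where G: "G holomorphic_on UNIV" "G 0 = 1" "\<And>x. G x = (1 - x) * G (q * x)"
    by (rule q_pochhammer_exists[OF q]) (rule that)
  define F where "F = (\<lambda>u. exp (- \<i> * of_real pi * u) * (G (e u) * G (q * e (- u))))"
  \<comment> \<open>\<open>F\<close> without the factor \<open>1 - e u\<close>. This form shows the
    symmetries and reduces the derivative at 0 to \<open>R 0 \<noteq> 0\<close>.\<close>
  define R where "R = (\<lambda>u. exp (- \<i> * of_real pi * u) * (G (q * e u) * G (q * e (- u))))"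
  have FR: "F u = (1 - e u) * R u" for u
    using G(3)[of "e u"] by (simp add: F_def R_def)
  have G': "(\<lambda>u. G (f u)) holomorphic_on UNIV" if "f holomorphic_on UNIV" for f
    using holomorphic_on_compose_gen[OF that G(1)] by (simp add: o_def)
  have e': "(\<lambda>u. e (f u)) holomorphic_on UNIV" if "f holomorphic_on UNIV" for f
    unfolding e_def by (intro holomorphic_intros that)
  have F': "F holomorphic_on UNIV" and R': "R holomorphic_on UNIV"
    unfolding F_def R_def by (intro holomorphic_intros G' e')+
  have e1: "e (u + 1) = e u" "e (- u - 1) = e (- u)" for u
  proof -
    have "exp (2 * \<i> * of_real pi) = (1 :: complex)"
      using exp_two_pi_i by (simp add: mult_ac)
    then show "e (u + 1) = e u" "e (- u - 1) = e (- u)"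
      by (simp_all add: e_def distrib_left right_diff_distrib exp_add exp_diff)
  qed
  have eom: "e (u + \<omega>) = q * e u" "e (- u) = q * e (- u - \<omega>)" for u
    by (simp_all add: e_def q_def algebra_simps flip: exp_add)
  have eneg: "e (- u) * e u = 1" for u
    by (simp add: e_def flip: exp_add)
  have ehalf: "exp (- \<i> * of_real pi * u) * exp (- \<i> * of_real pi * u) = e (- u)" for u
    by (simp add: e_def algebra_simps flip: exp_add)
  have qk: "q ^ k * e u = e (of_nat k * \<omega> + u)" for k u
    by (simp add: e_def q_def algebra_simps flip: exp_add exp_of_nat_mult)
  have Gq: "G q \<noteq> 0"
  proof
    assume "G q = 0"
    then obtain k where "q ^ k * q = 1"
      using q_pochhammer_zero[OF q G] by blast
    then have "norm q ^ Suc k = 1"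
      by (metis norm_one norm_power power_Suc2)
    then show False
      using q power_less_one_iff[of "norm q" "Suc k"] by auto
  qed
  have "theta_like F \<omega>"
  proof
    show "F (u + 1) = - F u" for u
      by (simp add: F_def e1 distrib_left exp_minus exp_add)
    show "F (u + \<omega>) = - exp (- (\<i> * of_real pi * (\<omega> + 2 * u))) * F u" for u
    proof -
      have c: "exp (- \<i> * of_real pi * (u + \<omega>)) = exp (- (\<i> * of_real pi * (\<omega> + 2 * u))) * (e u * exp (- \<i> * of_real pi * u))"
        by (simp add: e_def algebra_simps flip: exp_add)
      have "F (u + \<omega>) = exp (- \<i> * of_real pi * (u + \<omega>)) * (G (q * e u) * G (e (- u)))"
        using eom[of u] by (simp add: F_def)
      also have "G (e (- u)) = (1 - e (- u)) * G (q * e (- u))"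
        by (rule G(3))
      also have "exp (- \<i> * of_real pi * (u + \<omega>)) * (G (q * e u) * ((1 - e (- u)) * G (q * e (- u))))
          = exp (- (\<i> * of_real pi * (\<omega> + 2 * u))) * ((e u * (1 - e (- u))) * R u)"
        unfolding c R_def by (simp only: mult_ac)
      also have "e u * (1 - e (- u)) = - (1 - e u)"
        using eneg[of u] by (simp add: algebra_simps)
      finally show ?thesis by (simp only: FR[of u] mult_minus_left mult_minus_right)
    qed
    show "F (- u) = - F u" for u
    proof -
      have "R (- u) = e u * R u"
      proof -
        have "exp (- \<i> * of_real pi * - u) = e u * exp (- \<i> * of_real pi * u)"
          by (simp add: e_def algebra_simps flip: exp_add)
        then show ?thesis by (simp add: R_def mult_ac)
      qed
      then have "F (- u) = (e u * (1 - e (- u))) * R u"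
        by (simp add: FR)
      also have "e u * (1 - e (- u)) = - (1 - e u)"
        using eneg[of u] by (simp add: algebra_simps)
      finally show ?thesis by (simp only: FR[of u] mult_minus_left mult_minus_right)
    qed
    show "\<exists>m k :: int. u = of_int m + of_int k * \<omega>" if F0: "F u = 0" for u
    proof -
      have "G (e u) = 0 \<or> G (q * e (- u)) = 0"
        using F0 by (simp add: F_def)
      then show ?thesis
      proof
        assume "G (e u) = 0"
        then obtain k where "e (of_nat k * \<omega> + u) = 1"
          using q_pochhammer_zero[OF q G] qk by metis
        then obtain m :: int where "of_nat k * \<omega> + u = of_int m"
          using exp_eq_1_int by (auto simp: e_def)
        then have "u = of_int m + of_int (- int k) * \<omega>"
          by (simp add: algebra_simps)
        then show ?thesis by blast
      next
        assume "G (q * e (- u)) = 0"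
        then obtain k where "q ^ k * (q * e (- u)) = 1"
          using q_pochhammer_zero[OF q G] by blast
        then have "e (of_nat (Suc k) * \<omega> + - u) = 1"
          using qk[of "Suc k" "- u"] by (simp add: mult_ac)
        then obtain m :: int where "of_nat (Suc k) * \<omega> + - u = of_int m"
          using exp_eq_1_int unfolding e_def by blast
        then have "u = of_int (- m) + of_int (int (Suc k)) * \<omega>"
          by (simp add: algebra_simps)
        then show ?thesis by blast
      qed
    qed
    show "deriv F 0 \<noteq> 0"
    proof -
      have "((\<lambda>u. 1 - e u) has_field_derivative - (2 * \<i> * of_real pi)) (at 0)"
        unfolding e_def by (auto intro!: derivative_eq_intros)
      moreover have "(R has_field_derivative deriv R 0) (at 0)"
        using R' holomorphic_derivI by blast
      ultimately have "((\<lambda>u. (1 - e u) * R u) has_field_derivative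
          - (2 * \<i> * of_real pi) * R 0 + deriv R 0 * (1 - e 0)) (at 0)"
        by (rule DERIV_mult)
      then have "deriv F 0 = - (2 * \<i> * of_real pi) * R 0 + deriv R 0 * (1 - e 0)"
        by (intro DERIV_imp_deriv) (simp flip: FR)
      then show ?thesis
        using Gq by (simp add: R_def e_def)
    qed
  qed (use om F' in auto)
  then show ?thesis by (rule that)
qed

section \<open>Identification of the theta series with the product\<close>

lemma theta_like_scale:
  assumes F: "theta_like F \<omega>" and c: "c \<noteq> 0"
  shows "theta_like (\<lambda>u. c * F u) \<omega>"
proof -
  interpret F: theta_like F \<omega> by fact
  show ?thesis
  proof
    have "((\<lambda>u. c * F u) has_field_derivative c * deriv F 0) (at 0)"
      by (intro DERIV_cmult F.has_deriv)
    then show "deriv (\<lambda>u. c * F u) 0 \<noteq> 0"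
      using c F.deriv0 by (simp add: DERIV_imp_deriv)
  qed (use c F.Im_pos F.hol F.plus1 F.plus_period F.odd F.zeroD in \<open>auto intro: holomorphic_intros\<close>)
qed

text \<open>The terms with \<open>m = n\<close> and \<open>m = - 1 - n\<close> for natural
  \<open>n\<close> form two power series in the squares of
  \<open>exp (\<i> * of_real pi * u)\<close> and of its inverse. Summability, holomorphy and oddness
  of the theta series follow from this form, and \<open>P 0 \<noteq> 0\<close> keeps it from
  vanishing identically.\<close>

lemma theta_char_half_expansion:
  assumes om: "Im \<omega> > 0"
  obtains P where "P holomorphic_on UNIV" "P 0 \<noteq> 0"
    "\<And>u. ((\<lambda>m::int. exp (\<i> * of_real pi * ((of_int m + 1/2)\<^sup>2 * \<omega> + 2 * (of_int m + 1/2) * (u + 1/2))))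
        has_sum (exp (\<i> * of_real pi * u) * P (exp (\<i> * of_real pi * u) ^ 2)
          - exp (- (\<i> * of_real pi * u)) * P (exp (- (\<i> * of_real pi * u)) ^ 2))) UNIV"
proof -
  \<comment> \<open>The factor \<open>\<i> * (-1) ^ n\<close> is
    \<open>exp (\<i> * of_real pi * (of_nat n + 1/2))\<close>, the contribution of the second
    characteristic 1/2.\<close>
  define a where "a = (\<lambda>n::nat. \<i> * (-1) ^ n * exp (\<i> * of_real pi * (of_nat n + 1/2)\<^sup>2 * \<omega>))"
  define P where "P = (\<lambda>x. suminf (\<lambda>n. a n * x ^ n))"
  define y where "y = exp (- 2 * pi * Im \<omega>)"
  have y: "0 < y" "y < 1"
    using om by (auto simp: y_def)
  have aS: "norm (a (Suc n)) = y ^ Suc n * norm (a n)" for n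
  proof -
    have "a (Suc n) = - (exp (2 * \<i> * of_real pi * \<omega>) ^ Suc n) * a n"
      by (simp add: a_def power2_eq_square algebra_simps flip: exp_of_nat_mult exp_add)
    moreover have "norm (exp (2 * \<i> * of_real pi * \<omega>)) = y"
      by (simp add: y_def)
    ultimately show ?thesis
      by (simp add: norm_mult norm_power)
  qed
  have summ: "summable (\<lambda>n. norm (a n * x ^ n))" for x
  proof -
    have "(\<lambda>n. y ^ Suc n * norm x) \<longlonglongrightarrow> 0 * norm x"
      using y by (intro tendsto_intros LIMSEQ_Suc LIMSEQ_power_zero) auto
    then have "eventually (\<lambda>n. y ^ Suc n * norm x < 1 / 2) sequentially"
      by (rule order_tendstoD) simp
    then obtain N where N: "\<And>n. n \<ge> N \<Longrightarrow> y ^ Suc n * norm x < 1 / 2"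
      by (auto simp: eventually_sequentially)
    have "norm (norm (a (Suc n) * x ^ Suc n)) \<le> 1 / 2 * norm (norm (a n * x ^ n))" if "n \<ge> N" for n
    proof -
      have "norm (norm (a (Suc n) * x ^ Suc n)) = (y ^ Suc n * norm x) * norm (a n * x ^ n)"
        using y by (simp add: norm_mult aS abs_mult mult_ac)
      also have "\<dots> \<le> 1 / 2 * norm (a n * x ^ n)"
        using N[OF that] by (intro mult_right_mono) auto
      finally show ?thesis by simp
    qed
    then show ?thesis
      by (intro summable_ratio_test[of "1/2" N]) auto
  qed
  have sums: "(\<lambda>n. a n * x ^ n) sums P x" for x
    using summable_norm_cancel[OF summ] by (simp add: P_def summable_sums)
  have "P field_differentiable (at x)" for x
  proof -
    have "P holomorphic_on ball 0 (norm x + 1)"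
      by (rule power_series_holomorphic) (use sums in auto)
    then show ?thesis
      by (rule holomorphic_on_imp_differentiable_at) auto
  qed
  then have holP: "P holomorphic_on UNIV"
    by (simp add: holomorphic_on_def)
  have P0: "P 0 \<noteq> 0"
    using sums[of 0] powser_sums_zero_iff[of a "P 0"] by (auto simp: a_def)
  have hs: "((\<lambda>n. X * (a n * (X ^ 2) ^ n)) has_sum (X * P (X ^ 2))) UNIV" for X
    using norm_summable_imp_has_sum[OF summ sums] by (rule has_sum_cmult_right)
  define t where "t = (\<lambda>u (m::int). exp (\<i> * of_real pi * ((of_int m + 1/2)\<^sup>2 * \<omega> + 2 * (of_int m + 1/2) * (u + 1/2))))"
  have i_exp: "\<i> = exp (\<i> * of_real pi / 2)"
    by (simp add: exp_eq_polar cis_pi_half)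
  have m1_exp: "(-1) ^ n = exp (of_nat n * (\<i> * of_real pi))" for n
    by (simp only: exp_of_nat_mult) simp
  have m1_exp': "(-1) ^ n = exp (- of_nat n * (\<i> * of_real pi))" for n
    by (simp only: minus_mult_left[symmetric] exp_minus m1_exp[symmetric]) (cases "even n"; simp)
  have t_pos: "t u (int n) = exp (\<i> * of_real pi * u) * (a n * (exp (\<i> * of_real pi * u) ^ 2) ^ n)" for u n
    unfolding t_def a_def m1_exp
    by (subst (3) i_exp) (simp add: power2_eq_square algebra_simps flip: exp_of_nat_mult exp_add power_mult)
  have t_neg: "t u (- 1 - int n) = - (exp (- (\<i> * of_real pi * u)) * (a n * (exp (- (\<i> * of_real pi * u)) ^ 2) ^ n))" for u n
  proof -
    have "- \<i> = exp (- (\<i> * of_real pi / 2))"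
      by (simp only: exp_minus i_exp[symmetric]) simp
    moreover have "- (x * (\<i> * m * E * z)) = - \<i> * m * E * (x * z)" for x m E z
      by simp
    ultimately show ?thesis
      unfolding t_def a_def m1_exp'
      by (simp only:) (simp add: power2_eq_square algebra_simps flip: exp_of_nat_mult exp_add power_mult)
  qed
  have range: "range int \<union> range (\<lambda>n. - 1 - int n) = UNIV"
  proof (intro equalityI subsetI)
    fix m :: int
    show "m \<in> range int \<union> range (\<lambda>n. - 1 - int n)"
    proof (cases "m \<ge> 0")
      case True
      then show ?thesis by (metis UnI1 nonneg_int_cases rangeI)
    next
      case False
      then have "m = - 1 - int (nat (- 1 - m))" by simp
      then show ?thesis by blast
    qed
  qed auto
  have "(t u has_sum (exp (\<i> * of_real pi * u) * P (exp (\<i> * of_real pi * u) ^ 2)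
          - exp (- (\<i> * of_real pi * u)) * P (exp (- (\<i> * of_real pi * u)) ^ 2))) UNIV" for u
  proof -
    have "(t u has_sum (exp (\<i> * of_real pi * u) * P (exp (\<i> * of_real pi * u) ^ 2))) (range int)"
      using hs[of "exp (\<i> * of_real pi * u)"] by (subst has_sum_reindex) (auto simp: o_def t_pos)
    moreover have "(t u has_sum - (exp (- (\<i> * of_real pi * u)) * P (exp (- (\<i> * of_real pi * u)) ^ 2)))
        (range (\<lambda>n. - 1 - int n))"
      using hs[of "exp (- (\<i> * of_real pi * u))"]
      by (subst has_sum_reindex) (auto simp: o_def t_neg inj_on_def has_sum_uminus)
    ultimately show ?thesis
      using has_sum_Un_disjoint[of "t u" "range int" _ "range (\<lambda>n. - 1 - int n)"] range by fastforce
  qed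
  then show ?thesis
    using that[OF holP P0] by (simp add: t_def)
qed

text \<open>The series has the multipliers of the Jacobi product and vanishes at 0, so their
  quotient is entire and elliptic, hence a constant, which is nonzero because the series is.\<close>

lemma theta_char_half_theta_like:
  assumes om: "Im \<omega> > 0"
  shows "theta_like (\<lambda>u. theta_char (1/2) (1/2) u \<omega>) \<omega>"
proof -
  define T where "T = (\<lambda>u. theta_char (1/2) (1/2) u \<omega>)"
  define e where "e = (\<lambda>u. exp (\<i> * of_real pi * u))"
  obtain P where P: "P holomorphic_on UNIV" "P 0 \<noteq> 0"
    and hs: "\<And>u. ((\<lambda>m::int. exp (\<i> * of_real pi * ((of_int m + 1/2)\<^sup>2 * \<omega> + 2 * (of_int m + 1/2) * (u + 1/2))))
        has_sum (exp (\<i> * of_real pi * u) * P (exp (\<i> * of_real pi * u) ^ 2)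
          - exp (- (\<i> * of_real pi * u)) * P (exp (- (\<i> * of_real pi * u)) ^ 2))) UNIV"
    by (rule theta_char_half_expansion[OF om]) (rule that)
  define K where "K = (\<lambda>x. x * P (x ^ 2))"
  have T: "T u = K (e u) - K (e (- u))" for u
    using infsumI[OF hs[of u]] by (simp add: T_def theta_char_def K_def e_def)
  have sq: "(\<lambda>x :: complex. x ^ 2) holomorphic_on UNIV"
    by (intro holomorphic_intros)
  have Psq: "(\<lambda>x. P (x ^ 2)) holomorphic_on UNIV"
    using holomorphic_on_compose_gen[OF sq P(1)] by (simp add: o_def)
  have K: "K holomorphic_on UNIV"
    unfolding K_def by (intro holomorphic_intros Psq)
  have Ke: "(\<lambda>u. K (f u)) holomorphic_on UNIV" if "f holomorphic_on UNIV" for f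
    using holomorphic_on_compose_gen[OF that K] by (simp add: o_def)
  have T_hol: "T holomorphic_on UNIV"
    unfolding T e_def by (intro holomorphic_intros Ke)
  have T1: "T (u + 1) = - 1 * T u" for u
  proof -
    have "e (u + 1) = - e u" "e (- u - 1) = - e (- u)"
      by (simp_all add: e_def distrib_left right_diff_distrib exp_add exp_diff)
    then show ?thesis by (simp add: T K_def)
  qed
  have T2: "T (u + \<omega>) = - exp (- (\<i> * of_real pi * (\<omega> + 2 * u))) * T u" for u
  proof -
    define t where "t = (\<lambda>u (m::int). exp (\<i> * of_real pi * ((of_int m + 1/2)\<^sup>2 * \<omega> + 2 * (of_int m + 1/2) * (u + 1/2))))"
    have bij: "bij_betw (\<lambda>m::int. m + 1) UNIV UNIV"
      by (rule bij_betwI[where g = "\<lambda>m. m - 1"]) auto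
    have m1: "exp (- (\<i> * of_real pi)) = - 1"
      by (simp add: exp_minus)
    have "t (u + \<omega>) m = exp (- (\<i> * of_real pi * (\<omega> + 2 * u))) * exp (- (\<i> * of_real pi)) * t u (m + 1)" for m
      by (simp add: t_def power2_eq_square algebra_simps add_divide_distrib flip: exp_add)
    then have "t (u + \<omega>) = (\<lambda>m. - exp (- (\<i> * of_real pi * (\<omega> + 2 * u))) * t u (m + 1))"
      by (simp only: m1 fun_eq_iff) simp
    then have "infsum (t (u + \<omega>)) UNIV = - exp (- (\<i> * of_real pi * (\<omega> + 2 * u))) * infsum (\<lambda>m. t u (m + 1)) UNIV"
      by (simp only: infsum_cmult_right')
    also have "infsum (\<lambda>m. t u (m + 1)) UNIV = infsum (t u) UNIV"
      by (rule infsum_reindex_bij_betw[OF bij])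
    finally show ?thesis by (simp add: T_def theta_char_def t_def)
  qed
  \<comment> \<open>If \<open>T\<close> vanished identically, \<open>K\<close> would take the same
    value at \<open>x\<close> and \<open>1 / x\<close>, so it would be bounded by its values on the
    unit disc and constant; but \<open>K x = x * P (x ^ 2)\<close> with
    \<open>P 0 \<noteq> 0\<close>.\<close>
  have "\<exists>u. T u \<noteq> 0"
  proof (rule ccontr)
    assume T0: "\<not> ?thesis"
    then have inv: "K x = K (inverse x)" if "x \<noteq> 0" for x
    proof -
      have "e (Ln x / (\<i> * of_real pi)) = x" "e (- (Ln x / (\<i> * of_real pi))) = inverse x"
        using that by (simp_all add: e_def exp_minus)
      then show ?thesis
        using T[of "Ln x / (\<i> * of_real pi)"] T0 by auto
    qed
    have "bounded (K ` cball 0 1)"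
      by (intro compact_imp_bounded compact_continuous_image holomorphic_on_imp_continuous_on
          holomorphic_on_subset[OF K]) auto
    moreover have "range K \<subseteq> K ` cball 0 1"
    proof
      fix z assume "z \<in> range K"
      then obtain x where x: "z = K x" by auto
      show "z \<in> K ` cball 0 1"
      proof (cases "norm x \<le> 1")
        case False
        then have "x \<noteq> 0" "norm (inverse x) \<le> 1"
          by (auto simp: norm_inverse inverse_le_1_iff)
        then show ?thesis using x inv[of x] by auto
      qed (use x in auto)
    qed
    ultimately have "bounded (range K)"
      using bounded_subset by blast
    then obtain c where c: "\<And>x. K x = c"
      using Liouville_theorem[OF K] by (auto simp: constant_on_def)
    have "K 0 = 0" by (simp add: K_def)
    then have "P (x ^ 2) * x = 0" for x
      using c[of x] c[of 0] by (auto simp: K_def)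
    from entire_mult_eq_0[OF Psq holomorphic_on_ident this, of 1 0]
    have "P (0 ^ 2) = 0" by simp
    then show False using P(2) by simp
  qed
  then obtain u0 where u0: "T u0 \<noteq> 0" by blast
  obtain F where F: "theta_like F \<omega>"
    using theta_like_exists[OF om] by blast
  then interpret F: theta_like F \<omega> .
  have T2': "T (u + \<omega>) = - exp (- (\<i> * of_real pi * \<omega>)) * exp (- 2 * \<i> * of_real pi * 1 * u) * T u" for u
  proof -
    have "exp (- (\<i> * of_real pi * (\<omega> + 2 * u))) = exp (- (\<i> * of_real pi * \<omega>)) * exp (- 2 * \<i> * of_real pi * 1 * u)"
      by (simp add: algebra_simps flip: exp_add)
    then show ?thesis by (simp add: T2)
  qed
  have T0: "T 0 = 0" by (simp add: T)
  obtain g where g: "g holomorphic_on UNIV" and Tg: "\<And>u. T u = F (u - 0) * g u"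
    and g1: "\<And>u. g (u + 1) = - (- 1) * g u"
    and g2: "\<And>u. g (u + \<omega>) = - (- exp (- (\<i> * of_real pi * \<omega>))) * exp (\<i> * of_real pi * (\<omega> - 2 * 0))
        * exp (- 2 * \<i> * of_real pi * (1 - 1) * u) * g u"
    by (rule F.divide_zero[OF T_hol T1 T2' T0]) (rule that)
  have "g (u + \<omega>) = g u" for u
    using g2[of u] by (simp flip: exp_add)
  then have "g u = g u0" for u
    using elliptic_entire_const[OF om g] g1 by simp
  then have "T u = g u0 * F u" for u
    using Tg[of u] by (simp add: mult.commute)
  moreover have "g u0 \<noteq> 0"
    using u0 Tg[of u0] by auto
  ultimately have "theta_like T \<omega>"
    using theta_like_scale[OF F, of "g u0"] by (metis (no_types, lifting) ext)
  then show ?thesis by (simp add: T_def)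
qed

section \<open>The theta functions of the R-matrix\<close>

text \<open>Changing the characteristic by \<open>j / n\<close> at period n \<tau> amounts to a
  translation by j \<tau>. Thus zeros and multipliers for every index come from index 0.\<close>

lemma theta_j_eq_shift:
  assumes n: "n > 0"
  shows "theta_j n \<tau> j u = exp (\<i> * of_real pi * (of_int j ^ 2 * \<tau> - 2 * of_int j * (u + 1/2)) / of_nat n)
    * theta_j n \<tau> 0 (u - of_int j * \<tau>)"
proof -
  have "exp (\<i> * of_real pi * ((of_int m + (1/2 - of_int j / of_nat n))\<^sup>2 * (of_nat n * \<tau>) + 2 * (of_int m + (1/2 - of_int j / of_nat n)) * (u + 1/2)))
     = exp (\<i> * of_real pi * (of_int j ^ 2 * \<tau> - 2 * of_int j * (u + 1/2)) / of_nat n)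
      * exp (\<i> * of_real pi * ((of_int m + (1/2 - of_int 0 / of_nat n))\<^sup>2 * (of_nat n * \<tau>) + 2 * (of_int m + (1/2 - of_int 0 / of_nat n)) * (u - of_int j * \<tau> + 1/2)))" for m
    using n unfolding exp_add[symmetric]
    by (intro arg_cong[of _ _ exp]) (simp add: field_simps power2_eq_square)
  then show ?thesis
    by (simp only: theta_j_def theta_char_def infsum_cmult_right')
qed

lemma prod_residues_reindex:
  fixes f :: "int \<Rightarrow> 'a::comm_monoid_mult"
  assumes n: "n > 0" and f: "\<And>a b. [a = b] (mod int n) \<Longrightarrow> f a = f b"
    and g: "\<And>a b. [g a = g b] (mod int n) \<Longrightarrow> [a = b] (mod int n)"
  shows "(\<Prod>j=0..<n. f (g (int j))) = (\<Prod>j=0..<n. f (int j))"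
proof -
  define r where "r = (\<lambda>j. nat (g (int j) mod int n))"
  have r: "r j < n" "[int (r j) = g (int j)] (mod int n)" for j
    using n by (auto simp: r_def nat_less_iff)
  have "inj_on r {0..<n}"
  proof (rule inj_onI)
    fix i j assume ij: "i \<in> {0..<n}" "j \<in> {0..<n}" and "r i = r j"
    then have "[g (int i) = g (int j)] (mod int n)"
      using r(2)[of i] r(2)[of j] by (metis cong_sym cong_trans)
    then show "i = j"
      using g[of "int i" "int j"] ij by (simp add: cong_def)
  qed
  moreover from this have "r ` {0..<n} = {0..<n}"
    using r(1) by (intro endo_inj_surj) auto
  ultimately have "bij_betw r {0..<n} {0..<n}"
    by (simp add: bij_betw_def)
  from prod.reindex_bij_betw[OF this, of "\<lambda>j. f (int j)"]
  have "(\<Prod>j=0..<n. f (int (r j))) = (\<Prod>j=0..<n. f (int j))" .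
  then show ?thesis
    using f[OF r(2)] by simp
qed

locale theta_setting =
  fixes n :: nat and \<tau> :: complex
  assumes n_pos: "n > 0" and Im_tau: "Im \<tau> > 0"
begin

abbreviation \<theta> :: "int \<Rightarrow> complex \<Rightarrow> complex" where "\<theta> \<equiv> theta_j n \<tau>"
abbreviation h :: "complex \<Rightarrow> complex" where "h \<equiv> h_fun n \<tau>"
text \<open>\<open>v k z\<close> is component \<open>k\<close> of the vector phi(z) of the
  overview.\<close>

abbreviation v :: "int \<Rightarrow> complex \<Rightarrow> complex" where "v \<equiv> theta_bar n \<tau>"

lemma theta0: "theta_like (\<theta> 0) (of_nat n * \<tau>)"
  using theta_char_half_theta_like[of "of_nat n * \<tau>"] n_pos Im_tau by (simp add: theta_j_def[abs_def])

sublocale th: theta_like "\<theta> 0" "of_nat n * \<tau>"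
  by (rule theta0)

lemmas theta_cong = theta_j_cong[OF n_pos]

lemma theta_shift: "\<theta> j u = exp (\<i> * of_real pi * (of_int j ^ 2 * \<tau> - 2 * of_int j * (u + 1/2)) / of_nat n)
    * \<theta> 0 (u - of_int j * \<tau>)"
  by (rule theta_j_eq_shift[OF n_pos])

lemma theta_holomorphic [holomorphic_intros]: "f holomorphic_on A \<Longrightarrow> (\<lambda>z. \<theta> j (f z)) holomorphic_on A"
  by (subst theta_shift) (intro holomorphic_intros; use n_pos in simp)

lemma theta_plus_tau:
  "\<theta> j (u + of_int l * \<tau>) = exp (- (\<i> * of_real pi * (of_int l ^ 2 * \<tau> + 2 * of_int l * u + of_int l) / of_nat n)) * \<theta> (j - l) u"
proof -
  have "exp (\<i> * of_real pi * (of_int j ^ 2 * \<tau> - 2 * of_int j * (u + of_int l * \<tau> + 1/2)) / of_nat n)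
    = exp (- (\<i> * of_real pi * (of_int l ^ 2 * \<tau> + 2 * of_int l * u + of_int l) / of_nat n))
      * exp (\<i> * of_real pi * (of_int (j - l) ^ 2 * \<tau> - 2 * of_int (j - l) * (u + 1/2)) / of_nat n)"
    using n_pos unfolding exp_add[symmetric]
    by (intro arg_cong[of _ _ exp]) (simp add: field_simps power2_eq_square)
  moreover have "u + of_int l * \<tau> - of_int j * \<tau> = u - of_int (j - l) * \<tau>"
    by (simp add: algebra_simps)
  ultimately show ?thesis
    by (simp only: theta_shift[of j "u + of_int l * \<tau>"] theta_shift[of "j - l" u] mult.assoc)
qed

lemma theta_plus_1: "\<theta> j (u + 1) = - exp (- (2 * \<i> * of_real pi * of_int j / of_nat n)) * \<theta> j u"
proof -
  have "exp (\<i> * of_real pi * (of_int j ^ 2 * \<tau> - 2 * of_int j * (u + 1 + 1/2)) / of_nat n)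
    = exp (- (2 * \<i> * of_real pi * of_int j / of_nat n))
      * exp (\<i> * of_real pi * (of_int j ^ 2 * \<tau> - 2 * of_int j * (u + 1/2)) / of_nat n)"
    using n_pos unfolding exp_add[symmetric]
    by (intro arg_cong[of _ _ exp]) (simp add: field_simps power2_eq_square)
  moreover have "\<theta> 0 (u + 1 - of_int j * \<tau>) = - \<theta> 0 (u - of_int j * \<tau>)"
    using th.plus1[of "u - of_int j * \<tau>"] by (simp add: algebra_simps)
  ultimately show ?thesis
    using theta_shift[of j "u + 1"] theta_shift[of j u] by (simp add: mult.assoc)
qed

lemma theta_minus: "\<theta> j (- u) = - exp (- (2 * \<i> * of_real pi * of_int j / of_nat n)) * \<theta> (- j) u"
proof -
  have "exp (\<i> * of_real pi * (of_int j ^ 2 * \<tau> - 2 * of_int j * (- u + 1/2)) / of_nat n)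
    = exp (- (2 * \<i> * of_real pi * of_int j / of_nat n))
      * exp (\<i> * of_real pi * (of_int (- j) ^ 2 * \<tau> - 2 * of_int (- j) * (u + 1/2)) / of_nat n)"
    using n_pos unfolding exp_add[symmetric]
    by (intro arg_cong[of _ _ exp]) (simp add: field_simps power2_eq_square)
  moreover have "\<theta> 0 (- u - of_int j * \<tau>) = - \<theta> 0 (u - of_int (- j) * \<tau>)"
    using th.odd[of "u + of_int j * \<tau>"] by (simp add: algebra_simps)
  ultimately show ?thesis
    using theta_shift[of j "- u"] theta_shift[of "- j" u] by (simp add: mult.assoc)
qed

lemma theta_eq_0_iff: "\<theta> j u = 0 \<longleftrightarrow> \<theta> 0 (u - of_int j * \<tau>) = 0"
  by (subst theta_shift) simp

lemma theta_eq_0D: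
  assumes "\<theta> j u = 0"
  obtains m k :: int where "u = of_int m + of_int (j + k * int n) * \<tau>"
proof -
  from assms obtain m k :: int where "u - of_int j * \<tau> = of_int m + of_int k * (of_nat n * \<tau>)"
    using theta_eq_0_iff th.zeroD by blast
  then have "u = of_int m + of_int (j + k * int n) * \<tau>"
    by (simp add: algebra_simps)
  then show ?thesis by (rule that)
qed

lemma theta_zero_tau: "\<theta> j (of_int j * \<tau>) = 0"
  by (simp add: theta_eq_0_iff)

lemma theta_at_0: "\<not> [j = 0] (mod int n) \<Longrightarrow> \<theta> j 0 \<noteq> 0"
proof
  assume j: "\<not> [j = 0] (mod int n)" and "\<theta> j 0 = 0"
  then obtain m k :: int where mk: "0 = of_int m + of_int (j + k * int n) * \<tau>"
    by (elim theta_eq_0D)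
  then have "Im (of_int m + of_int (j + k * int n) * \<tau>) = 0"
    by simp
  then have "of_int (j + k * int n) * Im \<tau> = 0"
    by (simp only: plus_complex.simps times_complex.simps complex_Re_of_int complex_Im_of_int)
  then have "of_int (j + k * int n) = (0 :: real)"
    using Im_tau by simp
  then have "j + k * int n = 0"
    unfolding of_int_eq_0_iff .
  then have "j = int n * - k"
    by (simp add: mult.commute)
  then show False
    using j by (simp add: cong_0_iff)
qed

section \<open>The product of all the theta functions\<close>

definition h_den :: complex where "h_den = (\<Prod>j=1..<n. \<theta> (int j) 0)"

lemma h_den_nz: "h_den \<noteq> 0"
proof -
  have "\<theta> (int j) 0 \<noteq> 0" if j: "j \<in> {1..<n}" for j
  proof (rule theta_at_0)
    have "\<not> n dvd j"
      using j dvd_imp_le[of n j] by auto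
    then show "\<not> [int j = 0] (mod int n)"
      by (simp add: cong_0_iff)
  qed
  then show ?thesis
    by (simp add: h_den_def)
qed

lemma h_eq: "h u = (\<Prod>j=0..<n. \<theta> (int j) u) / h_den"
  by (simp add: h_fun_def h_den_def)

lemma sum_residues: "(\<Sum>j=0..<n. of_int (int j) :: complex) = of_nat n * (of_nat n - 1) / 2"
  by (induction n) (auto simp: field_simps)

text \<open>Translation by \<tau> permutes the factors cyclically, so \<tau> becomes a quasi-period
  although each factor has only n \<tau>. Under translation by 1 the n signs and the product of the
  characters, \<open>(-1) ^ (n - 1)\<close>, combine to -1. The simple zero at 0 stems from the
  factor of index 0 alone.\<close>

lemma h_theta_like: "theta_like h \<tau>"
proof
  show "Im \<tau> > 0" by (rule Im_tau)
  show "h holomorphic_on UNIV"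
    unfolding h_eq using h_den_nz by (intro holomorphic_intros) auto
  have ex: "(\<Prod>j=0..<n. - exp (- (2 * \<i> * of_real pi * of_int (int j) / of_nat n))) = - 1"
  proof -
    have "(\<Prod>j=0..<n. - exp (- (2 * \<i> * of_real pi * of_int (int j) / of_nat n)))
        = (-1) ^ n * exp (\<Sum>j=0..<n. - (2 * \<i> * of_real pi * of_int (int j) / of_nat n))"
      by (simp add: exp_sum prod_uminus)
    also have "(\<Sum>j=0..<n. - (2 * \<i> * of_real pi * of_int (int j) / of_nat n)) = - (2 * \<i> * of_real pi / of_nat n) * (\<Sum>j=0..<n. of_int (int j))"
      unfolding sum_distrib_left by (intro sum.cong) auto
    also have "\<dots> = - (of_nat (n - 1) * (\<i> * of_real pi))"
      unfolding sum_residues using n_pos by (simp add: of_nat_diff)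
    also have "exp (- (of_nat (n - 1) * (\<i> * of_real pi))) = (-1) ^ (n - 1)"
      by (simp only: exp_minus exp_of_nat_mult exp_pi_i') (cases "even (n - 1)"; simp)
    finally show ?thesis
      using n_pos by (cases n) (auto simp flip: power_add mult_2)
  qed
  show "h (u + 1) = - h u" for u
    unfolding h_eq theta_plus_1 prod.distrib ex by simp
  show "h (u + \<tau>) = - exp (- (\<i> * of_real pi * (\<tau> + 2 * u))) * h u" for u
  proof -
    have "(\<Prod>j=0..<n. \<theta> (int j) (u + \<tau>))
        = (\<Prod>j=0..<n. exp (- (\<i> * of_real pi * (\<tau> + 2 * u + 1) / of_nat n)) * \<theta> (int j - 1) u)"
      using theta_plus_tau[of _ u 1] by simp
    also have "\<dots> = exp (- (\<i> * of_real pi * (\<tau> + 2 * u + 1) / of_nat n)) ^ n * (\<Prod>j=0..<n. \<theta> (int j - 1) u)"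
      by (simp add: prod.distrib)
    also have "exp (- (\<i> * of_real pi * (\<tau> + 2 * u + 1) / of_nat n)) ^ n = exp (- (\<i> * of_real pi * (\<tau> + 2 * u))) * exp (- (\<i> * of_real pi))"
      using n_pos unfolding exp_of_nat_mult[symmetric] exp_add[symmetric]
      by (intro arg_cong[of _ _ exp]) (simp add: field_simps)
    also have "exp (- (\<i> * of_real pi)) = - 1"
      by (simp add: exp_minus)
    also have "(\<Prod>j=0..<n. \<theta> (int j - 1) u) = (\<Prod>j=0..<n. \<theta> (int j) u)"
      by (rule prod_residues_reindex[OF n_pos, where f = "\<lambda>j. \<theta> j u" and g = "\<lambda>j. j - 1"])
         (auto intro: theta_cong simp: cong_iff_dvd_diff)
    finally show ?thesis by (simp add: h_eq)
  qed
  show "h (- u) = - h u" for u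
  proof -
    have "(\<Prod>j=0..<n. \<theta> (- int j) u) = (\<Prod>j=0..<n. \<theta> (int j) u)"
      by (rule prod_residues_reindex[OF n_pos, where f = "\<lambda>j. \<theta> j u" and g = "\<lambda>j. - j"])
         (auto intro: theta_cong simp: cong_iff_dvd_diff dvd_diff_commute)
    then show ?thesis
      unfolding h_eq theta_minus prod.distrib ex by simp
  qed
  show "\<exists>m k :: int. u = of_int m + of_int k * \<tau>" if h0: "h u = 0" for u
  proof -
    obtain j where "\<theta> (int j) u = 0"
      using h0 h_den_nz by (auto simp: h_eq)
    then show ?thesis by (elim theta_eq_0D) blast
  qed
  show "deriv h 0 \<noteq> 0"
  proof -
    define R where "R = (\<lambda>u. (\<Prod>j=1..<n. \<theta> (int j) u) / h_den)"
    have h: "h = (\<lambda>u. \<theta> 0 u * R u)"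
      using n_pos by (auto simp: fun_eq_iff h_eq R_def prod.atLeast_Suc_lessThan)
    have "R holomorphic_on UNIV"
      unfolding R_def using h_den_nz by (intro holomorphic_intros) auto
    then have "(R has_field_derivative deriv R 0) (at 0)"
      using holomorphic_derivI by blast
    from DERIV_mult[OF th.has_deriv this]
    have "deriv h 0 = deriv (\<theta> 0) 0 * R 0"
      unfolding h by (intro DERIV_imp_deriv) simp
    moreover have "R 0 = 1"
      using h_den_nz by (simp add: R_def h_den_def)
    ultimately show ?thesis using th.deriv0 by simp
  qed
qed

sublocale h: theta_like h \<tau>
  by (rule h_theta_like)

lemma h_theta_nz: "h u \<noteq> 0 \<Longrightarrow> \<theta> j u \<noteq> 0"
proof
  assume h: "h u \<noteq> 0" and 0: "\<theta> j u = 0"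
  define r where "r = nat (j mod int n)"
  have r: "r < n" "[int r = j] (mod int n)"
    using n_pos by (auto simp: r_def nat_less_iff cong_def)
  then have "\<theta> (int r) u = 0"
    using theta_cong[OF r(2)] 0 by simp
  then show False using h r(1) by (auto simp: h_eq)
qed

lemma h_quot_mult: "h_quot n \<tau> m u * \<theta> m u = h u"
proof -
  define r where "r = nat (m mod int n)"
  have r: "r \<in> {0..<n}" "[int r = m] (mod int n)"
    using n_pos by (auto simp: r_def cong_def nat_less_iff)
  have "[int q = m] (mod int n) \<longleftrightarrow> q = r" if "q < n" for q
    using that r(2) by (auto simp: r_def cong_def)
  then have eq: "{q\<in>{0..<n}. \<not> [int q = m] (mod int n)} = {0..<n} - {r}"
    by auto
  have "(\<Prod>j=0..<n. \<theta> (int j) u) = \<theta> m u * (\<Prod>j\<in>{0..<n} - {r}. \<theta> (int j) u)"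
    using r theta_cong[OF r(2)] by (subst prod.remove[of _ r]) auto
  then show ?thesis
    unfolding h_eq h_quot_def eq h_den_def by simp
qed

lemma h_quot_eq: "h u \<noteq> 0 \<Longrightarrow> h_quot n \<tau> m u = h u / \<theta> m u"
  using h_quot_mult[of m u] h_theta_nz[of u m] by (simp add: field_simps)

lemma h_quot_holomorphic [holomorphic_intros]: "f holomorphic_on A \<Longrightarrow> (\<lambda>z. h_quot n \<tau> m (f z)) holomorphic_on A"
  unfolding h_quot_def h_den_def[symmetric] using h_den_nz by (intro holomorphic_intros) auto

lemma h_quot_zero:
  assumes "\<theta> l u = 0" and "\<not> [l = m] (mod int n)"
  shows "h_quot n \<tau> m u = 0"
proof -
  define r where "r = nat (l mod int n)"
  have r: "r < n" "[int r = l] (mod int n)"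
    using n_pos by (auto simp: r_def cong_def nat_less_iff)
  then have "\<not> [int r = m] (mod int n)"
    using assms(2) cong_trans cong_sym by blast
  moreover have "\<theta> (int r) u = 0"
    using theta_cong[OF r(2)] assms(1) by simp
  ultimately show ?thesis
    using r(1) by (auto simp: h_quot_def)
qed

lemma h_plus_tau: "h (u + of_int l * \<tau>) = exp (- (\<i> * of_real pi * (of_int l ^ 2 * \<tau> + 2 * of_int l * u + of_int l))) * h u"
proof -
  have "(\<Prod>j=0..<n. \<theta> (int j) (u + of_int l * \<tau>))
      = exp (- (\<i> * of_real pi * (of_int l ^ 2 * \<tau> + 2 * of_int l * u + of_int l) / of_nat n)) ^ n * (\<Prod>j=0..<n. \<theta> (int j - l) u)"
    by (simp add: theta_plus_tau prod.distrib)
  also have "exp (- (\<i> * of_real pi * (of_int l ^ 2 * \<tau> + 2 * of_int l * u + of_int l) / of_nat n)) ^ n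
      = exp (- (\<i> * of_real pi * (of_int l ^ 2 * \<tau> + 2 * of_int l * u + of_int l)))"
    using n_pos by (simp flip: exp_of_nat_mult)
  also have "(\<Prod>j=0..<n. \<theta> (int j - l) u) = (\<Prod>j=0..<n. \<theta> (int j) u)"
    by (rule prod_residues_reindex[OF n_pos, where f = "\<lambda>j. \<theta> j u" and g = "\<lambda>j. j - l"])
       (auto intro: theta_cong simp: cong_iff_dvd_diff)
  finally show ?thesis by (simp add: h_eq)
qed

text \<open>This is the value of \<open>h\<close> divided by the theta function of index
  \<open>l\<close> at its removable singularity. It is transported from the value 1 at 0 by
  quasi-periodicity; that relation is known after multiplication by \<open>\<theta> 0 u\<close>, and
  continuation removes this factor.\<close>

lemma h_quot_tau:
  "h_quot n \<tau> l (of_int l * \<tau>) = exp (\<i> * of_real pi * (of_int l ^ 2 * \<tau> + of_int l) / of_nat n)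
     * exp (- (\<i> * of_real pi * (of_int l ^ 2 * \<tau> + of_int l)))"
proof -
  define a where "a = (\<lambda>u. exp (- (\<i> * of_real pi * (of_int l ^ 2 * \<tau> + 2 * of_int l * u + of_int l) / of_nat n)))"
  define b where "b = (\<lambda>u. exp (- (\<i> * of_real pi * (of_int l ^ 2 * \<tau> + 2 * of_int l * u + of_int l))))"
  have "(h_quot n \<tau> l (u + of_int l * \<tau>) * a u - b u * h_quot n \<tau> 0 u) * \<theta> 0 u = 0" for u
  proof -
    have "h_quot n \<tau> l (u + of_int l * \<tau>) * (a u * \<theta> 0 u) = b u * (h_quot n \<tau> 0 u * \<theta> 0 u)"
      using h_quot_mult[of l "u + of_int l * \<tau>"] theta_plus_tau[of l u l] h_plus_tau[of u l] h_quot_mult[of 0 u]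
      by (simp add: a_def b_def)
    then show ?thesis by (simp add: algebra_simps)
  qed
  moreover have "(\<lambda>u. h_quot n \<tau> l (u + of_int l * \<tau>) * a u - b u * h_quot n \<tau> 0 u) holomorphic_on UNIV"
    unfolding a_def b_def using n_pos by (intro holomorphic_intros) auto
  moreover obtain z0 where "\<theta> 0 z0 \<noteq> 0"
    using th.ex_nonzero by blast
  ultimately have "h_quot n \<tau> l (0 + of_int l * \<tau>) * a 0 - b 0 * h_quot n \<tau> 0 0 = 0"
    using entire_mult_eq_0[OF _ th.hol, of "\<lambda>u. h_quot n \<tau> l (u + of_int l * \<tau>) * a u - b u * h_quot n \<tau> 0 u" z0 0] by blast
  moreover have "h_quot n \<tau> 0 0 = 1"
  proof -
    have "{j\<in>{0..<n}. \<not> [int j = 0] (mod int n)} = {1..<n}"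
      by (auto simp: cong_0_iff zdvd_not_zless Suc_le_eq intro: gr0I)
    then show ?thesis
      using h_den_nz by (simp add: h_quot_def h_den_def)
  qed
  ultimately have "h_quot n \<tau> l (of_int l * \<tau>) * a 0 = b 0" by simp
  then have "h_quot n \<tau> l (of_int l * \<tau>) = inverse (a 0) * b 0"
    by (simp add: a_def field_simps)
  then show ?thesis
    by (simp add: a_def b_def exp_minus)
qed

end

section \<open>The vertex-IRF correspondence\<close>

context theta_setting
begin

lemma theta_plus_n_tau: "\<theta> m (u + of_nat n * \<tau>) = - exp (- (\<i> * of_real pi * (of_nat n * \<tau> + 2 * u))) * \<theta> m u"
proof -
  have "exp (- (\<i> * of_real pi * (of_int (int n) ^ 2 * \<tau> + 2 * of_int (int n) * u + of_int (int n)) / of_nat n))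
      = exp (- (\<i> * of_real pi * (of_nat n * \<tau> + 2 * u))) * exp (- (\<i> * of_real pi))"
    using n_pos unfolding exp_add[symmetric]
    by (intro arg_cong[of _ _ exp]) (simp add: field_simps power2_eq_square)
  also have "exp (- (\<i> * of_real pi)) = - 1"
    by (simp add: exp_minus)
  finally show ?thesis
    using theta_plus_tau[of m u "int n"] theta_cong[of "m - int n" m \<tau> u] by (simp add: cong_iff_dvd_diff)
qed

lemma h_plus_n_tau: "h (u + of_nat n * \<tau>) = exp (- (\<i> * of_real pi * (of_nat n ^ 2 * \<tau> + 2 * of_nat n * u + of_nat n))) * h u"
  using h_plus_tau[of u "int n"] by simp

lemma h_minus_n_tau: "h (u - of_nat n * \<tau>) = exp (- (\<i> * of_real pi * (of_nat n ^ 2 * \<tau> - 2 * of_nat n * u - of_nat n))) * h u"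
  using h_plus_tau[of u "- int n"] by simp

lemma residue_representative:
  obtains k where "k \<in> {1..n}" "[int k = a] (mod int n)"
proof
  \<comment> \<open>The shift by 1 represents the residue class of 0 by \<open>n\<close> instead of
    0.\<close>
  define k where "k = nat ((a - 1) mod int n) + 1"
  show "k \<in> {1..n}"
    using n_pos by (auto simp: k_def nat_less_iff Suc_le_eq)
  have "[(a - 1) mod int n + 1 = (a - 1) + 1] (mod int n)"
    by (intro cong_add) (auto simp: cong_def)
  then show "[int k = a] (mod int n)"
    using n_pos by (simp add: k_def add.commute)
qed

text \<open>Multipliers computed away from the poles, where \<open>h\<close> does not vanish, extend
  to the whole plane.\<close>

lemma eq_if_h_nonzero:
  assumes "f holomorphic_on UNIV" "g holomorphic_on UNIV" "\<And>w. h w \<noteq> 0 \<Longrightarrow> f w = g w"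
  shows "f w = g w"
proof -
  obtain z0 where z0: "h z0 \<noteq> 0" using h.ex_nonzero by blast
  have "(f z - g z) * h z = 0" for z
    using assms(3)[of z] by (cases "h z = 0") auto
  then have "f w - g w = 0"
    by (rule entire_mult_eq_0[OF holomorphic_on_diff[OF assms(1,2)] h.hol _ z0])
  then show ?thesis by simp
qed

text \<open>
  For fixed \<open>p\<close>, \<open>q\<close>, \<open>\<xi>\<close> the difference of the two sides is, as a function of \<open>w\<close>, entire and has the
  multipliers of a theta function with a single zero, at a place other than \<open>(i - j) \<tau> - \<xi>\<close>.  As it
  does vanish there, it is zero.
\<close>
lemma vertex_irf_theta_generic:
  fixes i j :: int
  assumes \<xi>: "h \<xi> \<noteq> 0" and w: "h w \<noteq> 0" and q: "\<theta> j q \<noteq> 0" and x: "x = (p - q - \<xi>) / of_nat n"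
  shows "(\<Sum>k=1..n. h \<xi> / \<theta> (int k - j) \<xi> * \<theta> (int k) p
        * (\<theta> (i - j) (\<xi> + w) * \<theta> (i + j - int k) (q + w) / \<theta> (i - int k) w)) * h x
    = h (\<xi> + x) * \<theta> j (p - \<xi>) * \<theta> i (q + \<xi> + w) + h \<xi> * \<theta> j q * (h (x - w) / h w * \<theta> i (p + w))"
proof -
  define c where "c = (\<lambda>k. h \<xi> / \<theta> (int k - j) \<xi> * \<theta> (int k) p)"
  define A where "A = h (\<xi> + x) * \<theta> j (p - \<xi>)"
  define B where "B = h \<xi> * \<theta> j q"
  define T where "T = (\<lambda>k w. \<theta> (i - j) (\<xi> + w) * \<theta> (i + j - int k) (q + w) / \<theta> (i - int k) w)"
  define V where "V = (\<lambda>w. h (x - w) / h w * \<theta> i (p + w))"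
  \<comment> \<open>\<open>\<Phi>0\<close> is the difference of the two sides, with apparent poles
    at the zeros of \<open>h\<close>; \<open>\<Theta>\<close> is \<open>h\<close> times it, written
    with \<open>h_quot\<close> so as to be entire. In these terms \<open>w\<close> is a bound
    variable.\<close>
  define \<Phi>0 where "\<Phi>0 = (\<lambda>w. (\<Sum>k=1..n. c k * T k w) * h x - (A * \<theta> i (q + \<xi> + w) + B * V w))"
  define \<Theta> where "\<Theta> = (\<lambda>w. (\<Sum>k=1..n. c k * (\<theta> (i - j) (\<xi> + w) * \<theta> (i + j - int k) (q + w) * h_quot n \<tau> (i - int k) w)) * h x
      - (A * \<theta> i (q + \<xi> + w) * h w + B * (h (x - w) * \<theta> i (p + w))))"
  have nx: "of_nat n * x = p - q - \<xi>"
    using n_pos by (simp add: x)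
  have \<Theta>_hol: "\<Theta> holomorphic_on UNIV"
    unfolding \<Theta>_def by (intro holomorphic_intros)
  have \<Theta>: "\<Theta> w = h w * \<Phi>0 w" if "h w \<noteq> 0" for w
  proof -
    have "\<theta> (i - j) (\<xi> + w) * \<theta> (i + j - int k) (q + w) * h_quot n \<tau> (i - int k) w = h w * T k w" for k
      using that by (simp add: T_def h_quot_eq)
    then have "\<Theta> w = (\<Sum>k=1..n. c k * (h w * T k w)) * h x - (A * \<theta> i (q + \<xi> + w) * h w + B * (h (x - w) * \<theta> i (p + w)))"
      by (simp add: \<Theta>_def)
    also have "(\<Sum>k=1..n. c k * (h w * T k w)) = h w * (\<Sum>k=1..n. c k * T k w)"
      by (simp add: sum_distrib_left mult_ac)
    also have "h (x - w) * \<theta> i (p + w) = h w * V w"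
      using that by (simp add: V_def)
    finally show ?thesis
      by (simp add: \<Phi>0_def algebra_simps)
  qed
  have \<Phi>0_shift: "\<Phi>0 w' = d * \<Phi>0 w"
    if "\<And>k. T k w' = d * T k w" "\<theta> i (q + \<xi> + w') = d * \<theta> i (q + \<xi> + w)" "V w' = d * V w" for w w' d
  proof -
    have "(\<Sum>k=1..n. c k * T k w') = d * (\<Sum>k=1..n. c k * T k w)"
      using that(1) by (simp add: sum_distrib_left mult_ac)
    then show ?thesis
      using that(2,3) by (simp add: \<Phi>0_def algebra_simps)
  qed
  have frac: "a * X * (b * Y) / (e * Z) = d * (X * Y / Z)" if "a * b = d * e" "e \<noteq> 0" for a b d e X Y Z :: complex
  proof -
    have "a * X * (b * Y) / (e * Z) = (a * b) * (X * Y) / (e * Z)"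
      by (simp add: mult_ac)
    then show ?thesis using that by simp
  qed
  define \<epsilon> where "\<epsilon> = (\<lambda>m::int. exp (- (2 * \<i> * of_real pi * of_int m / of_nat n)))"
  have eps: "\<epsilon> (i - j) * \<epsilon> (i + j - int k) = \<epsilon> i * \<epsilon> (i - int k)" for k
    using n_pos unfolding \<epsilon>_def exp_add[symmetric]
    by (intro arg_cong[of _ _ exp]) (simp add: field_simps)
  have \<Phi>0_1: "\<Phi>0 (w + 1) = - \<epsilon> i * \<Phi>0 w" for w
  proof (rule \<Phi>0_shift)
    have s: "\<theta> m (z + (w + 1)) = - \<epsilon> m * \<theta> m (z + w)" "\<theta> m (w + 1) = - \<epsilon> m * \<theta> m w" for m z
      using theta_plus_1[of m "z + w"] theta_plus_1[of m w] by (simp_all add: \<epsilon>_def add.assoc)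
    show "T k (w + 1) = - \<epsilon> i * T k w" for k
      unfolding T_def s by (rule frac) (use eps[of k] in \<open>auto simp: \<epsilon>_def\<close>)
    show "\<theta> i (q + \<xi> + (w + 1)) = - \<epsilon> i * \<theta> i (q + \<xi> + w)"
      by (rule s)
    have "h (x - (w + 1)) = - h (x - w)"
      using h.plus1[of "x - (w + 1)"] by (simp add: algebra_simps)
    then show "V (w + 1) = - \<epsilon> i * V w"
      by (simp add: V_def s h.plus1)
  qed
  define E where "E = (\<lambda>u. exp (- (\<i> * of_real pi * (of_nat n * \<tau> + 2 * u))))"
  have \<Phi>0_ntau: "\<Phi>0 (w + of_nat n * \<tau>) = - E (q + \<xi> + w) * \<Phi>0 w" for w
  proof (rule \<Phi>0_shift)
    have s: "\<theta> m (z + (w + of_nat n * \<tau>)) = - E (z + w) * \<theta> m (z + w)" "\<theta> m (w + of_nat n * \<tau>) = - E w * \<theta> m w" for m z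
      using theta_plus_n_tau[of m "z + w"] theta_plus_n_tau[of m w] by (simp_all add: E_def add.assoc)
    have "E (\<xi> + w) * E (q + w) = E (q + \<xi> + w) * E w"
      unfolding E_def exp_add[symmetric] by (intro arg_cong[of _ _ exp]) (simp add: algebra_simps)
    then show "T k (w + of_nat n * \<tau>) = - E (q + \<xi> + w) * T k w" for k
      unfolding T_def s by (intro frac) (auto simp: E_def)
    show "\<theta> i (q + \<xi> + (w + of_nat n * \<tau>)) = - E (q + \<xi> + w) * \<theta> i (q + \<xi> + w)"
      by (rule s)
    define H where "H = exp (- (\<i> * of_real pi * (of_nat n ^ 2 * \<tau> + 2 * of_nat n * w + of_nat n)))"
    define H' where "H' = exp (- (\<i> * of_real pi * (of_nat n ^ 2 * \<tau> - 2 * of_nat n * (x - w) - of_nat n)))"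
    have H0: "H \<noteq> 0" by (simp add: H_def)
    have "H' * E (p + w) = E (q + \<xi> + w) * H * exp (2 * of_nat n * of_real pi * \<i>)"
    proof -
      have "2 * of_nat n * x = 2 * (p - q - \<xi>)"
        using nx by (simp add: mult.assoc)
      then have "of_nat n ^ 2 * \<tau> - 2 * of_nat n * (x - w) - of_nat n = of_nat n ^ 2 * \<tau> - 2 * (p - q - \<xi>) + 2 * of_nat n * w - of_nat n"
        by (simp add: algebra_simps)
      then show ?thesis
        unfolding H'_def H_def E_def exp_add[symmetric]
        by (intro arg_cong[of _ _ exp]) (simp only:, simp add: algebra_simps)
    qed
    also have "exp (2 * of_nat n * of_real pi * \<i>) = (1 :: complex)"
      using exp_integer_2pi[of "of_nat n"] by simp
    finally have HE: "H' * E (p + w) = E (q + \<xi> + w) * H" by simp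
    have "h (x - (w + of_nat n * \<tau>)) = H' * h (x - w)"
      using h_minus_n_tau[of "x - w"] by (simp add: H'_def diff_diff_eq)
    moreover have "h (w + of_nat n * \<tau>) = H * h w"
      by (simp add: H_def h_plus_n_tau)
    ultimately have "V (w + of_nat n * \<tau>) = (H' * h (x - w)) / (H * h w) * (- E (p + w) * \<theta> i (p + w))"
      by (simp add: V_def s)
    also have "\<dots> = - (H' * E (p + w)) / H * V w"
      by (simp add: V_def mult_ac)
    also have "\<dots> = - E (q + \<xi> + w) * V w"
      using H0 by (simp add: HE)
    finally show "V (w + of_nat n * \<tau>) = - E (q + \<xi> + w) * V w" .
  qed
  have hol_shift: "(\<lambda>w. f (w + a)) holomorphic_on UNIV" if "f holomorphic_on UNIV" for f :: "complex \<Rightarrow> complex" and a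
    using holomorphic_on_compose_gen[of "\<lambda>w. w + a" UNIV f UNIV] that by (simp add: o_def holomorphic_intros)
  have \<Theta>_1: "\<Theta> (w + 1) = \<epsilon> i * \<Theta> w" for w
  proof (rule eq_if_h_nonzero[where f = "\<lambda>w. \<Theta> (w + 1)" and g = "\<lambda>w. \<epsilon> i * \<Theta> w"])
    show "(\<lambda>w. \<epsilon> i * \<Theta> w) holomorphic_on UNIV"
      by (intro holomorphic_intros \<Theta>_hol)
    show "\<Theta> (w + 1) = \<epsilon> i * \<Theta> w" if "h w \<noteq> 0" for w
      using that by (simp add: \<Theta> \<Phi>0_1 h.plus1)
  qed (rule hol_shift[OF \<Theta>_hol])
  define G where "G = (\<lambda>w. exp (- (\<i> * of_real pi * (of_nat n ^ 2 * \<tau> + 2 * of_nat n * w + of_nat n))) * (- E (q + \<xi> + w)))"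
  have \<Theta>_ntau: "\<Theta> (w + of_nat n * \<tau>) = G w * \<Theta> w" for w
  proof (rule eq_if_h_nonzero[where f = "\<lambda>w. \<Theta> (w + of_nat n * \<tau>)" and g = "\<lambda>w. G w * \<Theta> w"])
    show "(\<lambda>w. G w * \<Theta> w) holomorphic_on UNIV"
      unfolding G_def E_def by (intro holomorphic_intros \<Theta>_hol)
    show "\<Theta> (w + of_nat n * \<tau>) = G w * \<Theta> w" if "h w \<noteq> 0" for w
      using that \<Theta>[of "w + of_nat n * \<tau>"] by (simp add: \<Theta> \<Phi>0_ntau h_plus_n_tau G_def)
  qed (rule hol_shift[OF \<Theta>_hol])
  have lat: "\<Theta> (w + of_int m + of_int t * (of_nat n * \<tau>)) = 0 \<longleftrightarrow> \<Theta> w = 0" for w m t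
    by (rule lattice_shift) (auto simp: \<Theta>_1 \<Theta>_ntau \<epsilon>_def G_def E_def)
  \<comment> \<open>At this zero of \<open>h\<close> all \<open>h_quot\<close> factors vanish except
    the one with \<open>k = k0\<close>, and the surviving term cancels against the passing
    term.\<close>
  have \<Theta>_tau: "\<Theta> (of_int (i - int k0) * \<tau>) = 0" if k0: "k0 \<in> {1..n}" for k0
  proof -
    define l where "l = i - int k0"
    define e where "e = (\<lambda>u. exp (- (\<i> * of_real pi * (of_int l ^ 2 * \<tau> + 2 * of_int l * u + of_int l) / of_nat n)))"
    have s: "\<theta> m (u + of_int l * \<tau>) = e u * \<theta> (m - l) u" for m u
      by (simp add: theta_plus_tau e_def)
    have idx: "i - j - l = int k0 - j" "i + j - int k0 - l = j" "i - l = int k0"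
      by (simp_all add: l_def)
    have hl: "h (of_int l * \<tau>) = 0"
      unfolding h.eq_0_iff by (rule exI[of _ 0], rule exI[of _ l]) simp
    have "h_quot n \<tau> (i - int k) (of_int l * \<tau>) = 0" if "k \<in> {1..n} - {k0}" for k
    proof (rule h_quot_zero[OF theta_zero_tau])
      have "\<not> int n dvd (int k - int k0)"
      proof
        assume "int n dvd (int k - int k0)"
        moreover have "int k - int k0 \<noteq> 0"
          using that by auto
        ultimately have "\<bar>int n\<bar> \<le> \<bar>int k - int k0\<bar>"
          by (rule dvd_imp_le_int[rotated])
        then show False using that k0 by auto
      qed
      then show "\<not> [l = i - int k] (mod int n)"
        by (simp add: l_def cong_iff_dvd_diff)
    qed
    then have "(\<Sum>k=1..n. c k * (\<theta> (i - j) (\<xi> + of_int l * \<tau>) * \<theta> (i + j - int k) (q + of_int l * \<tau>) * h_quot n \<tau> (i - int k) (of_int l * \<tau>)))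
      = c k0 * (\<theta> (i - j) (\<xi> + of_int l * \<tau>) * \<theta> (i + j - int k0) (q + of_int l * \<tau>) * h_quot n \<tau> l (of_int l * \<tau>))"
      using k0 by (subst sum.remove[of _ k0]) (auto simp: l_def)
    also have "\<dots> = c k0 * (e \<xi> * \<theta> (int k0 - j) \<xi> * (e q * \<theta> j q) * h_quot n \<tau> l (of_int l * \<tau>))"
      by (simp only: s idx)
    also have "\<dots> = B * \<theta> (int k0) p * (e \<xi> * e q * h_quot n \<tau> l (of_int l * \<tau>))"
      using h_theta_nz[OF \<xi>] by (simp add: c_def B_def mult_ac)
    finally have sum: "(\<Sum>k=1..n. c k * (\<theta> (i - j) (\<xi> + of_int l * \<tau>) * \<theta> (i + j - int k) (q + of_int l * \<tau>) * h_quot n \<tau> (i - int k) (of_int l * \<tau>)))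
      = B * \<theta> (int k0) p * (e \<xi> * e q * h_quot n \<tau> l (of_int l * \<tau>))" .
    define b where "b = exp (- (\<i> * of_real pi * (of_int l ^ 2 * \<tau> - 2 * of_int l * x - of_int l)))"
    have hx: "h (x - of_int l * \<tau>) = b * h x"
      using h_plus_tau[of x "- l"] by (simp add: b_def)
    \<comment> \<open>The exponents of the two sides differ by an integer multiple of 2 pi i, which
      the additional factor makes explicit.\<close>
    have "e \<xi> * e q * h_quot n \<tau> l (of_int l * \<tau>) * exp (2 * of_int l * of_real pi * \<i>) = b * e p"
    proof -
      have xx: "x = p / of_nat n - q / of_nat n - \<xi> / of_nat n"
        by (simp add: x diff_divide_distrib)
      show ?thesis
        unfolding h_quot_tau e_def b_def exp_add[symmetric] xx
        using n_pos by (intro arg_cong[of _ _ exp]) (simp add: field_simps)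
    qed
    moreover have "exp (2 * of_int l * of_real pi * \<i>) = (1 :: complex)"
      using exp_integer_2pi[of "of_int l"] by simp
    ultimately have "e \<xi> * e q * h_quot n \<tau> l (of_int l * \<tau>) = b * e p" by simp
    then have "\<Theta> (of_int l * \<tau>) = 0"
      unfolding \<Theta>_def sum hl hx by (simp add: s idx)
    then show ?thesis by (simp add: l_def)
  qed
  \<comment> \<open>The periods 1 and n \<tau> move any zero of \<open>h\<close> to one of the
    points \<open>(i - k0) \<tau>\<close>, so all apparent poles of \<open>\<Phi>0\<close> are
    removable.\<close>
  have \<Theta>_zero: "\<Theta> z = 0 \<and> deriv h z \<noteq> 0" if hz: "h z = 0" for z
  proof -
    obtain m l :: int where z: "z = of_int m + of_int l * \<tau>"
      using h.zeroD[OF hz] by blast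
    obtain k0 where k0: "k0 \<in> {1..n}" and "[int k0 = i - l] (mod int n)"
      using residue_representative by blast
    then obtain t where "i - l = int k0 + int n * t"
      by (metis cong_iff_lin)
    then have l: "l = i - int k0 + (- t) * int n"
      by (simp add: algebra_simps)
    have "of_int l = (of_int (i - int k0) + of_int (- t) * of_nat n :: complex)"
      by (subst l) simp
    then have "z = of_int (i - int k0) * \<tau> + of_int m + of_int (- t) * (of_nat n * \<tau>)"
      by (simp only: z) (simp add: algebra_simps)
    then have "\<Theta> z = 0"
      using lat[of "of_int (i - int k0) * \<tau>" m "- t"] \<Theta>_tau[OF k0] by simp
    then show ?thesis
      using h.simple_zero[OF hz] by simp
  qed
  obtain \<Phi> where \<Phi>: "\<Phi> holomorphic_on UNIV" and \<Theta>\<Phi>: "\<And>z. \<Theta> z = h z * \<Phi> z"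
    using entire_divide[OF \<Theta>_hol h.hol \<Theta>_zero] by blast
  have \<Phi>\<Phi>0: "\<Phi> w = \<Phi>0 w" if "h w \<noteq> 0" for w
    using \<Theta>[OF that] \<Theta>\<Phi>[of w] that by simp
  have \<Phi>_1: "\<Phi> (w + 1) = - exp (- (2 * \<i> * of_real pi * of_int i / of_nat n)) * \<Phi> w" for w
  proof (rule eq_if_h_nonzero[where f = "\<lambda>w. \<Phi> (w + 1)" and g = "\<lambda>w. - exp (- (2 * \<i> * of_real pi * of_int i / of_nat n)) * \<Phi> w"])
    show "(\<lambda>w. - exp (- (2 * \<i> * of_real pi * of_int i / of_nat n)) * \<Phi> w) holomorphic_on UNIV"
      using n_pos by (intro holomorphic_intros \<Phi>) auto
    show "\<Phi> (w + 1) = - exp (- (2 * \<i> * of_real pi * of_int i / of_nat n)) * \<Phi> w" if "h w \<noteq> 0" for w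
      using that \<Phi>\<Phi>0[of w] \<Phi>\<Phi>0[of "w + 1"] by (simp add: \<Phi>0_1 h.plus1 \<epsilon>_def)
  qed (rule hol_shift[OF \<Phi>])
  \<comment> \<open>The multipliers of \<open>\<Phi>\<close> are those of
    \<open>\<theta> i (q + \<xi> + w)\<close> as a function of \<open>w\<close>; \<open>z0\<close>
    is the zero of that function.\<close>
  define z0 where "z0 = of_int i * \<tau> - q - \<xi>"
  have \<Phi>_2: "\<Phi> (w + of_nat n * \<tau>) = - exp (- (2 * \<i> * of_real pi * of_int i / of_nat n) * (of_nat n * \<tau>))
      * exp (- (\<i> * of_real pi * (of_nat n * \<tau> + 2 * (w - z0)))) * \<Phi> w" for w
  proof (rule eq_if_h_nonzero[where f = "\<lambda>w. \<Phi> (w + of_nat n * \<tau>)" and g = "\<lambda>w. - exp (- (2 * \<i> * of_real pi * of_int i / of_nat n) * (of_nat n * \<tau>)) * exp (- (\<i> * of_real pi * (of_nat n * \<tau> + 2 * (w - z0)))) * \<Phi> w"])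
    show "(\<lambda>w. - exp (- (2 * \<i> * of_real pi * of_int i / of_nat n) * (of_nat n * \<tau>))
      * exp (- (\<i> * of_real pi * (of_nat n * \<tau> + 2 * (w - z0)))) * \<Phi> w) holomorphic_on UNIV"
      using n_pos by (intro holomorphic_intros \<Phi>) auto
    have "exp (- (2 * \<i> * of_real pi * of_int i / of_nat n) * (of_nat n * \<tau>))
      * exp (- (\<i> * of_real pi * (of_nat n * \<tau> + 2 * (w - z0)))) = E (q + \<xi> + w)" for w
      using n_pos unfolding E_def exp_add[symmetric] z0_def
      by (intro arg_cong[of _ _ exp]) (simp add: algebra_simps)
    then show "\<Phi> (w + of_nat n * \<tau>) = - exp (- (2 * \<i> * of_real pi * of_int i / of_nat n) * (of_nat n * \<tau>))
      * exp (- (\<i> * of_real pi * (of_nat n * \<tau> + 2 * (w - z0)))) * \<Phi> w" if "h w \<noteq> 0" for w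
      using that \<Phi>\<Phi>0[of w] \<Phi>\<Phi>0[of "w + of_nat n * \<tau>"] by (simp add: \<Phi>0_ntau h_plus_n_tau)
  qed (rule hol_shift[OF \<Phi>])
  \<comment> \<open>Here \<open>\<theta> (i - j) (\<xi> + w)\<close>, a factor of every term of the
    sum, vanishes. The exchange and the passing term remain and cancel each other.\<close>
  define z1 where "z1 = of_int (i - j) * \<tau> - \<xi>"
  have \<Phi>_z: "\<Phi> z1 = 0"
  proof -
    define l where "l = i - j"
    define e where "e = (\<lambda>u. exp (- (\<i> * of_real pi * (of_int l ^ 2 * \<tau> + 2 * of_int l * u + of_int l) / of_nat n)))"
    have s: "\<theta> m (u + of_int l * \<tau>) = e u * \<theta> (m - l) u" for m u
      by (simp add: theta_plus_tau e_def)
    define b b' where "b = exp (- (\<i> * of_real pi * (of_int l ^ 2 * \<tau> - 2 * of_int l * \<xi> + of_int l)))"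
      and "b' = exp (- (\<i> * of_real pi * (of_int l ^ 2 * \<tau> - 2 * of_int l * (\<xi> + x) - of_int l)))"
    have z1: "\<xi> + z1 = of_int (i - j) * \<tau>" "q + \<xi> + z1 = q + of_int l * \<tau>" "p + z1 = (p - \<xi>) + of_int l * \<tau>"
      "x - z1 = \<xi> + x - of_int l * \<tau>" "z1 = - \<xi> + of_int l * \<tau>"
      by (simp_all add: z1_def l_def)
    have hz1: "h z1 = - b * h \<xi>"
      using h_plus_tau[of "- \<xi>" l] by (simp add: b_def z1(5) h.odd)
    have hx: "h (x - z1) = b' * h (\<xi> + x)"
      using h_plus_tau[of "\<xi> + x" "- l"] by (simp add: b'_def z1(4))
    have "b * e q * exp (2 * of_int l * of_real pi * \<i>) = b' * e (p - \<xi>)"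
    proof -
      have xx: "x = p / of_nat n - q / of_nat n - \<xi> / of_nat n"
        by (simp add: x diff_divide_distrib)
      show ?thesis
        unfolding e_def b_def b'_def exp_add[symmetric] xx
        using n_pos by (intro arg_cong[of _ _ exp]) (simp add: field_simps)
    qed
    moreover have "exp (2 * of_int l * of_real pi * \<i>) = (1 :: complex)"
      using exp_integer_2pi[of "of_int l"] by simp
    ultimately have be: "b * e q = b' * e (p - \<xi>)" by simp
    have "\<Theta> z1 = - (A * (e q * \<theta> (i - l) q) * (- b * h \<xi>) + B * (b' * h (\<xi> + x) * (e (p - \<xi>) * \<theta> (i - l) (p - \<xi>))))"
      unfolding \<Theta>_def z1(1-3) hz1 hx theta_zero_tau s by simp
    also have "\<dots> = (b * e q - b' * e (p - \<xi>)) * (h \<xi> * h (\<xi> + x) * \<theta> j q * \<theta> j (p - \<xi>))"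
      by (simp add: A_def B_def l_def algebra_simps)
    finally have "\<Theta> z1 = 0" by (simp add: be)
    moreover have "h z1 \<noteq> 0"
      using \<xi> by (simp add: hz1 b_def)
    ultimately show ?thesis
      using \<Theta>\<Phi>[of z1] by simp
  qed
  \<comment> \<open>The difference \<open>z1 - z0\<close> equals \<open>q - j \<tau>\<close>, so the
    two zeros are inequivalent because \<open>\<theta> j q \<noteq> 0\<close>.\<close>
  have "\<theta> 0 (z1 - z0) \<noteq> 0"
    using q theta_eq_0_iff[of j q] by (simp add: z1_def z0_def algebra_simps)
  from th.degree1_eq_0[OF \<Phi> \<Phi>_1 \<Phi>_2 \<Phi>_z this] have "\<Phi> w = 0" .
  then show ?thesis
    using \<Phi>\<Phi>0[OF w] by (simp add: \<Phi>0_def c_def T_def A_def B_def V_def)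
qed


text \<open>Continuation in \<open>q\<close> removes the condition
  \<open>\<theta> j q \<noteq> 0\<close>. The auxiliary \<open>x\<close> is written out because it
  varies with \<open>q\<close>.\<close>

lemma vertex_irf_theta:
  fixes i j :: int
  assumes \<xi>: "h \<xi> \<noteq> 0" and w: "h w \<noteq> 0"
  shows "(\<Sum>k=1..n. h \<xi> / \<theta> (int k - j) \<xi> * \<theta> (int k) p
        * (\<theta> (i - j) (\<xi> + w) * \<theta> (i + j - int k) (q + w) / \<theta> (i - int k) w)) * h ((p - q - \<xi>) / of_nat n)
    = h (\<xi> + (p - q - \<xi>) / of_nat n) * \<theta> j (p - \<xi>) * \<theta> i (q + \<xi> + w)
      + h \<xi> * \<theta> j q * (h ((p - q - \<xi>) / of_nat n - w) / h w * \<theta> i (p + w))"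
    (is "?L q = ?R q")
proof -
  obtain z where z: "\<theta> 0 z \<noteq> 0"
    using th.ex_nonzero by blast
  have z': "\<theta> j (z + of_int j * \<tau>) \<noteq> 0"
    using z by (simp add: theta_eq_0_iff[of j])
  have "(?L q - ?R q) * \<theta> j q = 0" for q
    using vertex_irf_theta_generic[OF \<xi> w, of j q "(p - q - \<xi>) / of_nat n" p i] by (cases "\<theta> j q = 0") simp_all
  moreover have "(\<lambda>q. ?L q - ?R q) holomorphic_on UNIV"
    using n_pos w h_theta_nz[OF w] by (intro holomorphic_intros) auto
  moreover have "(\<lambda>q. \<theta> j q) holomorphic_on UNIV"
    by (intro holomorphic_intros)
  ultimately have "?L q - ?R q = 0"
    using entire_mult_eq_0[where f = "\<lambda>q. ?L q - ?R q" and g = "\<theta> j", OF _ _ _ z'] by blast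
  then show ?thesis by simp
qed

lemma theta_bar_cong: "[a = b] (mod int n) \<Longrightarrow> v a u = v b u"
  by (simp add: theta_bar_def theta_cong)

text \<open>Index conservation in the R-matrix leaves exactly one \<open>l\<close> in the range, the
  representative of \<open>i + j - k\<close>.\<close>

lemma sum_residue_indicator:
  assumes f: "\<And>a b. [a = b] (mod int n) \<Longrightarrow> f a = f b"
  shows "(\<Sum>l=1..n. if [i + j = k + l] (mod n) then f (int l) else 0) = (f (int i + int j - int k) :: complex)"
proof -
  obtain l0 where l0: "l0 \<in> {1..n}" "[int l0 = int i + int j - int k] (mod int n)"
    by (rule residue_representative) (rule that)
  have iff: "[i + j = k + l] (mod n) \<longleftrightarrow> l = l0" if l: "l \<in> {1..n}" for l
  proof
    assume "[i + j = k + l] (mod n)"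
    then have "[int i + int j = int k + int l] (mod int n)"
      by (metis cong_int_iff of_nat_add)
    then have "[int l = int i + int j - int k] (mod int n)"
      by (simp add: cong_iff_dvd_diff algebra_simps dvd_diff_commute)
    then have "[int l = int l0] (mod int n)"
      using l0(2) cong_sym cong_trans by blast
    then have "int n dvd int l - int l0"
      by (simp add: cong_iff_dvd_diff)
    then show "l = l0"
    proof (rule contrapos_pp)
      assume "l \<noteq> l0"
      show "\<not> int n dvd int l - int l0"
      proof
        assume "int n dvd int l - int l0"
        moreover have "int l - int l0 \<noteq> 0"
          using \<open>l \<noteq> l0\<close> by simp
        ultimately have "\<bar>int n\<bar> \<le> \<bar>int l - int l0\<bar>"
          by (rule dvd_imp_le_int[rotated])
        then show False using l l0(1) by auto
      qed
    qed
  next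
    assume "l = l0"
    have "[int k + int l0 = int k + (int i + int j - int k)] (mod int n)"
      by (intro cong_add cong_refl l0(2))
    then have "[int (i + j) = int (k + l0)] (mod int n)"
      by (simp add: cong_sym)
    then show "[i + j = k + l] (mod n)"
      using \<open>l = l0\<close> cong_int_iff by blast
  qed
  have "(\<Sum>l=1..n. if [i + j = k + l] (mod n) then f (int l) else 0) = (\<Sum>l=1..n. if l = l0 then f (int l) else 0)"
    by (intro sum.cong refl) (simp add: iff)
  also have "\<dots> = f (int l0)"
    using l0(1) by simp
  finally show ?thesis using f[OF l0(2)] by simp
qed

text \<open>\<open>\<alpha>\<close> is the weight of the exchange term and \<open>\<beta>\<close>
  that of the passing term. Their argument \<open>x\<close> is the rescaled difference of the two
  points; \<open>\<beta>\<close> vanishes at \<open>x = w\<close>.\<close>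

definition \<alpha> :: "complex \<Rightarrow> complex \<Rightarrow> complex" where "\<alpha> \<xi> x = h (\<xi> + x) / h x"
definition \<beta> :: "complex \<Rightarrow> complex \<Rightarrow> complex \<Rightarrow> complex" where "\<beta> w \<xi> x = h \<xi> * h (x - w) / (h w * h x)"

text \<open>In each of the two resulting products the arguments add up to \<open>p + y\<close>, so
  the exponential prefactors of \<open>theta_bar\<close> pass through and the identity for the bare
  theta functions, with \<open>q = y - w\<close>, applies.\<close>

theorem vertex_irf:
  assumes \<xi>: "h \<xi> \<noteq> 0" and w: "h w \<noteq> 0" and x: "h x \<noteq> 0" and x_def: "x = (p - y + w - \<xi>) / of_nat n"
  shows "(\<Sum>k=1..n. \<Sum>l=1..n. R_coeff n \<tau> w \<xi> i j k l * (v (int k) p * v (int l) y)) = \<alpha> \<xi> x * (v (int i) (y + \<xi>) * v (int j) (p - \<xi>)) + \<beta> w \<xi> x * (v (int i) (p + w) * v (int j) (y - w))"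
    (is "?S = _")
proof -
  define q where "q = y - w"
  define e where "e = (\<lambda>u. exp (\<i> * of_real pi * u))"
  have e: "e a * e b = e (a + b)" for a b
    by (simp add: e_def distrib_left flip: exp_add)
  have vt: "v a u = e u * \<theta> a u" for a u
    by (simp add: theta_bar_def e_def)
  define t where "t = (\<lambda>k. h \<xi> / \<theta> (int k - int j) \<xi> * \<theta> (int k) p
        * (\<theta> (int i - int j) (\<xi> + w) * \<theta> (int i + int j - int k) (q + w) / \<theta> (int i - int k) w))"
  have "(\<Sum>l=1..n. R_coeff n \<tau> w \<xi> i j k l * (v (int k) p * v (int l) y)) = e (p + y) * t k" for k
  proof -
    define f where "f = (\<lambda>l. h \<xi> / \<theta> (int k - int j) \<xi> * \<theta> (int i - int j) (\<xi> + w) / \<theta> (int i - int k) w * (v (int k) p * v l y))"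
    have "(\<Sum>l=1..n. R_coeff n \<tau> w \<xi> i j k l * (v (int k) p * v (int l) y))
        = (\<Sum>l=1..n. if [i + j = k + l] (mod n) then f (int l) else 0)"
      by (intro sum.cong refl) (simp add: R_coeff_def f_def h_quot_eq[OF \<xi>])
    also have "\<dots> = f (int i + int j - int k)"
      by (rule sum_residue_indicator) (simp add: f_def theta_bar_cong)
    also have "\<dots> = e (p + y) * t k"
      by (simp add: f_def t_def vt q_def flip: e)
    finally show ?thesis .
  qed
  then have "(\<Sum>k=1..n. \<Sum>l=1..n. R_coeff n \<tau> w \<xi> i j k l * (v (int k) p * v (int l) y)) * h x = e (p + y) * ((\<Sum>k=1..n. t k) * h x)"
    by (simp add: sum_distrib_left mult.assoc)
  also have "(\<Sum>k=1..n. t k) * h x = h (\<xi> + x) * \<theta> (int j) (p - \<xi>) * \<theta> (int i) (q + \<xi> + w)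
      + h \<xi> * \<theta> (int j) q * (h (x - w) / h w * \<theta> (int i) (p + w))"
  proof -
    have "x = (p - q - \<xi>) / of_nat n"
      by (simp add: x_def q_def algebra_simps)
    then show ?thesis
      using vertex_irf_theta[OF \<xi> w, of "int j" p "int i" q] by (simp add: t_def)
  qed
  also have "e (p + y) * \<dots> = h (\<xi> + x) * (v (int i) (y + \<xi>) * v (int j) (p - \<xi>))
      + h \<xi> * h (x - w) / h w * (v (int i) (p + w) * v (int j) (y - w))"
  proof -
    have "e (p + y) = e (y + \<xi>) * e (p - \<xi>)" "e (p + y) = e (p + w) * e (y - w)"
      by (simp_all add: e algebra_simps)
    moreover have "q + \<xi> + w = y + \<xi>" by (simp add: q_def)
    ultimately show ?thesis
      unfolding distrib_left vt by (simp add: q_def mult_ac)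
  qed
  finally have *: "?S * h x = h (\<xi> + x) * (v (int i) (y + \<xi>) * v (int j) (p - \<xi>))
      + h \<xi> * h (x - w) / h w * (v (int i) (p + w) * v (int j) (y - w))" .
  have "?S = ?S * h x / h x"
    using x by simp
  then show ?thesis
    unfolding * by (simp add: \<alpha>_def \<beta>_def add_divide_distrib)
qed

section \<open>Generic test points\<close>

lemma countable_h_zeros: "countable {u. h u = 0}"
proof -
  have "{u. h u = 0} \<subseteq> (\<lambda>(m :: int, k :: int). of_int m + of_int k * \<tau>) ` UNIV"
    using h.zeroD by fastforce
  then show ?thesis
    by (rule countable_subset) (intro countable_image countableI_type)
qed

text \<open>The conditions put on a test point all say that \<open>h\<close> does not vanish at
  certain affine functions of it, so each excludes only countably many points.\<close>

lemma countable_h_affine: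
  assumes "b \<noteq> 0"
  shows "countable {y. h (a + b * y) = 0}"
proof -
  have "{y. h (a + b * y) = 0} \<subseteq> (\<lambda>z. (z - a) / b) ` {u. h u = 0}"
  proof
    fix y assume "y \<in> {y. h (a + b * y) = 0}"
    then show "y \<in> (\<lambda>z. (z - a) / b) ` {u. h u = 0}"
      using assms by (intro image_eqI[of _ _ "a + b * y"]) auto
  qed
  then show ?thesis
    by (rule countable_subset) (intro countable_image countable_h_zeros)
qed

lemma theta_bar_plus_1: "v k (u + 1) = exp (- (2 * \<i> * of_real pi * of_int k / of_nat n)) * v k u"
  by (simp add: theta_bar_def theta_plus_1 distrib_left exp_add)

lemma theta_bar_plus_nat: "v k (u + of_nat s) = exp (- (2 * \<i> * of_real pi * of_int k / of_nat n)) ^ s * v k u"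
proof (induction s)
  case (Suc s)
  then show ?case
    using theta_bar_plus_1[of k "u + of_nat s"] by (simp add: algebra_simps)
qed simp

text \<open>Translation by 1 multiplies component \<open>k\<close> by an n-th root of unity, so
  \<open>n\<close> is a genuine period of the whole vector. The points of Psi matter modulo this
  period only.\<close>

lemma theta_bar_period: "v k (u + of_nat n * of_int m) = v k u"
proof -
  have "exp (- (2 * \<i> * of_real pi * of_int k / of_nat n)) ^ n = 1"
  proof -
    have "exp (- (2 * \<i> * of_real pi * of_int k / of_nat n)) ^ n = exp (2 * of_int (- k) * of_real pi * \<i>)"
      using n_pos unfolding exp_of_nat_mult[symmetric] by (intro arg_cong[of _ _ exp]) (simp add: field_simps)
    also have "\<dots> = 1"
      using exp_integer_2pi[of "of_int (- k)"] by simp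
    finally show ?thesis .
  qed
  then have "v k (u + of_nat n) = v k u" for u
    by (simp add: theta_bar_plus_nat)
  then have "v k (u + of_int m * of_nat n) = v k u"
    using lattice_shift_int[of "\<lambda>a. v k a = v k u" "of_nat n" u m] by simp
  then show ?thesis by (simp add: mult.commute)
qed

lemma uncountable_complex: "uncountable (UNIV :: complex set)"
proof
  assume "countable (UNIV :: complex set)"
  then have "countable (range complex_of_real)"
    by (rule countable_subset[rotated]) simp
  then have "countable (UNIV :: real set)"
    by (rule countable_image_inj_on) (simp add: inj_on_def)
  then show False
    using uncountable_UNIV_real by blast
qed

text \<open>The translates \<open>y, y + 1, \<dots>\<close> do it, by orthogonality of characters of \<open>\<int>/n\<close>.\<close>
lemma dual_points:
  assumes B: "countable B"
  obtains ys :: "nat \<Rightarrow> complex" and D :: "nat \<Rightarrow> nat \<Rightarrow> complex" where "\<And>s. ys s \<notin> B"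
    "\<And>k l. k \<in> {1..n} \<Longrightarrow> l \<in> {1..n} \<Longrightarrow> (\<Sum>s<n. D k s * v (int l) (ys s)) = (if k = l then 1 else 0)"
proof -
  \<comment> \<open>The base point is chosen so that all its translates avoid \<open>B\<close> and
    no component \<open>v k y\<close> vanishes.\<close>
  define B' where "B' = (\<Union>s::nat. (\<lambda>b. b - of_nat s) ` B) \<union> {u. h u = 0}"
  have "countable B'"
    unfolding B'_def using B countable_h_zeros by auto
  then obtain y where y: "y \<notin> B'"
    using uncountable_complex by (metis UNIV_eq_I)
  define ys where "ys = (\<lambda>s::nat. y + of_nat s)"
  have ys: "ys s \<notin> B" for s
  proof
    assume "ys s \<in> B"
    then have "y \<in> (\<lambda>b. b - of_nat s) ` B"
      by (intro image_eqI[of _ _ "ys s"]) (simp_all add: ys_def)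
    then show False using y by (auto simp: B'_def)
  qed
  have "h y \<noteq> 0"
    using y by (auto simp: B'_def)
  then have vy: "v k y \<noteq> 0" for k
    using h_theta_nz by (simp add: theta_bar_def)
  define z where "z = (\<lambda>k::int. exp (- (2 * \<i> * of_real pi * of_int k / of_nat n)))"
  \<comment> \<open>The inverse discrete Fourier transform, normalized by the components at the base
    point.\<close>
  define D where "D = (\<lambda>k s. z (- int k) ^ s / (of_nat n * v (int k) y))"
  have "(\<Sum>s<n. D k s * v (int l) (ys s)) = (if k = l then 1 else 0)" if k: "k \<in> {1..n}" and l: "l \<in> {1..n}" for k l
  proof -
    have zz: "z (- int k) * z (int l) = z (int l - int k)"
      unfolding z_def exp_add[symmetric] by (intro arg_cong[of _ _ exp]) (simp add: diff_divide_distrib algebra_simps)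
    have "D k s * v (int l) (ys s) = v (int l) y / (of_nat n * v (int k) y) * z (int l - int k) ^ s" for s
    proof -
      have "v (int l) (ys s) = z (int l) ^ s * v (int l) y"
        by (simp only: ys_def theta_bar_plus_nat z_def)
      then show ?thesis
        by (simp add: D_def zz[symmetric] power_mult_distrib)
    qed
    then have eq: "(\<Sum>s<n. D k s * v (int l) (ys s)) = v (int l) y / (of_nat n * v (int k) y) * (\<Sum>s<n. z (int l - int k) ^ s)"
      by (simp add: sum_distrib_left)
    show ?thesis
    proof (cases "k = l")
      case True
      then show ?thesis
        unfolding eq using n_pos vy[of "int k"] by (simp add: z_def)
    next
      case False
      have zn: "z (int l - int k) ^ n = 1"
      proof -
        have "z (int l - int k) ^ n = exp (2 * of_int (int k - int l) * of_real pi * \<i>)"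
          using n_pos unfolding z_def exp_of_nat_mult[symmetric] by (intro arg_cong[of _ _ exp]) (simp add: field_simps)
        also have "\<dots> = 1"
          using exp_integer_2pi[of "of_int (int k - int l)"] by simp
        finally show ?thesis .
      qed
      have "z (int l - int k) \<noteq> 1"
      proof
        assume "z (int l - int k) = 1"
        then have "exp (2 * \<i> * of_real pi * (of_int (int k - int l) / of_nat n)) = 1"
          by (simp add: z_def diff_divide_distrib algebra_simps)
        then obtain m :: int where "of_int (int k - int l) / of_nat n = (of_int m :: complex)"
          using exp_eq_1_int by blast
        then have "of_int (int k - int l) = (of_int (int n * m) :: complex)"
          using n_pos by (simp add: field_simps)
        then have "int k - int l = int n * m"
          unfolding of_int_eq_iff .
        then have "int n dvd int k - int l" by simp
        moreover have "int k - int l \<noteq> 0"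
          using False by simp
        ultimately have "\<bar>int n\<bar> \<le> \<bar>int k - int l\<bar>"
          by (rule dvd_imp_le_int[rotated])
        then show False using k l by auto
      qed
      then show ?thesis
        unfolding eq using False zn by (simp add: geometric_sum)
    qed
  qed
  with ys show ?thesis by (rule that)
qed

lemma h_nonzero_real:
  assumes "x \<notin> \<int>"
  shows "h (of_real x) \<noteq> 0"
proof
  assume "h (of_real x) = 0"
  then obtain m k :: int where mk: "of_real x = of_int m + of_int k * \<tau>"
    using h.zeroD by blast
  then have "Im (of_real x) = Im (of_int m + of_int k * \<tau>)"
    by simp
  then have "k = 0"
    using Im_tau by simp
  then have "x = of_int m"
    using mk by (metis add.right_neutral mult_zero_left of_int_0 of_real_eq_iff of_real_of_int_eq)
  then show False using assms by simp
qed

end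

section \<open>The fused R-matrix\<close>

text \<open>A bubble sort argument. The relation \<open>E\<close> is kept general because it is
  equality for R-matrices and congruence modulo the ideal for L-operators; \<open>A\<close> keeps
  the entries inside the index range.\<close>

lemma mset_eq_swap_induct:
  assumes refl: "\<And>s. E s s" and trans: "\<And>s t r. E s t \<Longrightarrow> E t r \<Longrightarrow> E s r"
    and swap: "\<And>xs a b ys. set (xs @ a # b # ys) \<subseteq> A \<Longrightarrow> E (f (xs @ a # b # ys)) (f (xs @ b # a # ys))"
    and "mset xs = mset ys" "set xs \<subseteq> A"
  shows "E (f xs) (f ys)"
  using swap \<open>mset xs = mset ys\<close> \<open>set xs \<subseteq> A\<close>
proof (induction xs arbitrary: f ys)
  case Nil
  then show ?case using refl by simp
next
  case (Cons a xs)
  note swap = Cons.prems(1)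
  have "a \<in> set ys"
    using Cons.prems(2) by (metis list.set_intros(1) set_mset_mset)
  then obtain ys1 ys2 where ys: "ys = ys1 @ a # ys2"
    by (meson split_list)
  have xs: "mset xs = mset (ys1 @ ys2)"
    using Cons.prems(2) by (simp add: ys)
  have sub: "a \<in> A" "set ys1 \<subseteq> A" "set ys2 \<subseteq> A"
    using Cons.prems(2,3) mset_eq_setD[of "a # xs" ys] by (auto simp: ys)
  have "E (f (zs @ a # ys1 @ ys2)) (f (zs @ ys1 @ a # ys2))" if "set zs \<subseteq> A" for zs
    using sub(2) that
  proof (induction ys1 arbitrary: zs)
    case (Cons b ys1)
    have "E (f (zs @ a # b # ys1 @ ys2)) (f (zs @ b # a # ys1 @ ys2))"
      using sub Cons.prems by (intro swap) auto
    moreover have "E (f ((zs @ [b]) @ a # ys1 @ ys2)) (f ((zs @ [b]) @ ys1 @ a # ys2))"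
      using Cons.prems by (intro Cons.IH) auto
    ultimately show ?case
      using trans by auto
  qed (use refl in auto)
  from this[of "[]"] have "E (f (a # ys1 @ ys2)) (f ys)"
    by (simp add: ys)
  moreover have "E (f (a # xs)) (f (a # (ys1 @ ys2)))"
  proof (rule Cons.IH[of "\<lambda>zs. f (a # zs)", OF _ xs])
    show "E (f (a # xs @ c # b # ys)) (f (a # xs @ b # c # ys))" if "set (xs @ c # b # ys) \<subseteq> A" for xs c b ys
      using swap[of "a # xs" c b ys] that sub(1) by simp
  qed (use Cons.prems(3) in auto)
  ultimately show ?case
    using trans by blast
qed

section \<open>Index lists and symmetric tensors\<close>

lemma tidx_0 [simp]: "tidx n 0 = {[]}"
  by (auto simp: tidx_def)

lemma tidx_Cons_iff: "a # x \<in> tidx n (Suc N) \<longleftrightarrow> a \<in> {1..n} \<and> x \<in> tidx n N"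
  by (auto simp: tidx_def)

lemma tidx_Suc: "tidx n (Suc N) = (\<lambda>(a, x). a # x) ` ({1..n} \<times> tidx n N)"
proof -
  have "x \<in> tidx n (Suc N) \<Longrightarrow> x \<in> (\<lambda>(a, x). a # x) ` ({1..n} \<times> tidx n N)" for x
    by (cases x) (auto simp: tidx_def)
  then show ?thesis
    using tidx_Cons_iff by fastforce
qed

lemma finite_tidx [simp]: "finite (tidx n N)"
  by (induction N) (auto simp: tidx_Suc)

lemma sum_tidx_Suc: "(\<Sum>x\<in>tidx n (Suc N). f x) = (\<Sum>a=1..n. \<Sum>x\<in>tidx n N. f (a # x))"
proof -
  have "(\<Sum>x\<in>tidx n (Suc N). f x) = (\<Sum>z\<in>{1..n} \<times> tidx n N. f (fst z # snd z))"
    unfolding tidx_Suc by (subst sum.reindex) (auto simp: inj_on_def case_prod_unfold)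
  then show ?thesis
    by (simp add: sum.cartesian_product case_prod_unfold)
qed

lemma tidx_length: "x \<in> tidx n N \<Longrightarrow> length x = N"
  by (simp add: tidx_def)

definition symmetric_on :: "nat \<Rightarrow> (nat list \<Rightarrow> 'a) \<Rightarrow> bool" where
  "symmetric_on N c \<longleftrightarrow> (\<forall>x y. length x = N \<longrightarrow> mset x = mset y \<longrightarrow> c x = c y)"

lemma symmetric_on_Cons: "symmetric_on (Suc N) c \<Longrightarrow> symmetric_on N (\<lambda>x. c (a # x))"
  by (auto simp: symmetric_on_def)

lemma symmetric_on_swap: "symmetric_on (Suc (Suc N)) c \<Longrightarrow> length x = N \<Longrightarrow> c (a # b # x) = c (b # a # x)"
  by (auto simp: symmetric_on_def)

text \<open>
  The entries of $R_{10}(\xi + (N - 1) w) \cdots R_{N0}(\xi)$; the arguments \<open>k\<close> and \<open>l\<close> belong to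
  the factor 0.
\<close>
primrec R_fused :: "nat \<Rightarrow> complex \<Rightarrow> complex \<Rightarrow> complex \<Rightarrow> nat list \<Rightarrow> nat \<Rightarrow> nat list \<Rightarrow> nat \<Rightarrow> complex" where
  "R_fused n \<tau> w \<xi> [] k y l = (if k = l then 1 else 0)"
| "R_fused n \<tau> w \<xi> (a # x) k y l
    = (\<Sum>m=1..n. R_coeff n \<tau> w (\<xi> + of_nat (length x) * w) a k (hd y) m * R_fused n \<tau> w \<xi> x m (tl y) l)"

section \<open>Symmetry of the fused R-matrix\<close>

locale fusion_setting = theta_setting +
  fixes w :: complex
  assumes hw: "h w \<noteq> 0"
begin

abbreviation R where "R \<equiv> R_coeff n \<tau> w"
abbreviation RF where "RF \<equiv> R_fused n \<tau> w"

lemma vertex_irf': "h \<xi> \<noteq> 0 \<Longrightarrow> h x \<noteq> 0 \<Longrightarrow> x = (p - y + w - \<xi>) / of_nat n \<Longrightarrow>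
   (\<Sum>k=1..n. \<Sum>l=1..n. R \<xi> i j k l * (v (int k) p * v (int l) y))
    = \<alpha> \<xi> x * (v (int i) (y + \<xi>) * v (int j) (p - \<xi>)) + \<beta> w \<xi> x * (v (int i) (p + w) * v (int j) (y - w))"
  using vertex_irf hw by blast

text \<open>The dual points express \<open>X k\<close> as a combination of the vanishing values.
  Through this lemma an identity of components is tested on theta vectors at generic points.\<close>

lemma theta_bar_span:
  assumes B: "countable B" and X: "\<And>y. y \<notin> B \<Longrightarrow> (\<Sum>l=1..n. X l * v (int l) y) = 0" and k: "k \<in> {1..n}"
  shows "X k = 0"
proof -
  obtain ys D where ys: "\<And>s. ys s \<notin> B" and D: "\<And>k l. k \<in> {1..n} \<Longrightarrow> l \<in> {1..n} \<Longrightarrow>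
      (\<Sum>s<n. D k s * v (int l) (ys s)) = (if k = l then 1 else 0)"
    using dual_points[OF B] by metis
  have "0 = (\<Sum>s<n. D k s * (\<Sum>l=1..n. X l * v (int l) (ys s)))"
    using X ys by simp
  also have "\<dots> = (\<Sum>l=1..n. X l * (\<Sum>s<n. D k s * v (int l) (ys s)))"
    unfolding sum_distrib_left by (subst sum.swap) (simp add: mult_ac)
  also have "\<dots> = (\<Sum>l=1..n. if l = k then X l else 0)"
    using D[OF k] by (intro sum.cong) auto
  also have "\<dots> = X k"
    using k by simp
  finally show ?thesis by simp
qed

lemma theta_bar_span_eq:
  assumes "countable B" and "\<And>y. y \<notin> B \<Longrightarrow> (\<Sum>l=1..n. X l * v (int l) y) = (\<Sum>l=1..n. Y l * v (int l) y)" and "k \<in> {1..n}"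
  shows "X k = Y k"
  using theta_bar_span[of B "\<lambda>l. X l - Y l" k] assms by (simp add: left_diff_distrib sum_subtractf)

text \<open>An instance of the three-term identity. The left side collects two of the four histories
  of passing and exchanging in the action of two R-matrices; the right side is the weight of a third
  history with \<open>X\<close> and \<open>X'\<close> interchanged.\<close>

lemma exchange_coeff:
  assumes X: "h X \<noteq> 0" "h X' \<noteq> 0" and XX: "h (X - X') \<noteq> 0"
  shows "\<alpha> \<xi> X' * \<alpha> (\<xi> + w) (X - X') + \<beta> w \<xi> X' * \<alpha> (\<xi> + w) X = \<alpha> \<xi> X * \<beta> w (\<xi> + w) (X' - X)"
proof -
  have neg: "h (X' - X) = - h (X - X')" "h (X' - X - w) = - h (X - X' + w)"
    using h.odd[of "X - X'"] h.odd[of "X - X' + w"] by (simp_all add: algebra_simps)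
  \<comment> \<open>The four arguments of the three-term identity are half sums and half differences
    of the desired ones.\<close>
  have half: "\<xi> + (w + X) / 2 + (w + X) / 2 = \<xi> + w + X" "\<xi> + (w + X) / 2 - (w + X) / 2 = \<xi>"
    "(X - w) / 2 + (X - 2 * X' + w) / 2 = X - X'" "(X - w) / 2 - (X - 2 * X' + w) / 2 = X' - w"
    "\<xi> + (w + X) / 2 + (X - w) / 2 = \<xi> + X" "\<xi> + (w + X) / 2 - (X - w) / 2 = \<xi> + w"
    "(w + X) / 2 + (X - 2 * X' + w) / 2 = X - X' + w" "(w + X) / 2 - (X - 2 * X' + w) / 2 = X'"
    "\<xi> + (w + X) / 2 + (X - 2 * X' + w) / 2 = \<xi> + w + (X - X')" "\<xi> + (w + X) / 2 - (X - 2 * X' + w) / 2 = \<xi> + X'"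
    "(w + X) / 2 + (X - w) / 2 = X" "(w + X) / 2 - (X - w) / 2 = w"
    by (simp_all add: field_simps)
  have "h (\<xi> + w + X) * h \<xi> * h (X - X') * h (X' - w) - h (\<xi> + X) * h (\<xi> + w) * h (X - X' + w) * h X'
      + h (\<xi> + w + (X - X')) * h (\<xi> + X') * h X * h w = 0"
    using h.three_term[of "\<xi> + (w + X) / 2" "(w + X) / 2" "(X - w) / 2" "(X - 2 * X' + w) / 2"]
    unfolding half .
  then show ?thesis
    using X XX hw unfolding \<alpha>_def \<beta>_def neg by (simp add: divide_simps) (simp add: algebra_simps)
qed

text \<open>Applied to \<open>v p\<close>, \<open>v p'\<close> and \<open>v y\<close> the product of
  two R-matrices has four terms. After contraction with a symmetric \<open>c\<close>, two of them
  merge; by \<open>exchange_coeff\<close> the result is invariant under interchanging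
  \<open>p\<close> and \<open>p'\<close>, and since theta vectors span, this is the symmetry in
  \<open>b\<close> and \<open>b'\<close>.\<close>

lemma R_fused_two_exchange:
  assumes \<xi>: "h \<xi> \<noteq> 0" "h (\<xi> + w) \<noteq> 0" and c: "\<And>a a'. c a a' = c a' a"
    and b: "b \<in> {1..n}" "b' \<in> {1..n}" and l: "l \<in> {1..n}"
  shows "(\<Sum>a=1..n. \<Sum>a'=1..n. c a a' * (\<Sum>m=1..n. R (\<xi> + w) a k b m * R \<xi> a' m b' l))
    = (\<Sum>a=1..n. \<Sum>a'=1..n. c a a' * (\<Sum>m=1..n. R (\<xi> + w) a k b' m * R \<xi> a' m b l))"
proof -
  define Z where "Z = (\<lambda>b b' l. \<Sum>a=1..n. \<Sum>a'=1..n. c a a' * (\<Sum>m=1..n. R (\<xi> + w) a k b m * R \<xi> a' m b' l))"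
  define S where "S = (\<lambda>q q'. \<Sum>a=1..n. \<Sum>a'=1..n. c a a' * (v (int a) q * v (int a') q'))"
  have S_sym: "S q q' = S q' q" for q q'
    unfolding S_def by (subst sum.swap) (simp add: c mult_ac)
  \<comment> \<open>\<open>R \<xi>\<close> acts on \<open>v p'\<close> and \<open>v y\<close> first,
    and \<open>R (\<xi> + w)\<close> then acts on \<open>v p\<close> and the vector left in the
    common factor.\<close>
  have contracted: "(\<Sum>b=1..n. \<Sum>b'=1..n. \<Sum>l=1..n. Z b b' l * (v (int b) p * v (int b') p' * v (int l) y))
    = S (y + \<xi>) (p' + w) * v (int k) (p - \<xi> - w) * (\<alpha> \<xi> X' * \<alpha> (\<xi> + w) (X - X') + \<beta> w \<xi> X' * \<alpha> (\<xi> + w) X)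
      + S (y + \<xi>) (p + w) * v (int k) (p' - \<xi> - w) * (\<alpha> \<xi> X' * \<beta> w (\<xi> + w) (X - X'))
      + S (p + w) (p' + w) * v (int k) (y - w - w) * (\<beta> w \<xi> X' * \<beta> w (\<xi> + w) X)"
    if X: "X = (p - y + w - \<xi>) / of_nat n" "X' = (p' - y + w - \<xi>) / of_nat n"
      and nz: "h X \<noteq> 0" "h X' \<noteq> 0" "h (X - X') \<noteq> 0" for p p' y X X'
  proof -
    define P where "P = (\<lambda>m a'. \<alpha> \<xi> X' * (v (int a') (y + \<xi>) * v (int m) (p' - \<xi>)) + \<beta> w \<xi> X' * (v (int a') (p' + w) * v (int m) (y - w)))"
    have P: "(\<Sum>b'=1..n. \<Sum>l=1..n. R \<xi> a' m b' l * (v (int b') p' * v (int l) y)) = P m a'" for a' m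
      unfolding P_def using vertex_irf'[OF \<xi>(1) nz(2) X(2)] .
    have x12: "X - X' = (p - (p' - \<xi>) + w - (\<xi> + w)) / of_nat n"
      by (simp add: X diff_divide_distrib add_divide_distrib)
    have x1: "X = (p - (y - w) + w - (\<xi> + w)) / of_nat n"
      by (simp add: X diff_divide_distrib add_divide_distrib)
    have "(\<Sum>b=1..n. \<Sum>b'=1..n. \<Sum>l=1..n. Z b b' l * (v (int b) p * v (int b') p' * v (int l) y))
      = (\<Sum>b=1..n. \<Sum>b'=1..n. \<Sum>l=1..n. \<Sum>a=1..n. \<Sum>a'=1..n. \<Sum>m=1..n.
          c a a' * (R (\<xi> + w) a k b m * v (int b) p) * (R \<xi> a' m b' l * (v (int b') p' * v (int l) y)))"
      unfolding Z_def by (simp add: sum_distrib_left sum_distrib_right mult_ac)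
    also have "\<dots> = (\<Sum>a=1..n. \<Sum>a'=1..n. \<Sum>b=1..n. \<Sum>m=1..n. \<Sum>b'=1..n. \<Sum>l=1..n.
          c a a' * (R (\<xi> + w) a k b m * v (int b) p) * (R \<xi> a' m b' l * (v (int b') p' * v (int l) y)))"
      (is "?A = ?B")
    proof -
      \<comment> \<open>Nested sums are reordered in one go, as a sum over a Cartesian product; the
        same device is used repeatedly below.\<close>
      have "?A = (\<Sum>(b, b', l, a, a', m)\<in>{1..n} \<times> {1..n} \<times> {1..n} \<times> {1..n} \<times> {1..n} \<times> {1..n}.
          c a a' * (R (\<xi> + w) a k b m * v (int b) p) * (R \<xi> a' m b' l * (v (int b') p' * v (int l) y)))"
        by (simp add: sum.cartesian_product)
      also have "\<dots> = (\<Sum>(a, a', b, m, b', l)\<in>{1..n} \<times> {1..n} \<times> {1..n} \<times> {1..n} \<times> {1..n} \<times> {1..n}.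
          c a a' * (R (\<xi> + w) a k b m * v (int b) p) * (R \<xi> a' m b' l * (v (int b') p' * v (int l) y)))"
        by (rule sum.reindex_bij_witness[of _ "\<lambda>(a, a', b, m, b', l). (b, b', l, a, a', m)" "\<lambda>(b, b', l, a, a', m). (a, a', b, m, b', l)"]) auto
      also have "\<dots> = ?B"
        by (simp add: sum.cartesian_product)
      finally show ?thesis .
    qed
    also have "\<dots> = (\<Sum>a=1..n. \<Sum>a'=1..n. \<Sum>b=1..n. \<Sum>m=1..n. c a a' * (R (\<xi> + w) a k b m * v (int b) p) * P m a')"
      by (simp only: sum_distrib_left[symmetric] P)
    also have "\<dots> = (\<Sum>a=1..n. \<Sum>a'=1..n. c a a' * (
          \<alpha> \<xi> X' * v (int a') (y + \<xi>) * (\<Sum>b=1..n. \<Sum>m=1..n. R (\<xi> + w) a k b m * (v (int b) p * v (int m) (p' - \<xi>)))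
        + \<beta> w \<xi> X' * v (int a') (p' + w) * (\<Sum>b=1..n. \<Sum>m=1..n. R (\<xi> + w) a k b m * (v (int b) p * v (int m) (y - w)))))"
      unfolding sum_distrib_left sum.distrib[symmetric]
      by (intro sum.cong refl) (simp add: P_def algebra_simps)
    also have "\<dots> = (\<Sum>a=1..n. \<Sum>a'=1..n. c a a' * (
          \<alpha> \<xi> X' * v (int a') (y + \<xi>) * (\<alpha> (\<xi> + w) (X - X') * (v (int a) (p' - \<xi> + (\<xi> + w)) * v (int k) (p - (\<xi> + w)))
              + \<beta> w (\<xi> + w) (X - X') * (v (int a) (p + w) * v (int k) (p' - \<xi> - w)))
        + \<beta> w \<xi> X' * v (int a') (p' + w) * (\<alpha> (\<xi> + w) X * (v (int a) (y - w + (\<xi> + w)) * v (int k) (p - (\<xi> + w)))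
              + \<beta> w (\<xi> + w) X * (v (int a) (p + w) * v (int k) (y - w - w)))))"
      using vertex_irf'[OF \<xi>(2) nz(3) x12] vertex_irf'[OF \<xi>(2) nz(1) x1] by simp
    also have "\<dots> = S (p' + w) (y + \<xi>) * v (int k) (p - \<xi> - w) * (\<alpha> \<xi> X' * \<alpha> (\<xi> + w) (X - X'))
      + S (p + w) (y + \<xi>) * v (int k) (p' - \<xi> - w) * (\<alpha> \<xi> X' * \<beta> w (\<xi> + w) (X - X'))
      + S (y + \<xi>) (p' + w) * v (int k) (p - \<xi> - w) * (\<beta> w \<xi> X' * \<alpha> (\<xi> + w) X)
      + S (p + w) (p' + w) * v (int k) (y - w - w) * (\<beta> w \<xi> X' * \<beta> w (\<xi> + w) X)"
      unfolding S_def sum_distrib_right sum.distrib[symmetric]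
      by (intro sum.cong refl) (simp add: algebra_simps)
    finally show ?thesis
      unfolding S_sym[of _ "y + \<xi>"] by (simp add: distrib_left add_ac)
  qed
  have bad: "countable {y. h ((p - y + w - \<xi>) / of_nat n) = 0}" for p
    using countable_h_affine[of "- 1 / of_nat n" "(p + w - \<xi>) / of_nat n"] n_pos
    by (simp add: diff_divide_distrib add_divide_distrib algebra_simps)
  have bad2: "countable {p. h ((p - p') / of_nat n) = 0}" for p'
    using countable_h_affine[of "1 / of_nat n" "- p' / of_nat n"] n_pos
    by (simp add: diff_divide_distrib)
  have ZZ: "Z b b' l = Z b' b l"
  proof -
    \<comment> \<open>The test vectors are stripped one at a time: \<open>y\<close> here, then
      \<open>p\<close>, finally \<open>p'\<close>. At each stage the others are fixed so that the
      bad values are countable.\<close>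
    have 1: "(\<Sum>b=1..n. \<Sum>b'=1..n. Z b b' l * (v (int b) p * v (int b') p'))
        = (\<Sum>b=1..n. \<Sum>b'=1..n. Z b' b l * (v (int b) p * v (int b') p'))"
      if pp: "h ((p - p') / of_nat n) \<noteq> 0" and l: "l \<in> {1..n}" for p p' l
    proof (rule theta_bar_span_eq[where X = "\<lambda>l. \<Sum>b=1..n. \<Sum>b'=1..n. Z b b' l * (v (int b) p * v (int b') p')" and
          Y = "\<lambda>l. \<Sum>b=1..n. \<Sum>b'=1..n. Z b' b l * (v (int b) p * v (int b') p')", OF countable_Un[OF bad[of p] bad[of p']] _ l])
      fix y assume y: "y \<notin> {y. h ((p - y + w - \<xi>) / of_nat n) = 0} \<union> {y. h ((p' - y + w - \<xi>) / of_nat n) = 0}"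
      define X where "X = (p - y + w - \<xi>) / of_nat n"
      define X' where "X' = (p' - y + w - \<xi>) / of_nat n"
      have XX: "X - X' = (p - p') / of_nat n" "X' - X = - ((p - p') / of_nat n)"
        by (simp_all add: X_def X'_def diff_divide_distrib add_divide_distrib)
      have nz: "h X \<noteq> 0" "h X' \<noteq> 0" "h (X - X') \<noteq> 0" "h (X' - X) \<noteq> 0"
        using y pp unfolding XX h.odd by (auto simp: X_def X'_def)
      have F1: "(\<Sum>b=1..n. \<Sum>b'=1..n. \<Sum>l=1..n. Z b b' l * (v (int b) p * v (int b') p' * v (int l) y))
          = (\<Sum>b=1..n. \<Sum>b'=1..n. \<Sum>l=1..n. Z b b' l * (v (int b) p' * v (int b') p * v (int l) y))"
        unfolding contracted[OF X_def X'_def nz(1-3)] contracted[OF X'_def X_def nz(2,1,4)]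
          exchange_coeff[OF nz(1-3)] exchange_coeff[OF nz(2,1,4)] S_sym[of "p' + w" "p + w"]
        by (simp add: \<beta>_def mult_ac)
      have r: "(\<Sum>l=1..n. (\<Sum>b=1..n. \<Sum>b'=1..n. W b b' l * (v (int b) p * v (int b') p')) * v (int l) y)
         = (\<Sum>b=1..n. \<Sum>b'=1..n. \<Sum>l=1..n. W b b' l * (v (int b) p * v (int b') p' * v (int l) y))" for W
      proof -
        have "(\<Sum>l=1..n. (\<Sum>b=1..n. \<Sum>b'=1..n. W b b' l * (v (int b) p * v (int b') p')) * v (int l) y)
          = (\<Sum>l=1..n. \<Sum>b=1..n. \<Sum>b'=1..n. W b b' l * (v (int b) p * v (int b') p' * v (int l) y))"
          by (simp only: sum_distrib_right mult.assoc)
        also have "\<dots> = (\<Sum>b=1..n. \<Sum>l=1..n. \<Sum>b'=1..n. W b b' l * (v (int b) p * v (int b') p' * v (int l) y))"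
          by (rule sum.swap)
        also have "\<dots> = (\<Sum>b=1..n. \<Sum>b'=1..n. \<Sum>l=1..n. W b b' l * (v (int b) p * v (int b') p' * v (int l) y))"
          by (intro sum.cong refl sum.swap)
        finally show ?thesis .
      qed
      have r': "(\<Sum>b=1..n. \<Sum>b'=1..n. \<Sum>l=1..n. Z b b' l * (v (int b) p' * v (int b') p * v (int l) y))
          = (\<Sum>b=1..n. \<Sum>b'=1..n. \<Sum>l=1..n. Z b' b l * (v (int b) p * v (int b') p' * v (int l) y))"
        by (subst sum.swap) (simp add: mult_ac)
      show "(\<Sum>l=1..n. (\<Sum>b=1..n. \<Sum>b'=1..n. Z b b' l * (v (int b) p * v (int b') p')) * v (int l) y)
          = (\<Sum>l=1..n. (\<Sum>b=1..n. \<Sum>b'=1..n. Z b' b l * (v (int b) p * v (int b') p')) * v (int l) y)"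
        unfolding r[of Z] r[of "\<lambda>b b' l. Z b' b l"] F1 r' ..
    qed
    have 2: "(\<Sum>b'=1..n. Z b b' l * v (int b') p') = (\<Sum>b'=1..n. Z b' b l * v (int b') p')" if b: "b \<in> {1..n}" for p' b
    proof (rule theta_bar_span_eq[where X = "\<lambda>b. \<Sum>b'=1..n. Z b b' l * v (int b') p'" and Y = "\<lambda>b. \<Sum>b'=1..n. Z b' b l * v (int b') p'",
          OF bad2[of p'] _ b])
      fix p assume "p \<notin> {p. h ((p - p') / of_nat n) = 0}"
      then show "(\<Sum>b=1..n. (\<Sum>b'=1..n. Z b b' l * v (int b') p') * v (int b) p)
          = (\<Sum>b=1..n. (\<Sum>b'=1..n. Z b' b l * v (int b') p') * v (int b) p)"
        using 1[of p p' l] l unfolding sum_distrib_right by (simp add: mult_ac)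
    qed
    show ?thesis
      by (rule theta_bar_span_eq[where X = "\<lambda>b'. Z b b' l" and Y = "\<lambda>b'. Z b' b l" and B = "{}"]) (use 2 b in auto)
  qed
  then show ?thesis
    by (simp add: Z_def)
qed


lemma sum_R_fused_Suc:
  "(\<Sum>x\<in>tidx n (Suc M). c x * RF \<xi> x k y l)
   = (\<Sum>a=1..n. \<Sum>m=1..n. R (\<xi> + of_nat M * w) a k (hd y) m * (\<Sum>x\<in>tidx n M. c (a # x) * RF \<xi> x m (tl y) l))"
proof -
  have "(\<Sum>x\<in>tidx n (Suc M). c x * RF \<xi> x k y l)
      = (\<Sum>a=1..n. \<Sum>x\<in>tidx n M. \<Sum>m=1..n. c (a # x) * (R (\<xi> + of_nat M * w) a k (hd y) m * RF \<xi> x m (tl y) l))"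
    unfolding sum_tidx_Suc by (intro sum.cong refl) (simp add: sum_distrib_left tidx_length)
  also have "\<dots> = (\<Sum>a=1..n. \<Sum>m=1..n. \<Sum>x\<in>tidx n M. c (a # x) * (R (\<xi> + of_nat M * w) a k (hd y) m * RF \<xi> x m (tl y) l))"
    by (intro sum.cong refl sum.swap)
  finally show ?thesis
    by (simp add: sum_distrib_left mult_ac)
qed

text \<open>Fixing the first index of a symmetric \<open>c\<close> leaves a symmetric tensor in the
  other factors, so the prefix \<open>ys\<close> can be stripped and only a swap of the two leading
  factors is at stake.\<close>

lemma R_fused_swap:
  assumes "symmetric_on N c" and "\<And>m. m < N \<Longrightarrow> h (\<xi> + of_nat m * w) \<noteq> 0" and "ys @ b # b' # zs \<in> tidx n N"
  shows "(\<Sum>x\<in>tidx n N. c x * RF \<xi> x k (ys @ b # b' # zs) l) = (\<Sum>x\<in>tidx n N. c x * RF \<xi> x k (ys @ b' # b # zs) l)"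
  using assms
proof (induction ys arbitrary: N c k)
  case Nil
  then obtain M where N: "N = Suc (Suc M)"
    by (metis add_2_eq_Suc' append_Nil length_Cons tidx_length add_Suc_right)
  have b: "b \<in> {1..n}" "b' \<in> {1..n}"
    using Nil.prems(3) by (auto simp: N tidx_Cons_iff)
  define f where "f = (\<lambda>m' x. RF \<xi> x m' zs l)"
  have expand: "(\<Sum>x\<in>tidx n N. c x * RF \<xi> x k (b # b' # zs) l)
      = (\<Sum>x\<in>tidx n M. \<Sum>m'=1..n. (\<Sum>a=1..n. \<Sum>a'=1..n. c (a # a' # x) *
          (\<Sum>m=1..n. R (\<xi> + of_nat M * w + w) a k b m * R (\<xi> + of_nat M * w) a' m b' m')) * f m' x)" for b b'
  proof -
    have "(\<Sum>x\<in>tidx n N. c x * RF \<xi> x k (b # b' # zs) l)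
      = (\<Sum>a=1..n. \<Sum>m=1..n. \<Sum>a'=1..n. \<Sum>m'=1..n. \<Sum>x\<in>tidx n M.
           R (\<xi> + of_nat M * w + w) a k b m * (R (\<xi> + of_nat M * w) a' m b' m' * (c (a # a' # x) * f m' x)))"
      unfolding N sum_R_fused_Suc by (simp add: sum_distrib_left f_def algebra_simps)
    also have "\<dots> = (\<Sum>(a, m, a', m', x)\<in>{1..n} \<times> {1..n} \<times> {1..n} \<times> {1..n} \<times> tidx n M.
           R (\<xi> + of_nat M * w + w) a k b m * (R (\<xi> + of_nat M * w) a' m b' m' * (c (a # a' # x) * f m' x)))"
      by (simp add: sum.cartesian_product)
    also have "\<dots> = (\<Sum>(x, m', a, a', m)\<in>tidx n M \<times> {1..n} \<times> {1..n} \<times> {1..n} \<times> {1..n}.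
           R (\<xi> + of_nat M * w + w) a k b m * (R (\<xi> + of_nat M * w) a' m b' m' * (c (a # a' # x) * f m' x)))"
      by (rule sum.reindex_bij_witness[of _ "\<lambda>(x, m', a, a', m). (a, m, a', m', x)" "\<lambda>(a, m, a', m', x). (x, m', a, a', m)"]) auto
    also have "\<dots> = (\<Sum>x\<in>tidx n M. \<Sum>m'=1..n. \<Sum>a=1..n. \<Sum>a'=1..n. \<Sum>m=1..n.
           R (\<xi> + of_nat M * w + w) a k b m * (R (\<xi> + of_nat M * w) a' m b' m' * (c (a # a' # x) * f m' x)))"
      by (simp add: sum.cartesian_product)
    also have "\<dots> = (\<Sum>x\<in>tidx n M. \<Sum>m'=1..n. (\<Sum>a=1..n. \<Sum>a'=1..n. c (a # a' # x) *
          (\<Sum>m=1..n. R (\<xi> + of_nat M * w + w) a k b m * R (\<xi> + of_nat M * w) a' m b' m')) * f m' x)"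
      unfolding sum_distrib_left sum_distrib_right by (intro sum.cong refl) (simp only: mult_ac)
    finally show ?thesis .
  qed
  have hM: "h (\<xi> + of_nat M * w) \<noteq> 0" "h (\<xi> + of_nat M * w + w) \<noteq> 0"
    using Nil.prems(2)[of M] Nil.prems(2)[of "Suc M"] by (simp_all add: N algebra_simps)
  have "(\<Sum>a=1..n. \<Sum>a'=1..n. c (a # a' # x) *
          (\<Sum>m=1..n. R (\<xi> + of_nat M * w + w) a k b m * R (\<xi> + of_nat M * w) a' m b' m'))
      = (\<Sum>a=1..n. \<Sum>a'=1..n. c (a # a' # x) *
          (\<Sum>m=1..n. R (\<xi> + of_nat M * w + w) a k b' m * R (\<xi> + of_nat M * w) a' m b m'))"
    if "x \<in> tidx n M" "m' \<in> {1..n}" for x m'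
    by (rule R_fused_two_exchange[OF hM _ b that(2)])
      (use Nil.prems(1) that(1) in \<open>simp add: N symmetric_on_swap tidx_length\<close>)
  then show ?case
    unfolding append_Nil expand by (intro sum.cong refl) simp
next
  case (Cons d ys)
  then obtain M where N: "N = Suc M"
    by (metis append_Cons length_Cons tidx_length)
  have "(\<Sum>x\<in>tidx n M. c (a # x) * RF \<xi> x m (ys @ b # b' # zs) l) = (\<Sum>x\<in>tidx n M. c (a # x) * RF \<xi> x m (ys @ b' # b # zs) l)" for a m
    using Cons.prems by (intro Cons.IH) (auto simp: N tidx_Cons_iff intro: symmetric_on_Cons)
  then show ?case
    unfolding N sum_R_fused_Suc by simp
qed

lemma R_fused_symmetric:
  assumes "symmetric_on N c" and "\<And>m. m < N \<Longrightarrow> h (\<xi> + of_nat m * w) \<noteq> 0" and "y \<in> tidx n N" and "mset y = mset y'"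
  shows "(\<Sum>x\<in>tidx n N. c x * RF \<xi> x k y l) = (\<Sum>x\<in>tidx n N. c x * RF \<xi> x k y' l)"
proof -
  \<comment> \<open>The value 0 at other lengths makes the swap rule hold for lists of any length,
    as the induction principle demands.\<close>
  define f where "f = (\<lambda>y. if length y = N then \<Sum>x\<in>tidx n N. c x * RF \<xi> x k y l else 0)"
  have "f y = f y'"
  proof (rule mset_eq_swap_induct[where E = "(=)" and A = "{1..n}"])
    show "f (ys @ a # b # zs) = f (ys @ b # a # zs)" if "set (ys @ a # b # zs) \<subseteq> {1..n}" for ys a b zs
      using R_fused_swap[OF assms(1,2), of ys a b zs] that by (auto simp: f_def tidx_def)
  qed (use assms(3,4) in \<open>auto simp: tidx_def\<close>)
  then show ?thesis
    using assms(3) mset_eq_length[OF assms(4)] by (simp add: f_def tidx_length)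
qed

section \<open>The fused R-matrix on tensors of theta vectors\<close>

primrec tens :: "complex list \<Rightarrow> nat list \<Rightarrow> complex" where
  "tens [] x = 1"
| "tens (p # ps) x = v (int (hd x)) p * tens ps (tl x)"

text \<open>The product of R-matrices of \<open>R_fused\<close> applied to \<open>tens ps\<close>
  and the vector \<open>v y\<close> in factor 0. The recursion sends that vector through the factors
  starting from the last one, which is the order in which the correspondence is applied.\<close>

primrec R_tens :: "complex \<Rightarrow> complex \<Rightarrow> complex list \<Rightarrow> nat list \<Rightarrow> nat \<Rightarrow> complex" where
  "R_tens \<xi> y [] x k = v (int k) y"
| "R_tens \<xi> y (p # ps) x k
    = (\<Sum>b=1..n. \<Sum>m=1..n. R (\<xi> + of_nat (length ps) * w) (hd x) k b m * (v (int b) p * R_tens \<xi> y ps (tl x) m))"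

lemma R_tens_eq:
  assumes "x \<in> tidx n (length ps)" and "k \<in> {1..n}"
  shows "(\<Sum>z\<in>tidx n (length ps). \<Sum>l=1..n. RF \<xi> x k z l * (tens ps z * v (int l) y)) = R_tens \<xi> y ps x k"
  using assms
proof (induction ps arbitrary: x k)
  case Nil
  have "(\<Sum>l=1..n. (if k = l then 1 else 0) * v (int l) y) = (\<Sum>l=1..n. if k = l then v (int l) y else 0)"
    by (intro sum.cong) auto
  then show ?case using Nil by (simp add: if_distrib)
next
  case (Cons p ps)
  then obtain a x' where x: "x = a # x'" "x' \<in> tidx n (length ps)"
    by (cases x) (auto simp: tidx_def)
  have "(\<Sum>z\<in>tidx n (length (p # ps)). \<Sum>l=1..n. RF \<xi> x k z l * (tens (p # ps) z * v (int l) y))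
      = (\<Sum>b=1..n. \<Sum>z\<in>tidx n (length ps). \<Sum>l=1..n. \<Sum>m=1..n.
          R (\<xi> + of_nat (length ps) * w) a k b m * v (int b) p * (RF \<xi> x' m z l * (tens ps z * v (int l) y)))"
    unfolding length_Cons sum_tidx_Suc x R_fused.simps tidx_length[OF x(2)] sum_distrib_right
    by (intro sum.cong refl) (simp add: mult_ac)
  also have "\<dots> = (\<Sum>(b, z, l, m)\<in>{1..n} \<times> tidx n (length ps) \<times> {1..n} \<times> {1..n}.
          R (\<xi> + of_nat (length ps) * w) a k b m * v (int b) p * (RF \<xi> x' m z l * (tens ps z * v (int l) y)))"
    by (simp add: sum.cartesian_product)
  also have "\<dots> = (\<Sum>(b, m, z, l)\<in>{1..n} \<times> {1..n} \<times> tidx n (length ps) \<times> {1..n}.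
          R (\<xi> + of_nat (length ps) * w) a k b m * v (int b) p * (RF \<xi> x' m z l * (tens ps z * v (int l) y)))"
    by (rule sum.reindex_bij_witness[of _ "\<lambda>(b, m, z, l). (b, z, l, m)" "\<lambda>(b, z, l, m). (b, m, z, l)"]) auto
  also have "\<dots> = (\<Sum>b=1..n. \<Sum>m=1..n. R (\<xi> + of_nat (length ps) * w) a k b m * v (int b) p *
          (\<Sum>z\<in>tidx n (length ps). \<Sum>l=1..n. RF \<xi> x' m z l * (tens ps z * v (int l) y)))"
    unfolding sum_distrib_left by (simp add: sum.cartesian_product)
  also have "\<dots> = (\<Sum>b=1..n. \<Sum>m=1..n. R (\<xi> + of_nat (length ps) * w) a k b m * v (int b) p * R_tens \<xi> y ps x' m)"
    by (intro sum.cong refl) (simp only: Cons.IH[OF x(2)])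
  finally show ?case
    by (simp add: x mult.assoc)
qed

definition tsum :: "(nat list \<Rightarrow> complex) \<Rightarrow> complex list \<Rightarrow> complex" where
  "tsum c qs = (\<Sum>x\<in>tidx n (length qs). c x * tens qs x)"

lemma tsum_Cons: "tsum c (q # qs) = (\<Sum>a=1..n. v (int a) q * tsum (\<lambda>x. c (a # x)) qs)"
  by (simp add: tsum_def sum_tidx_Suc sum_distrib_left mult_ac)

lemma tsum_swap2:
  assumes "symmetric_on (Suc (Suc (length qs))) c"
  shows "tsum c (q # q' # qs) = tsum c (q' # q # qs)"
proof -
  have "tsum (\<lambda>x. c (a # a' # x)) qs = tsum (\<lambda>x. c (a' # a # x)) qs" for a a'
    unfolding tsum_def by (intro sum.cong refl) (simp add: symmetric_on_swap[OF assms] tidx_length)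
  then have "tsum c (q # q' # qs) = (\<Sum>a=1..n. \<Sum>a'=1..n. v (int a) q * (v (int a') q' * tsum (\<lambda>x. c (a' # a # x)) qs))"
    by (simp add: tsum_Cons sum_distrib_left)
  also have "\<dots> = tsum c (q' # q # qs)"
    by (subst sum.swap) (simp add: tsum_Cons sum_distrib_left mult_ac)
  finally show ?thesis .
qed

lemma tsum_swap:
  "symmetric_on (length (xs @ q # q' # qs)) c \<Longrightarrow> tsum c (xs @ q # q' # qs) = tsum c (xs @ q' # q # qs)"
proof (induction xs arbitrary: c)
  case Nil
  then show ?case by (simp add: tsum_swap2)
next
  case (Cons p xs)
  then show ?case
    by (simp add: tsum_Cons symmetric_on_Cons)
qed

lemma tsum_mset:
  assumes "symmetric_on N c" and "length qs = N" and "mset qs = mset qs'"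
  shows "tsum c qs = tsum c qs'"
proof -
  define f where "f = (\<lambda>qs. if length qs = N then tsum c qs else 0)"
  have "f qs = f qs'"
  proof (rule mset_eq_swap_induct[where E = "(=)" and A = UNIV])
    show "f (xs @ a # b # ys) = f (xs @ b # a # ys)" for xs a b ys
      using tsum_swap[of xs a b ys c] assms(1) by (auto simp: f_def)
  qed (use assms in auto)
  then show ?thesis
    using assms(2) mset_eq_length[OF assms(3)] by (simp add: f_def)
qed

lemma tens_cong:
  assumes "\<And>k j. j \<in> set js \<Longrightarrow> v k (f j) = v k (g j)"
  shows "tens (map f js) x = tens (map g js) x"
  using assms by (induction js arbitrary: x) auto

text \<open>The order is decreasing, so that a new point is added in front while the base
  \<open>P\<close> and the tail, to which an induction hypothesis applies, stay fixed. It is also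
  the order of the arguments in Psi.\<close>

definition points :: "complex \<Rightarrow> nat \<Rightarrow> complex list" where
  "points P m = map (\<lambda>j. P + of_nat j * of_nat n * w) (rev [0..<m])"

lemma points_0 [simp]: "points P 0 = []"
  and points_Suc [simp]: "points P (Suc m) = (P + of_nat m * of_nat n * w) # points P m"
  and length_points [simp]: "length (points P m) = m"
  by (simp_all add: points_def)

text \<open>The telescoped product of the passing weights
  \<open>\<beta> w (\<xi> + of_nat j * w) (X + of_nat j * w)\<close> for
  \<open>j < m\<close>.\<close>

definition pass_coeff :: "complex \<Rightarrow> complex \<Rightarrow> nat \<Rightarrow> complex" where
  "pass_coeff \<xi> X m = (\<Prod>j<m. h (\<xi> + of_nat j * w)) / h w ^ m * (h (X - w) / h (X + of_nat m * w - w))"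

text \<open>Closed form of the sum, over the place of the first exchange, of the weights of all
  histories with an exchange.\<close>

definition exchange_sum :: "complex \<Rightarrow> complex \<Rightarrow> nat \<Rightarrow> complex" where
  "exchange_sum \<xi> X m = h (of_nat m * w) * h (X + \<xi> + of_nat m * w - w) * (\<Prod>j<m. h (\<xi> + of_nat j * w))
     / (h \<xi> * h w ^ m * h (X + of_nat m * w - w))"

lemma pass_coeff_Suc:
  assumes "h (X + of_nat m * w - w) \<noteq> 0" "h (X + of_nat m * w) \<noteq> 0"
  shows "pass_coeff \<xi> X (Suc m) = pass_coeff \<xi> X m * \<beta> w (\<xi> + of_nat m * w) (X + of_nat m * w)"
proof -
  have arg: "X + of_nat (Suc m) * w - w = X + of_nat m * w"
    by (simp add: algebra_simps)
  show ?thesis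
    using assms hw unfolding pass_coeff_def \<beta>_def arg by (simp add: mult_ac)
qed

text \<open>Either the new point is where the first exchange happens, or an earlier exchange is
  followed by a forced one of weight \<open>\<alpha> (\<xi> + of_nat m * w) w\<close>. The
  three-term identity adds the two contributions.\<close>

lemma exchange_sum_Suc:
  assumes nz: "h (X + of_nat m * w - w) \<noteq> 0" "h (X + of_nat m * w) \<noteq> 0" and \<xi>: "h \<xi> \<noteq> 0"
  shows "exchange_sum \<xi> X (Suc m) = pass_coeff \<xi> X m * \<alpha> (\<xi> + of_nat m * w) (X + of_nat m * w)
     + exchange_sum \<xi> X m * \<alpha> (\<xi> + of_nat m * w) w"
proof -
  define M where "M = of_nat m * w"
  define Q where "Q = (\<Prod>j<m. h (\<xi> + of_nat j * w))"
  have half: "X + M + (\<xi> - w) / 2 + (\<xi> + w) / 2 = X + \<xi> + M" "X + M + (\<xi> - w) / 2 - (\<xi> + w) / 2 = X + M - w"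
    "M + (\<xi> + w) / 2 + (\<xi> - w) / 2 = \<xi> + M" "M + (\<xi> + w) / 2 - (\<xi> - w) / 2 = M + w"
    "X + M + (\<xi> - w) / 2 + (M + (\<xi> + w) / 2) = \<xi> + M + (X + M)" "X + M + (\<xi> - w) / 2 - (M + (\<xi> + w) / 2) = X - w"
    "(\<xi> + w) / 2 + (\<xi> - w) / 2 = \<xi>" "(\<xi> + w) / 2 - (\<xi> - w) / 2 = w"
    "X + M + (\<xi> - w) / 2 + (\<xi> - w) / 2 = X + \<xi> + M - w" "X + M + (\<xi> - w) / 2 - (\<xi> - w) / 2 = X + M"
    "(\<xi> + w) / 2 + (M + (\<xi> + w) / 2) = \<xi> + M + w" "(\<xi> + w) / 2 - (M + (\<xi> + w) / 2) = - M"
    by (simp_all add: field_simps)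
  have tt: "h (X + \<xi> + M) * h (X + M - w) * h (\<xi> + M) * h (M + w) - h (\<xi> + M + (X + M)) * h (X - w) * h \<xi> * h w
      + h (X + \<xi> + M - w) * h (X + M) * h (\<xi> + M + w) * h (- M) = 0"
    using h.three_term[of "X + M + (\<xi> - w) / 2" "(\<xi> + w) / 2" "M + (\<xi> + w) / 2" "(\<xi> - w) / 2"]
    unfolding half .
  have args: "of_nat (Suc m) * w = M + w" "X + of_nat (Suc m) * w - w = X + M" "X + \<xi> + of_nat (Suc m) * w - w = X + \<xi> + M"
    by (simp_all add: M_def algebra_simps)
  have "exchange_sum \<xi> X (Suc m) = h (M + w) * h (X + \<xi> + M) * (Q * h (\<xi> + M)) / (h \<xi> * (h w ^ m * h w) * h (X + M))"
    unfolding exchange_sum_def args(2,3) unfolding args(1) by (simp add: Q_def M_def mult_ac)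
  moreover have "pass_coeff \<xi> X m * \<alpha> (\<xi> + M) (X + M) + exchange_sum \<xi> X m * \<alpha> (\<xi> + M) w
    = Q / h w ^ m * (h (X - w) / h (X + M - w)) * (h (\<xi> + M + (X + M)) / h (X + M))
      + h M * h (X + \<xi> + M - w) * Q / (h \<xi> * h w ^ m * h (X + M - w)) * (h (\<xi> + M + w) / h w)"
    by (simp add: pass_coeff_def exchange_sum_def \<alpha>_def Q_def M_def)
  \<comment> \<open>The algebra is done with plain variables in place of the values of
    \<open>h\<close>; the last assumption is the three-term identity.\<close>
  moreover have "A1 * A2 * (Q * A3) / (z * (W * ww) * D1) = Q / W * (A4 / D2) * (A5 / D1) + A6 * A7 * Q / (z * W * D2) * (A8 / ww)"
    if "z \<noteq> 0" "W \<noteq> 0" "ww \<noteq> 0" "D1 \<noteq> 0" "D2 \<noteq> 0" "A2 * D2 * A3 * A1 - A5 * A4 * z * ww + A7 * D1 * A8 * (- A6) = 0"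
    for A1 A2 A3 A4 A5 A6 A7 A8 z W ww D1 D2 :: complex
  proof -
    have "A1 * A2 * A3 * D2 = A4 * A5 * z * ww + A6 * A7 * A8 * D1"
      using that(6) by (simp add: algebra_simps)
    moreover have "A1 * A2 * (Q * A3) / (z * (W * ww) * D1) = Q * (A1 * A2 * A3 * D2) / (z * W * ww * D1 * D2)"
      using that(1-5) by (simp add: divide_simps)
    moreover have "Q / W * (A4 / D2) * (A5 / D1) + A6 * A7 * Q / (z * W * D2) * (A8 / ww)
        = Q * (A4 * A5 * z * ww + A6 * A7 * A8 * D1) / (z * W * ww * D1 * D2)"
      using that(1-5) by (simp add: divide_simps) (simp add: algebra_simps)
    ultimately show ?thesis by simp
  qed
  ultimately show ?thesis
    using tt nz \<xi> hw unfolding h.odd M_def[symmetric] by simp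
qed

text \<open>After \<open>m\<close> factors the vector in factor 0 is in one of two states: never
  exchanged, at \<open>y - of_nat m * w\<close>, or exchanged, at a point fixed by the last
  progression point. Each new factor maps these states to the same kind of states, and symmetry of
  \<open>c\<close> identifies all tensors arising from exchanges.\<close>

lemma R_tens_claim:
  assumes "symmetric_on (Suc m) c" and \<xi>: "\<And>j. j \<le> m \<Longrightarrow> h (\<xi> + of_nat j * w) \<noteq> 0"
    and X: "X = (P - y - \<xi> + w) / of_nat n" and nz: "\<And>j :: int. h (X + of_int j * w) \<noteq> 0"
  shows "(\<Sum>x\<in>tidx n (Suc m). c x * R_tens \<xi> y (points P (Suc m)) x k)
    = pass_coeff \<xi> X (Suc m) * tsum c (map (\<lambda>p. p + w) (points P (Suc m))) * v (int k) (y - of_nat (Suc m) * w)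
      + exchange_sum \<xi> X (Suc m) * tsum c ((y + \<xi>) # map (\<lambda>p. p + w) (points P m)) * v (int k) (P + of_nat m * of_nat n * w - \<xi> - of_nat m * w)"
  using assms(1) \<xi>
proof (induction m arbitrary: c k)
  case 0
  have nz0: "h X \<noteq> 0" "h (X - w) \<noteq> 0"
    using nz[of 0] nz[of "- 1"] by simp_all
  have h\<xi>: "h \<xi> \<noteq> 0"
    using 0(2)[of 0] by simp
  have X': "X = (P - y + w - \<xi>) / of_nat n"
    by (simp add: X algebra_simps)
  have co: "pass_coeff \<xi> X (Suc 0) = \<beta> w \<xi> X" "exchange_sum \<xi> X (Suc 0) = \<alpha> \<xi> X"
    using nz0 h\<xi> hw by (simp_all add: pass_coeff_def exchange_sum_def \<alpha>_def \<beta>_def algebra_simps)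
  have "(\<Sum>x\<in>tidx n (Suc 0). c x * R_tens \<xi> y (points P (Suc 0)) x k)
      = (\<Sum>a=1..n. c [a] * (\<Sum>b=1..n. \<Sum>d=1..n. R \<xi> a k b d * (v (int b) P * v (int d) y)))"
    by (simp add: sum_tidx_Suc)
  also have "\<dots> = (\<Sum>a=1..n. c [a] * (\<beta> w \<xi> X * (v (int a) (P + w) * v (int k) (y - w))))
      + (\<Sum>a=1..n. c [a] * (\<alpha> \<xi> X * (v (int a) (y + \<xi>) * v (int k) (P - \<xi>))))"
    unfolding vertex_irf'[OF h\<xi> nz0(1) X'] sum.distrib[symmetric] by (intro sum.cong refl) (simp add: algebra_simps)
  also have "\<dots> = \<beta> w \<xi> X * tsum c [P + w] * v (int k) (y - w) + \<alpha> \<xi> X * tsum c [y + \<xi>] * v (int k) (P - \<xi>)"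
  proof -
    have "tsum c [q] = (\<Sum>a=1..n. c [a] * v (int a) q)" for q
      by (simp add: tsum_def sum_tidx_Suc)
    then show ?thesis
      by (simp only: sum_distrib_left sum_distrib_right) (simp add: mult_ac)
  qed
  finally show ?case
    unfolding co by simp
next
  case (Suc m)
  define M where "M = Suc m"
  define p where "p = P + of_nat M * of_nat n * w"
  define ps where "ps = points P M"
  define \<xi>' where "\<xi>' = \<xi> + of_nat M * w"
  define z1 where "z1 = y - of_nat M * w"
  define z2 where "z2 = P + of_nat m * of_nat n * w - \<xi> - of_nat m * w"
  define S1 where "S1 = (\<lambda>a. tsum (\<lambda>x. c (a # x)) (map (\<lambda>p. p + w) ps))"
  define S2 where "S2 = (\<lambda>a. tsum (\<lambda>x. c (a # x)) ((y + \<xi>) # map (\<lambda>p. p + w) (points P m)))"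
  have IH: "(\<Sum>x\<in>tidx n M. c (a # x) * R_tens \<xi> y ps x b)
    = pass_coeff \<xi> X M * S1 a * v (int b) z1 + exchange_sum \<xi> X M * S2 a * v (int b) z2" for a b
    unfolding M_def ps_def S1_def S2_def z1_def z2_def
    using Suc.prems by (intro Suc.IH symmetric_on_Cons) auto
  have h\<xi>: "h \<xi>' \<noteq> 0" "h \<xi> \<noteq> 0"
    using Suc.prems(2)[of M] Suc.prems(2)[of 0] by (simp_all add: \<xi>'_def M_def)
  define X1 where "X1 = X + of_nat M * w"
  have nzX: "h X1 \<noteq> 0" "h (X1 - w) \<noteq> 0"
    using nz[of "int M"] nz[of "int m"] by (simp_all add: X1_def M_def algebra_simps)
  have e1: "X1 = (p - z1 + w - \<xi>') / of_nat n"
    using n_pos by (simp add: X1_def X p_def z1_def \<xi>'_def field_simps)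
  \<comment> \<open>The step \<open>n w\<close> of the progression makes the variable equal to
    \<open>w\<close> in the exchanged state, where the passing weight vanishes: after one exchange
    only exchanges follow.\<close>
  have e2: "w = (p - z2 + w - \<xi>') / of_nat n"
    using n_pos by (simp add: p_def z2_def \<xi>'_def M_def field_simps)
  have b0: "\<beta> w \<xi>' w = 0"
    by (simp add: \<beta>_def)
  have "(\<Sum>x\<in>tidx n (Suc M). c x * R_tens \<xi> y (p # ps) x k)
      = (\<Sum>a=1..n. \<Sum>x\<in>tidx n M. \<Sum>b=1..n. \<Sum>d=1..n. R \<xi>' a k b d * v (int b) p * (c (a # x) * R_tens \<xi> y ps x d))"
    by (simp add: sum_tidx_Suc sum_distrib_left \<xi>'_def ps_def mult_ac)
  also have "\<dots> = (\<Sum>a=1..n. \<Sum>b=1..n. \<Sum>d=1..n. \<Sum>x\<in>tidx n M. R \<xi>' a k b d * v (int b) p * (c (a # x) * R_tens \<xi> y ps x d))"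
  proof (rule sum.cong[OF refl])
    fix a
    have "(\<Sum>x\<in>tidx n M. \<Sum>b=1..n. \<Sum>d=1..n. R \<xi>' a k b d * v (int b) p * (c (a # x) * R_tens \<xi> y ps x d))
       = (\<Sum>b=1..n. \<Sum>x\<in>tidx n M. \<Sum>d=1..n. R \<xi>' a k b d * v (int b) p * (c (a # x) * R_tens \<xi> y ps x d))"
      by (rule sum.swap)
    also have "\<dots> = (\<Sum>b=1..n. \<Sum>d=1..n. \<Sum>x\<in>tidx n M. R \<xi>' a k b d * v (int b) p * (c (a # x) * R_tens \<xi> y ps x d))"
      by (intro sum.cong refl sum.swap)
    finally show "(\<Sum>x\<in>tidx n M. \<Sum>b=1..n. \<Sum>d=1..n. R \<xi>' a k b d * v (int b) p * (c (a # x) * R_tens \<xi> y ps x d))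
       = (\<Sum>b=1..n. \<Sum>d=1..n. \<Sum>x\<in>tidx n M. R \<xi>' a k b d * v (int b) p * (c (a # x) * R_tens \<xi> y ps x d))" .
  qed
  also have "\<dots> = (\<Sum>a=1..n. \<Sum>b=1..n. \<Sum>d=1..n. R \<xi>' a k b d * v (int b) p *
      (pass_coeff \<xi> X M * S1 a * v (int d) z1 + exchange_sum \<xi> X M * S2 a * v (int d) z2))"
    by (simp only: sum_distrib_left[symmetric] IH)
  also have "\<dots> = (\<Sum>a=1..n. pass_coeff \<xi> X M * S1 a * (\<Sum>b=1..n. \<Sum>d=1..n. R \<xi>' a k b d * (v (int b) p * v (int d) z1))
      + exchange_sum \<xi> X M * S2 a * (\<Sum>b=1..n. \<Sum>d=1..n. R \<xi>' a k b d * (v (int b) p * v (int d) z2)))"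
    unfolding sum_distrib_left sum.distrib[symmetric] by (intro sum.cong refl) (simp add: algebra_simps)
  also have "\<dots> = (\<Sum>a=1..n. pass_coeff \<xi> X M * S1 a * (\<alpha> \<xi>' X1 * (v (int a) (z1 + \<xi>') * v (int k) (p - \<xi>')) + \<beta> w \<xi>' X1 * (v (int a) (p + w) * v (int k) (z1 - w)))
      + exchange_sum \<xi> X M * S2 a * (\<alpha> \<xi>' w * (v (int a) (z2 + \<xi>') * v (int k) (p - \<xi>'))))"
    unfolding vertex_irf'[OF h\<xi>(1) nzX(1) e1] vertex_irf'[OF h\<xi>(1) hw e2] b0 by simp
  also have "\<dots> = pass_coeff \<xi> X M * \<beta> w \<xi>' X1 * (\<Sum>a=1..n. v (int a) (p + w) * S1 a) * v (int k) (z1 - w)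
      + (pass_coeff \<xi> X M * \<alpha> \<xi>' X1 * (\<Sum>a=1..n. v (int a) (z1 + \<xi>') * S1 a)
        + exchange_sum \<xi> X M * \<alpha> \<xi>' w * (\<Sum>a=1..n. v (int a) (z2 + \<xi>') * S2 a)) * v (int k) (p - \<xi>')"
    unfolding sum_distrib_left sum_distrib_right distrib_right sum.distrib[symmetric]
    by (intro sum.cong refl) (simp add: algebra_simps)
  also have "(\<Sum>a=1..n. v (int a) (p + w) * S1 a) = tsum c (map (\<lambda>p. p + w) (points P (Suc M)))"
    by (simp add: S1_def tsum_Cons p_def ps_def)
  also have "(\<Sum>a=1..n. v (int a) (z1 + \<xi>') * S1 a) = tsum c ((y + \<xi>) # map (\<lambda>p. p + w) (points P M))"
    by (simp add: S1_def tsum_Cons z1_def \<xi>'_def ps_def)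
  also have "(\<Sum>a=1..n. v (int a) (z2 + \<xi>') * S2 a) = tsum c ((z2 + \<xi>') # (y + \<xi>) # map (\<lambda>p. p + w) (points P m))"
    unfolding S2_def by (rule tsum_Cons[symmetric])
  \<comment> \<open>\<open>z2 + \<xi>'\<close> is the highest point of the previous stage shifted by
    \<open>w\<close>. Symmetry of \<open>c\<close> puts it back among the shifted points, so both
    contributions contain the same tensor.\<close>
  also have "\<dots> = tsum c ((y + \<xi>) # (z2 + \<xi>') # map (\<lambda>p. p + w) (points P m))"
    using Suc.prems(1) by (intro tsum_swap2) simp
  also have "(z2 + \<xi>') # map (\<lambda>p. p + w) (points P m) = map (\<lambda>p. p + w) (points P M)"
    by (simp add: M_def z2_def \<xi>'_def algebra_simps)
  finally have "(\<Sum>x\<in>tidx n (Suc M). c x * R_tens \<xi> y (p # ps) x k)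
      = pass_coeff \<xi> X M * \<beta> w \<xi>' X1 * tsum c (map (\<lambda>p. p + w) (points P (Suc M))) * v (int k) (z1 - w)
       + (pass_coeff \<xi> X M * \<alpha> \<xi>' X1 + exchange_sum \<xi> X M * \<alpha> \<xi>' w) * tsum c ((y + \<xi>) # map (\<lambda>p. p + w) (points P M)) * v (int k) (p - \<xi>')"
    by (simp add: distrib_right)
  moreover have "pass_coeff \<xi> X M * \<beta> w \<xi>' X1 = pass_coeff \<xi> X (Suc M)"
    using pass_coeff_Suc[of X M \<xi>] nzX by (simp add: X1_def \<xi>'_def)
  moreover have "pass_coeff \<xi> X M * \<alpha> \<xi>' X1 + exchange_sum \<xi> X M * \<alpha> \<xi>' w = exchange_sum \<xi> X (Suc M)"
    using exchange_sum_Suc[of X M \<xi>] nzX h\<xi>(2) by (simp add: X1_def \<xi>'_def)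
  moreover have "z1 - w = y - of_nat (Suc M) * w" "p - \<xi>' = P + of_nat M * of_nat n * w - \<xi> - of_nat M * w"
    by (simp_all add: z1_def p_def \<xi>'_def algebra_simps)
  ultimately show ?case
    by (simp only: M_def[symmetric] points_Suc p_def ps_def)
qed


section \<open>The progression when N w = n\<close>

lemma h_plus_nat: "h (u + of_nat m) = (-1) ^ m * h u"
proof (induction m)
  case (Suc m)
  then show ?case
    using h.plus1[of "u + of_nat m"] by (simp add: algebra_simps)
qed simp

text \<open>The value of \<open>pass_coeff\<close> for all \<open>N\<close> points. When
  \<open>N w = n\<close>, the quotient \<open>h (X - w) / h (X + of_nat N * w - w)\<close> is
  \<open>(-1) ^ n\<close>, so the dependence on \<open>X\<close> disappears.\<close>

definition fused_factor :: "nat \<Rightarrow> complex \<Rightarrow> complex" where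
  "fused_factor N \<xi> = (-1) ^ n * ((\<Prod>j<N. h (\<xi> + of_nat j * w)) / h w ^ N)"

lemma tsum_points_shift:
  assumes c: "symmetric_on N c" and N: "N > 0" and cop: "coprime n N" and w: "w = of_nat n / of_nat N"
  shows "tsum c (map (\<lambda>p. p + w) (points P N)) = tsum c (points P N)"
proof -
  define f where "f = (\<lambda>j::nat. P + of_nat j * of_nat n * w)"
  \<comment> \<open>\<open>r\<close> inverts \<open>n\<close> modulo \<open>N\<close>. Since
    \<open>N w = n\<close>, raising the index of a point by \<open>r\<close> adds
    \<open>r n w = w + n t\<close>, which is \<open>w\<close> modulo the period \<open>n\<close>;
    reducing the index modulo \<open>N\<close> changes the point by multiples of that period as
    well.\<close>
  obtain r where "[int n * r = 1] (mod int N)"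
    using cong_solve_coprime_int[of "int n" "int N"] cop by auto
  then obtain t where t: "int n * r = 1 + int N * t"
    by (metis cong_iff_lin cong_sym)
  define \<sigma> where "\<sigma> = (\<lambda>j. nat ((int j + r) mod int N))"
  have \<sigma>: "int (\<sigma> j) = int j + r - int N * ((int j + r) div int N)" for j
    using N by (simp add: \<sigma>_def minus_mult_div_eq_mod)
  have shift: "v k (f j + w) = v k (f (\<sigma> j))" for k j
  proof -
    define q where "q = (int j + r) div int N"
    have N0: "(of_nat N :: complex) \<noteq> 0" using N by simp
    have "(of_nat (\<sigma> j) :: complex) = of_int (int (\<sigma> j))" by simp
    also have "\<dots> = of_nat j + of_int r - of_nat N * of_int q"
      unfolding \<sigma> q_def by simp
    finally have s: "(of_nat (\<sigma> j) :: complex) = of_nat j + of_int r - of_nat N * of_int q" .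
    have "(of_int (int n * r) :: complex) = of_int (1 + int N * t)"
      using t by simp
    then have t': "of_nat n * of_int r = (1 + of_nat N * of_int t :: complex)"
      by simp
    have e1: "of_nat n * of_int r * w = w + of_nat n * of_int t"
      unfolding t' using N0 by (simp add: w field_simps)
    have "of_nat N * w = of_nat n"
      using N0 by (simp add: w)
    then have "of_int q * of_nat n * (of_nat N * w) = of_int q * of_nat n * of_nat n"
      by simp
    then have e2: "of_nat N * of_int q * of_nat n * w = of_nat n * of_nat n * of_int q"
      by (simp only: mult_ac)
    have e3: "of_nat (\<sigma> j) * of_nat n * w = of_nat j * of_nat n * w + of_nat n * of_int r * w - of_nat N * of_int q * of_nat n * w"
      unfolding s by (simp add: algebra_simps)
    have "f j + w = f (\<sigma> j) + of_nat n * of_int (int n * q - t)"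
      unfolding f_def e3 e1 e2 by (simp add: algebra_simps)
    then show ?thesis
      by (simp only: theta_bar_period)
  qed
  have pts: "points P N = map f (rev [0..<N])"
    by (simp add: points_def f_def)
  have "tens (map (\<lambda>p. p + w) (points P N)) x = tens (map (f \<circ> \<sigma>) (rev [0..<N])) x" for x
    unfolding pts map_map by (rule tens_cong) (simp add: shift)
  then have "tsum c (map (\<lambda>p. p + w) (points P N)) = tsum c (map (f \<circ> \<sigma>) (rev [0..<N]))"
    by (simp add: tsum_def)
  also have "\<dots> = tsum c (points P N)"
  proof (rule tsum_mset[OF c])
    have "inj_on \<sigma> {0..<N}"
    proof (rule inj_onI)
      fix i j assume ij: "i \<in> {0..<N}" "j \<in> {0..<N}" and "\<sigma> i = \<sigma> j"
      then have "(int i + r) mod int N = (int j + r) mod int N"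
        using N by (simp add: \<sigma>_def nat_eq_iff)
      then have "[int i + r = int j + r] (mod int N)"
        by (simp add: cong_def)
      then have "[int i = int j] (mod int N)"
        by (simp add: cong_add_rcancel)
      then show "i = j"
        using ij by (simp add: cong_def)
    qed
    moreover from this have "\<sigma> ` {0..<N} = {0..<N}"
      using N by (intro endo_inj_surj) (auto simp: \<sigma>_def nat_less_iff)
    ultimately have "image_mset \<sigma> (mset_set {0..<N}) = mset_set {0..<N}"
      by (simp add: image_mset_mset_set)
    then have "image_mset f (image_mset \<sigma> (mset_set {0..<N})) = image_mset f (mset_set {0..<N})"
      by simp
    then show "mset (map (f \<circ> \<sigma>) (rev [0..<N])) = mset (points P N)"
      by (simp add: pts multiset.map_comp)
  qed simp
  finally show ?thesis .
qed

text \<open>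
  The weight of all exchanges together contains the factor \<open>h (N w) = h n = 0\<close>, and passing through
  all \<open>N\<close> points shifts them by \<open>w\<close>, which permutes them modulo \<open>n\<close>.
\<close>
theorem R_fused_points:
  assumes c: "symmetric_on N c" and N: "N > 0" and cop: "coprime n N" and w: "w = of_nat n / of_nat N"
    and \<xi>: "\<And>j. j < N \<Longrightarrow> h (\<xi> + of_nat j * w) \<noteq> 0" and k: "k \<in> {1..n}" and l: "l \<in> {1..n}"
  shows "(\<Sum>x\<in>tidx n N. \<Sum>z\<in>tidx n N. c x * RF \<xi> x k z l * tens (points P N) z)
    = (if k = l then fused_factor N \<xi> * tsum c (points P N) else 0)"
proof -
  have Nw: "of_nat N * w = of_nat n"
    using N by (simp add: w)
  \<comment> \<open>Both sides are compared as functionals of the vector in factor 0 and tested on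
    \<open>v y\<close>. The set excludes the \<open>y\<close> for which some weight along the
    progression has a zero denominator.\<close>
  define B where "B = (\<Union>j::int. {y. h ((P - y - \<xi> + w) / of_nat n + of_int j * w) = 0})"
  have "countable B"
    unfolding B_def
  proof (intro countable_UN countableI_type)
    fix j :: int
    have eq: "(P - y - \<xi> + w) / of_nat n + of_int j * w = ((P - \<xi> + w) / of_nat n + of_int j * w) + (- 1 / of_nat n) * y" for y
      by (simp add: diff_divide_distrib add_divide_distrib)
    show "countable {y. h ((P - y - \<xi> + w) / of_nat n + of_int j * w) = 0}"
      unfolding eq by (rule countable_h_affine) (use n_pos in simp)
  qed
  then show ?thesis
  proof (rule theta_bar_span_eq[where X = "\<lambda>l. \<Sum>x\<in>tidx n N. \<Sum>z\<in>tidx n N. c x * RF \<xi> x k z l * tens (points P N) z"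
        and Y = "\<lambda>l. if k = l then fused_factor N \<xi> * tsum c (points P N) else 0", OF _ _ l])
    fix y assume y: "y \<notin> B"
    define X where "X = (P - y - \<xi> + w) / of_nat n"
    have nz: "h (X + of_int j * w) \<noteq> 0" for j
      using y by (auto simp: B_def X_def)
    obtain M where M: "N = Suc M"
      using N by (cases N) auto
    have "(\<Sum>l=1..n. (\<Sum>x\<in>tidx n N. \<Sum>z\<in>tidx n N. c x * RF \<xi> x k z l * tens (points P N) z) * v (int l) y)
        = (\<Sum>l=1..n. \<Sum>x\<in>tidx n N. \<Sum>z\<in>tidx n N. c x * (RF \<xi> x k z l * (tens (points P N) z * v (int l) y)))"
      by (simp only: sum_distrib_right mult.assoc)
    also have "\<dots> = (\<Sum>x\<in>tidx n N. \<Sum>l=1..n. \<Sum>z\<in>tidx n N. c x * (RF \<xi> x k z l * (tens (points P N) z * v (int l) y)))"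
      by (rule sum.swap)
    also have "\<dots> = (\<Sum>x\<in>tidx n N. \<Sum>z\<in>tidx n N. \<Sum>l=1..n. c x * (RF \<xi> x k z l * (tens (points P N) z * v (int l) y)))"
      by (intro sum.cong refl sum.swap)
    also have "\<dots> = (\<Sum>x\<in>tidx n N. c x * R_tens \<xi> y (points P N) x k)"
      unfolding sum_distrib_left[symmetric]
      by (intro sum.cong refl) (use R_tens_eq[where ps = "points P N" and \<xi> = \<xi> and y = y and k = k] k in simp)
    also have "\<dots> = pass_coeff \<xi> X N * tsum c (map (\<lambda>p. p + w) (points P N)) * v (int k) (y - of_nat N * w)
      + exchange_sum \<xi> X N * tsum c ((y + \<xi>) # map (\<lambda>p. p + w) (points P M)) * v (int k) (P + of_nat M * of_nat n * w - \<xi> - of_nat M * w)"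
      unfolding M by (rule R_tens_claim[OF _ _ X_def nz]) (use c \<xi> in \<open>auto simp: M\<close>)
    also have "exchange_sum \<xi> X N = 0"
    proof -
      have "h (of_nat n) = 0"
        unfolding h.eq_0_iff by (rule exI[of _ "int n"], rule exI[of _ 0]) simp
      then show ?thesis by (simp add: exchange_sum_def Nw)
    qed
    also have "pass_coeff \<xi> X N = fused_factor N \<xi>"
    proof -
      have "h (X + of_nat N * w - w) = (-1) ^ n * h (X - w)"
        using h_plus_nat[of "X - w" n] unfolding Nw by (simp add: algebra_simps)
      moreover have "h (X - w) \<noteq> 0"
        using nz[of "- 1"] by simp
      ultimately have "h (X - w) / h (X + of_nat N * w - w) = (-1) ^ n"
        by (cases "even n") auto
      then show ?thesis
        by (simp add: pass_coeff_def fused_factor_def mult_ac)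
    qed
    also have "v (int k) (y - of_nat N * w) = v (int k) y"
      using theta_bar_period[of "int k" "y - of_nat n" 1] by (simp add: Nw)
    also note tsum_points_shift[OF c N cop w]
    finally show "(\<Sum>l=1..n. (\<Sum>x\<in>tidx n N. \<Sum>z\<in>tidx n N. c x * RF \<xi> x k z l * tens (points P N) z) * v (int l) y)
      = (\<Sum>l=1..n. (if k = l then fused_factor N \<xi> * tsum c (points P N) else 0) * v (int l) y)"
      using k by (simp add: if_distrib[of "\<lambda>t. t * _"] cong: if_cong)
  qed
qed

end

section \<open>Computing modulo the relations\<close>

lemma scal_add: "scal (a + b) = scal a + scal b"
  and scal_mult: "scal (a * b) = scal a * scal b"
  and scal_0 [simp]: "scal 0 = 0"
  and scal_1 [simp]: "scal 1 = 1"
  by (simp_all add: scal_def single_add mult_single)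

lemma scal_uminus: "scal (- a) = - scal a"
  by (simp add: scal_def single_uminus)

lemma scal_sum: "scal (sum f A) = (\<Sum>x\<in>A. scal (f x))"
  by (induction A rule: infinite_finite_induct) (simp_all add: scal_add)

lemma scal_central: "p * scal c = scal c * p"
proof (induction p rule: update_induct)
  case (update p g b)
  have "Poly_Mapping.update g b p = p + Poly_Mapping.single g b"
    using update(1) by (intro poly_mapping_eqI) (auto simp: lookup_update lookup_add lookup_single when_def in_keys_iff)
  then show ?case
    using update(3) by (simp add: scal_def distrib_left distrib_right mult_single mult.commute)
qed simp

lemma scal_left_commute: "p * (scal c * q) = scal c * (p * q)"
  by (metis mult.assoc scal_central)

locale monodromy =
  fixes n :: nat and \<tau> w :: complex
begin

abbreviation C where "C \<equiv> carrier (free_alg n)"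
abbreviation J where "J \<equiv> RLL_ideal n \<tau> w"

lemma free_alg_simps:
  "mult (free_alg n) = (*)" "one (free_alg n) = 1" "zero (free_alg n) = 0" "add (free_alg n) = (+)"
  by (simp_all add: free_alg_def)

sublocale F: ring "free_alg n"
  by (rule free_alg_ring)

sublocale J: ideal J "free_alg n"
  unfolding RLL_ideal_def by (intro F.genideal_ideal RLL_rels_subset)

lemma J_0 [simp]: "0 \<in> J"
  using J.zero_closed by (simp add: free_alg_simps)

lemma J_add: "p \<in> J \<Longrightarrow> q \<in> J \<Longrightarrow> p + q \<in> J"
  using J.a_closed by (simp add: free_alg_simps)

lemma J_left: "p \<in> J \<Longrightarrow> c \<in> C \<Longrightarrow> c * p \<in> J"
  using J.I_l_closed by (simp add: free_alg_simps)

lemma J_right: "p \<in> J \<Longrightarrow> c \<in> C \<Longrightarrow> p * c \<in> J"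
  using J.I_r_closed by (simp add: free_alg_simps)

lemma scal_C [simp]: "scal c \<in> C"
  by (simp add: scal_def free_alg_def zero_word_def)

lemma gen_C: "i \<in> {1..n} \<Longrightarrow> j \<in> {1..n} \<Longrightarrow> gen_L u i j \<in> C"
  by (simp add: gen_L_def free_alg_def)

lemma J_scal: "p \<in> J \<Longrightarrow> scal c * p \<in> J"
  by (simp add: J_left)

lemma J_uminus: "p \<in> J \<Longrightarrow> - p \<in> J"
  using J_scal[of p "- 1"] by (simp add: scal_uminus)

lemma J_sum: "(\<And>x. x \<in> A \<Longrightarrow> f x \<in> J) \<Longrightarrow> sum f A \<in> J"
  by (induction A rule: infinite_finite_induct) (auto intro: J_add)

lemma C_mult: "p \<in> C \<Longrightarrow> q \<in> C \<Longrightarrow> p * q \<in> C"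
  by (rule free_alg_mult_closed)

lemma C_sum: "(\<And>z. z \<in> Z \<Longrightarrow> f z \<in> C) \<Longrightarrow> sum f Z \<in> C"
  by (rule free_alg_sum_closed)

text \<open>Calculations use representatives in the free algebra. The ideal belongs to the ring with
  carrier \<open>C\<close>, so \<open>eqv_left\<close> and \<open>eqv_right\<close> ask the
  multiplier to lie in \<open>C\<close>.\<close>

definition eqv :: "falg \<Rightarrow> falg \<Rightarrow> bool" (infix "\<asymp>" 50) where "p \<asymp> q \<longleftrightarrow> p - q \<in> J"

lemma eqv_refl [simp]: "p \<asymp> p"
  by (simp add: eqv_def)

lemma eqv_sym: "p \<asymp> q \<Longrightarrow> q \<asymp> p"
  using J_uminus[of "p - q"] by (simp add: eqv_def)

lemma eqv_trans [trans]: "p \<asymp> q \<Longrightarrow> q \<asymp> r \<Longrightarrow> p \<asymp> r"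
  using J_add[of "p - q" "q - r"] by (simp add: eqv_def)

lemma eqv_eq_trans [trans]: "p \<asymp> q \<Longrightarrow> q = r \<Longrightarrow> p \<asymp> r" "p = q \<Longrightarrow> q \<asymp> r \<Longrightarrow> p \<asymp> r"
  by simp_all

lemma eqv_left: "p \<asymp> q \<Longrightarrow> c \<in> C \<Longrightarrow> c * p \<asymp> c * q"
  using J_left[of "p - q" c] by (simp add: eqv_def right_diff_distrib)

lemma eqv_right: "p \<asymp> q \<Longrightarrow> c \<in> C \<Longrightarrow> p * c \<asymp> q * c"
  using J_right[of "p - q" c] by (simp add: eqv_def left_diff_distrib)

lemma eqv_scal: "p \<asymp> q \<Longrightarrow> scal c * p \<asymp> scal c * q"
  by (simp add: eqv_left)

lemma eqv_scal_cancel: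
  assumes "scal c * p \<asymp> scal c * q" "c \<noteq> 0"
  shows "p \<asymp> q"
  using eqv_scal[OF assms(1), of "inverse c"] assms(2) by (simp add: mult.assoc[symmetric] scal_mult[symmetric])

lemma eqv_sum: "(\<And>x. x \<in> A \<Longrightarrow> f x \<asymp> g x) \<Longrightarrow> sum f A \<asymp> sum g A"
  using J_sum[of A "\<lambda>x. f x - g x"] by (simp add: eqv_def sum_subtractf)

lemma cls_eq_iff:
  assumes "p \<in> C" "q \<in> C"
  shows "cls n \<tau> w p = cls n \<tau> w q \<longleftrightarrow> p \<asymp> q"
proof -
  have "p \<ominus>\<^bsub>free_alg n\<^esub> q = p - q"
  proof -
    have "p - q \<in> C"
      using assms by (rule free_alg_diff_closed)
    then have "(p - q) \<oplus>\<^bsub>free_alg n\<^esub> q = p"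
      by (simp add: free_alg_simps)
    then show ?thesis
      using assms \<open>p - q \<in> C\<close> by (metis F.add.inv_solve_right F.minus_eq)
  qed
  then show ?thesis
    using F.quotient_eq_iff_same_a_r_cos[OF J.is_ideal assms] by (simp add: cls_def eqv_def)
qed

lemma cls_hom: "ring_hom_ring (free_alg n) (mono_alg n \<tau> w) (cls n \<tau> w)"
  using J.rcos_ring_hom_ring unfolding mono_alg_def cls_def .

sublocale cls: ring_hom_ring "free_alg n" "mono_alg n \<tau> w" "cls n \<tau> w"
  by (rule cls_hom)

lemma mono_alg_rep:
  assumes "\<Lambda> \<in> carrier (mono_alg n \<tau> w)"
  obtains p where "p \<in> C" "\<Lambda> = cls n \<tau> w p"
  using assms unfolding mono_alg_def FactRing_def A_RCOSETS_def' cls_def by auto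

lemma cls_sum:
  assumes "\<And>z. z \<in> A \<Longrightarrow> f z \<in> C"
  shows "finsum (mono_alg n \<tau> w) (\<lambda>z. cls n \<tau> w (f z)) A = cls n \<tau> w (sum f A)"
  using assms
proof (induction A rule: infinite_finite_induct)
  case (insert x A)
  have "cls n \<tau> w (f x + sum f A) = cls n \<tau> w (f x) \<oplus>\<^bsub>mono_alg n \<tau> w\<^esub> cls n \<tau> w (sum f A)"
    using cls.hom_add[of "f x" "sum f A"] insert.prems by (simp add: free_alg_simps C_sum)
  moreover have "finsum (mono_alg n \<tau> w) (\<lambda>z. cls n \<tau> w (f z)) (insert x A)
      = cls n \<tau> w (f x) \<oplus>\<^bsub>mono_alg n \<tau> w\<^esub> finsum (mono_alg n \<tau> w) (\<lambda>z. cls n \<tau> w (f z)) A"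
    using insert by (intro cls.S.finsum_insert) auto
  ultimately show ?case
    using insert by simp
qed (use cls.hom_zero in \<open>simp_all add: free_alg_simps\<close>)

lemma cls_mult: "p \<in> C \<Longrightarrow> q \<in> C \<Longrightarrow> cls n \<tau> w p \<otimes>\<^bsub>mono_alg n \<tau> w\<^esub> cls n \<tau> w q = cls n \<tau> w (p * q)"
  using cls.hom_mult[of p q] by (simp add: free_alg_simps)

lemma sum_tidx_2: "(\<Sum>x\<in>tidx n 2. f x) = (\<Sum>a=1..n. \<Sum>b=1..n. f [a, b])"
  by (simp add: numeral_2_eq_2 sum_tidx_Suc)

lemma tmul_leg_leg:
  assumes "a \<in> {1..n}" "b \<in> {1..n}" "c \<in> {1..n}" "d \<in> {1..n}"
  shows "tmul n 2 (leg 2 0 M) (leg 2 1 K) [a, b] [c, d] = M a c * K b d"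
    and "tmul n 2 (leg 2 1 K) (leg 2 0 M) [a, b] [c, d] = K b d * M a c"
proof -
  have all2: "(\<forall>t<2. t \<noteq> 0 \<longrightarrow> P t) \<longleftrightarrow> P 1" "(\<forall>t<2. t \<noteq> 1 \<longrightarrow> P t) \<longleftrightarrow> P 0" for P :: "nat \<Rightarrow> bool"
    by (auto simp: less_2_cases_iff)
  have "tmul n 2 (leg 2 0 M) (leg 2 1 K) [a, b] [c, d]
      = (\<Sum>e=1..n. \<Sum>f=1..n. if e = c then if f = b then M a c * K b d else 0 else 0)"
    unfolding tmul_def sum_tidx_2 leg_def all2 by (intro sum.cong refl) auto
  also have "\<dots> = (\<Sum>e=1..n. if e = c then (\<Sum>f=1..n. if f = b then M a c * K b d else 0) else 0)"
    by (intro sum.cong refl) auto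
  finally show "tmul n 2 (leg 2 0 M) (leg 2 1 K) [a, b] [c, d] = M a c * K b d"
    using assms by simp
  have "tmul n 2 (leg 2 1 K) (leg 2 0 M) [a, b] [c, d]
      = (\<Sum>e=1..n. \<Sum>f=1..n. if e = a then if f = d then K b d * M a c else 0 else 0)"
    unfolding tmul_def sum_tidx_2 leg_def all2 by (intro sum.cong refl) auto
  also have "\<dots> = (\<Sum>e=1..n. if e = a then (\<Sum>f=1..n. if f = d then K b d * M a c else 0) else 0)"
    by (intro sum.cong refl) auto
  finally show "tmul n 2 (leg 2 1 K) (leg 2 0 M) [a, b] [c, d] = K b d * M a c"
    using assms by simp
qed

lemma RLL:
  assumes "a \<in> {1..n}" "k \<in> {1..n}" "b \<in> {1..n}" "l \<in> {1..n}"
  shows "(\<Sum>c=1..n. \<Sum>d=1..n. scal (R_coeff n \<tau> w (u - v) a k c d) * (gen_L u c b * gen_L v d l))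
    \<asymp> (\<Sum>c=1..n. \<Sum>d=1..n. scal (R_coeff n \<tau> w (u - v) c d b l) * (gen_L v k d * gen_L u a c))"
proof -
  have ak: "[a, k] \<in> tidx n 2" "[b, l] \<in> tidx n 2"
    using assms by (auto simp: tidx_def)
  define M1 where "M1 = tmul n 2 (smat (R_mat n \<tau> w (u - v))) (tmul n 2 (leg 2 0 (gen_L u)) (leg 2 1 (gen_L v))) [a, k] [b, l]"
  define M2 where "M2 = tmul n 2 (tmul n 2 (leg 2 1 (gen_L v)) (leg 2 0 (gen_L u))) (smat (R_mat n \<tau> w (u - v))) [a, k] [b, l]"
  have "M1 - M2 \<in> RLL_rels n \<tau> w"
    unfolding RLL_rels_def M1_def M2_def using ak by blast
  then have "M1 - M2 \<in> J"
    unfolding RLL_ideal_def using F.genideal_self[OF RLL_rels_subset] by blast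
  moreover have "M1 = (\<Sum>c=1..n. \<Sum>d=1..n. scal (R_coeff n \<tau> w (u - v) a k c d) * (gen_L u c b * gen_L v d l))"
    unfolding M1_def tmul_def[of n 2 "smat _"] sum_tidx_2
    by (intro sum.cong refl) (simp only: tmul_leg_leg assms, simp add: smat_def R_mat_def)
  moreover have "M2 = (\<Sum>c=1..n. \<Sum>d=1..n. scal (R_coeff n \<tau> w (u - v) c d b l) * (gen_L v k d * gen_L u a c))"
    unfolding M2_def tmul_def[of n 2 _ "smat _"] sum_tidx_2
    by (intro sum.cong refl) (simp only: tmul_leg_leg assms, simp add: smat_def R_mat_def scal_central)
  ultimately show ?thesis
    by (simp add: eqv_def)
qed

end

section \<open>The fused L-operator\<close>

lemma scal_diff: "scal (a - b) = scal a - scal b"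
  by (simp add: scal_def single_diff)

lemma scal_shuffle: "scal r * (g * (scal f * (k * l))) = scal f * (scal r * (g * k) * l)"
  by (simp only: scal_left_commute[of g] scal_left_commute[of "scal r"] mult.assoc)

text \<open>An entry of the fused product before symmetrization: the factors act on different tensor
  legs, so the matrix product collapses to a single ordered product of generators, as
  \<open>fused_L_eq\<close> confirms.\<close>

primrec L_word :: "complex \<Rightarrow> complex \<Rightarrow> nat list \<Rightarrow> nat list \<Rightarrow> falg" where
  "L_word w u [] y = 1"
| "L_word w u (a # x) y = gen_L (u + of_nat (length x) * w) a (hd y) * L_word w u x (tl y)"

text \<open>At argument \<open>- w\<close> the numerator becomes \<open>\<theta> (i - j) 0\<close>,
  which is odd under interchanging \<open>i\<close> and \<open>j\<close> up to a character; the
  characters from the denominators compensate it.\<close>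

lemma (in theta_setting) R_antisym:
  assumes hw: "h w \<noteq> 0"
  shows "R_coeff n \<tau> w (- w) i j k l = - R_coeff n \<tau> w (- w) j i k l"
proof (cases "[i + j = k + l] (mod n)")
  case True
  define \<epsilon> where "\<epsilon> = (\<lambda>m::int. exp (- (2 * \<i> * of_real pi * of_int m / of_nat n)))"
  have e0: "\<epsilon> m \<noteq> 0" for m by (simp add: \<epsilon>_def)
  have ee: "\<epsilon> (int k - int i) = \<epsilon> (int j - int i) * \<epsilon> (int k - int j)"
    using n_pos unfolding \<epsilon>_def exp_add[symmetric]
    by (intro arg_cong[of _ _ exp]) (simp add: field_simps)
  have hw': "h (- w) \<noteq> 0" using hw by (simp add: h.odd)
  have m: "\<theta> a (- z) = - \<epsilon> a * \<theta> (- a) z" for a z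
    by (simp add: theta_minus \<epsilon>_def)
  have 0: "\<theta> (int j - int i) 0 = - \<epsilon> (int j - int i) * \<theta> (int i - int j) 0"
    using m[of "int j - int i" 0] by simp
  have nz: "\<theta> a w \<noteq> 0" for a
    by (rule h_theta_nz[OF hw])
  have r1: "R_coeff n \<tau> w (- w) i j k l = h (- w) * \<theta> (int i - int j) 0 / (- \<epsilon> (int k - int j) * \<theta> (int j - int k) w * \<theta> (int i - int k) w)"
    using True by (simp add: R_coeff_def h_quot_eq[OF hw'] m)
  have r2: "R_coeff n \<tau> w (- w) j i k l = h (- w) * \<theta> (int j - int i) 0 / (- \<epsilon> (int k - int i) * \<theta> (int i - int k) w * \<theta> (int j - int k) w)"
    using True by (simp add: R_coeff_def h_quot_eq[OF hw'] m add.commute)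
  show ?thesis
    unfolding r1 r2 0 ee using e0 nz by (simp add: divide_simps)
next
  case False
  then show ?thesis by (simp add: R_coeff_def add.commute)
qed

section \<open>Symmetry of the fused L-operator\<close>

context fusion_setting
begin

sublocale monodromy n \<tau> w .

lemma C_1: "1 \<in> C"
  using scal_C[of 1] by simp

lemma L_word_C: "x \<in> tidx n N \<Longrightarrow> y \<in> tidx n N \<Longrightarrow> L_word w u x y \<in> C"
proof (induction x arbitrary: y N)
  case (Cons a x)
  then obtain b y' where "y = b # y'"
    by (cases y; cases N) (auto simp: tidx_def)
  moreover obtain M where "N = Suc M"
    using Cons.prems(1) by (cases N) auto
  ultimately show ?case
    using Cons by (auto simp: tidx_Cons_iff intro!: C_mult gen_C)
qed (simp add: C_1)

text \<open>The finite combination given by the dual points carries over from numbers to elements of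
  the ideal, where no limits could be taken.\<close>

lemma theta_bar_span_J:
  assumes B: "countable B" and X: "\<And>y. y \<notin> B \<Longrightarrow> (\<Sum>l=1..n. scal (v (int l) y) * X l) \<in> J" and k: "k \<in> {1..n}"
  shows "X k \<in> J"
proof -
  obtain ys D where ys: "\<And>s. ys s \<notin> B" and D: "\<And>k l. k \<in> {1..n} \<Longrightarrow> l \<in> {1..n} \<Longrightarrow>
      (\<Sum>s<n. D k s * v (int l) (ys s)) = (if k = l then 1 else 0)"
    using dual_points[OF B] by metis
  have "(\<Sum>s<n. scal (D k s) * (\<Sum>l=1..n. scal (v (int l) (ys s)) * X l)) \<in> J"
    by (intro J_sum[of "{..<n}"] J_scal X ys)
  also have "(\<Sum>s<n. scal (D k s) * (\<Sum>l=1..n. scal (v (int l) (ys s)) * X l))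
      = (\<Sum>l=1..n. scal (\<Sum>s<n. D k s * v (int l) (ys s)) * X l)"
    unfolding sum_distrib_left scal_sum sum_distrib_right
    by (subst sum.swap) (simp add: scal_mult mult.assoc)
  also have "\<dots> = (\<Sum>l=1..n. if l = k then X l else 0)"
    using D[OF k] by (intro sum.cong) auto
  also have "\<dots> = X k"
    using k by simp
  finally show ?thesis .
qed

text \<open>
  \<open>R (- w)\<close> has antisymmetric values and, by the vertex-IRF correspondence, all of them: it maps
  tensors of theta vectors to multiples of \<open>v Q \<otimes> v P - v P \<otimes> v Q\<close>.
\<close>
lemma L_two_exchange:
  assumes c: "\<And>a a'. c a a' = c a' a" and b: "b \<in> {1..n}" "b' \<in> {1..n}"
  shows "(\<Sum>a=1..n. \<Sum>a'=1..n. scal (c a a') * (gen_L (u + w) a b * gen_L u a' b'))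
    \<asymp> (\<Sum>a=1..n. \<Sum>a'=1..n. scal (c a a') * (gen_L (u + w) a b' * gen_L u a' b))"
proof -
  define S where "S = (\<lambda>d e. \<Sum>a=1..n. \<Sum>a'=1..n. scal (c a a') * (gen_L (u + w) a' d * gen_L u a e))"
  have antisym: "(\<Sum>a=1..n. \<Sum>a'=1..n. scal (c a a') * scal (R (- w) a a' e d)) = 0" for e d
  proof -
    define f where "f = (\<lambda>a a'. scal (c a a') * scal (R (- w) a a' e d))"
    have f: "f a a' = - f a' a" for a a'
      using R_antisym[OF hw, of a a' e d] c[of a a'] by (simp add: f_def scal_uminus)
    have "(\<Sum>a=1..n. \<Sum>a'=1..n. f a a') = (\<Sum>a'=1..n. \<Sum>a=1..n. f a a')"
      by (rule sum.swap)
    also have "\<dots> = - (\<Sum>a=1..n. \<Sum>a'=1..n. f a a')"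
      by (subst f) (simp add: sum_negf)
    finally have "scal 2 * (\<Sum>a=1..n. \<Sum>a'=1..n. f a a') = 0"
      using scal_add[of 1 1] by (simp add: mult_2 eq_neg_iff_add_eq_0)
    then have "scal (1/2) * (scal 2 * (\<Sum>a=1..n. \<Sum>a'=1..n. f a a')) = 0"
      by simp
    then show ?thesis
      by (simp add: f_def mult.assoc[symmetric] scal_mult[symmetric])
  qed
  \<comment> \<open>The defining relation at spectral parameters \<open>u\<close> and
    \<open>u + w\<close>, contracted with \<open>c\<close>: the side where the R-matrix meets
    \<open>c\<close> vanishes by antisymmetry.\<close>
  have 1: "(\<Sum>e=1..n. \<Sum>d=1..n. scal (R (- w) e d b1 b2) * S d e) \<asymp> 0" if b12: "b1 \<in> {1..n}" "b2 \<in> {1..n}" for b1 b2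
  proof -
    have "(\<Sum>a=1..n. \<Sum>a'=1..n. scal (c a a') * (\<Sum>e=1..n. \<Sum>d=1..n. scal (R (u - (u + w)) a a' e d) * (gen_L u e b1 * gen_L (u + w) d b2)))
      \<asymp> (\<Sum>a=1..n. \<Sum>a'=1..n. scal (c a a') * (\<Sum>e=1..n. \<Sum>d=1..n. scal (R (u - (u + w)) e d b1 b2) * (gen_L (u + w) a' d * gen_L u a e)))"
      by (intro eqv_sum eqv_scal RLL b12)
    also have "(\<Sum>a=1..n. \<Sum>a'=1..n. scal (c a a') * (\<Sum>e=1..n. \<Sum>d=1..n. scal (R (u - (u + w)) e d b1 b2) * (gen_L (u + w) a' d * gen_L u a e)))
      = (\<Sum>e=1..n. \<Sum>d=1..n. scal (R (- w) e d b1 b2) * S d e)"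
    proof -
      have "(\<Sum>a=1..n. \<Sum>a'=1..n. scal (c a a') * (\<Sum>e=1..n. \<Sum>d=1..n. scal (R (u - (u + w)) e d b1 b2) * (gen_L (u + w) a' d * gen_L u a e)))
        = (\<Sum>(a, a', e, d)\<in>{1..n} \<times> {1..n} \<times> {1..n} \<times> {1..n}. scal (c a a') * (scal (R (- w) e d b1 b2) * (gen_L (u + w) a' d * gen_L u a e)))"
        unfolding sum_distrib_left by (simp add: sum.cartesian_product)
      also have "\<dots> = (\<Sum>(e, d, a, a')\<in>{1..n} \<times> {1..n} \<times> {1..n} \<times> {1..n}. scal (c a a') * (scal (R (- w) e d b1 b2) * (gen_L (u + w) a' d * gen_L u a e)))"
        by (rule sum.reindex_bij_witness[of _ "\<lambda>(e, d, a, a'). (a, a', e, d)" "\<lambda>(a, a', e, d). (e, d, a, a')"]) auto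
      also have "\<dots> = (\<Sum>e=1..n. \<Sum>d=1..n. \<Sum>a=1..n. \<Sum>a'=1..n. scal (c a a') * (scal (R (- w) e d b1 b2) * (gen_L (u + w) a' d * gen_L u a e)))"
        by (simp add: sum.cartesian_product)
      also have "\<dots> = (\<Sum>e=1..n. \<Sum>d=1..n. scal (R (- w) e d b1 b2) * S d e)"
        unfolding S_def sum_distrib_left by (intro sum.cong refl scal_left_commute)
      finally show ?thesis .
    qed
    also have "(\<Sum>a=1..n. \<Sum>a'=1..n. scal (c a a') * (\<Sum>e=1..n. \<Sum>d=1..n. scal (R (u - (u + w)) a a' e d) * (gen_L u e b1 * gen_L (u + w) d b2))) = 0"
    proof -
      have "(\<Sum>a=1..n. \<Sum>a'=1..n. scal (c a a') * (\<Sum>e=1..n. \<Sum>d=1..n. scal (R (u - (u + w)) a a' e d) * (gen_L u e b1 * gen_L (u + w) d b2)))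
        = (\<Sum>(a, a', e, d)\<in>{1..n} \<times> {1..n} \<times> {1..n} \<times> {1..n}. scal (c a a') * scal (R (- w) a a' e d) * (gen_L u e b1 * gen_L (u + w) d b2))"
        unfolding sum_distrib_left by (simp add: sum.cartesian_product mult.assoc)
      also have "\<dots> = (\<Sum>(e, d, a, a')\<in>{1..n} \<times> {1..n} \<times> {1..n} \<times> {1..n}. scal (c a a') * scal (R (- w) a a' e d) * (gen_L u e b1 * gen_L (u + w) d b2))"
        by (rule sum.reindex_bij_witness[of _ "\<lambda>(e, d, a, a'). (a, a', e, d)" "\<lambda>(a, a', e, d). (e, d, a, a')"]) auto
      also have "\<dots> = (\<Sum>e=1..n. \<Sum>d=1..n. (\<Sum>a=1..n. \<Sum>a'=1..n. scal (c a a') * scal (R (- w) a a' e d)) * (gen_L u e b1 * gen_L (u + w) d b2))"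
        unfolding sum_distrib_right by (simp add: sum.cartesian_product)
      finally show ?thesis by (simp only: antisym) simp
    qed
    finally show ?thesis
      by (rule eqv_sym)
  qed
  have 2: "(\<Sum>e=1..n. \<Sum>d=1..n. scal (v (int e) Q * v (int d) P - v (int e) P * v (int d) Q) * S d e) \<asymp> 0"
    if nz: "h ((P - Q) / of_nat n) \<noteq> 0" "h ((P - Q) / of_nat n - w) \<noteq> 0" for P Q
  proof -
    define x where "x = (P - Q) / of_nat n"
    \<comment> \<open>With these arguments, at \<open>\<xi> = - w\<close>, exchange yields
      \<open>v Q\<close> and \<open>v P\<close> in this order, and passing yields them reversed,
      with opposite weights.\<close>
    define p y where "p = P - w" and "y = Q + w"
    have x: "x = (p - y + w - (- w)) / of_nat n"
      by (simp add: x_def p_def y_def)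
    have hw': "h (- w) \<noteq> 0" using hw by (simp add: h.odd)
    have nz': "h x \<noteq> 0" "h (x - w) \<noteq> 0"
      using nz by (simp_all add: x_def)
    have co: "\<alpha> (- w) x = h (x - w) / h x" "\<beta> w (- w) x = - (h (x - w) / h x)"
      using hw by (simp_all add: \<alpha>_def \<beta>_def h.odd)
    have V: "(\<Sum>b1=1..n. \<Sum>b2=1..n. R (- w) e d b1 b2 * (v (int b1) p * v (int b2) y))
        = h (x - w) / h x * (v (int e) Q * v (int d) P - v (int e) P * v (int d) Q)" for e d
      unfolding vertex_irf'[OF hw' nz'(1) x] co by (simp add: p_def y_def algebra_simps)
    have "(\<Sum>b1=1..n. \<Sum>b2=1..n. scal (v (int b1) p * v (int b2) y) * (\<Sum>e=1..n. \<Sum>d=1..n. scal (R (- w) e d b1 b2) * S d e))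
        \<asymp> (\<Sum>b1=1..n. \<Sum>b2=1..n. scal (v (int b1) p * v (int b2) y) * 0)"
      by (intro eqv_sum eqv_scal 1)
    moreover have "(\<Sum>b1=1..n. \<Sum>b2=1..n. scal (v (int b1) p * v (int b2) y) * (\<Sum>e=1..n. \<Sum>d=1..n. scal (R (- w) e d b1 b2) * S d e))
        = (\<Sum>e=1..n. \<Sum>d=1..n. scal (\<Sum>b1=1..n. \<Sum>b2=1..n. R (- w) e d b1 b2 * (v (int b1) p * v (int b2) y)) * S d e)"
    proof -
      have "(\<Sum>b1=1..n. \<Sum>b2=1..n. scal (v (int b1) p * v (int b2) y) * (\<Sum>e=1..n. \<Sum>d=1..n. scal (R (- w) e d b1 b2) * S d e))
         = (\<Sum>(b1, b2, e, d)\<in>{1..n} \<times> {1..n} \<times> {1..n} \<times> {1..n}. scal (R (- w) e d b1 b2 * (v (int b1) p * v (int b2) y)) * S d e)"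
        unfolding sum_distrib_left by (simp add: sum.cartesian_product mult.assoc[symmetric] scal_mult[symmetric]) (simp only: mult_ac)
      also have "\<dots> = (\<Sum>(e, d, b1, b2)\<in>{1..n} \<times> {1..n} \<times> {1..n} \<times> {1..n}. scal (R (- w) e d b1 b2 * (v (int b1) p * v (int b2) y)) * S d e)"
        by (rule sum.reindex_bij_witness[of _ "\<lambda>(e, d, b1, b2). (b1, b2, e, d)" "\<lambda>(b1, b2, e, d). (e, d, b1, b2)"]) auto
      finally show ?thesis
        unfolding scal_sum sum_distrib_right by (simp add: sum.cartesian_product)
    qed
    ultimately have "(\<Sum>e=1..n. \<Sum>d=1..n. scal (h (x - w) / h x * (v (int e) Q * v (int d) P - v (int e) P * v (int d) Q)) * S d e) \<asymp> 0"
      unfolding V by simp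
    then have "scal (h (x - w) / h x) * (\<Sum>e=1..n. \<Sum>d=1..n. scal (v (int e) Q * v (int d) P - v (int e) P * v (int d) Q) * S d e) \<asymp> scal (h (x - w) / h x) * 0"
      unfolding scal_mult mult.assoc sum_distrib_left[symmetric] by (simp only: mult_zero_right)
    then show ?thesis
      by (rule eqv_scal_cancel) (use nz' in simp)
  qed
  \<comment> \<open>The antisymmetric part of \<open>S\<close> is annihilated by all generic pairs
    of theta vectors; stripping \<open>P\<close> and then \<open>Q\<close> puts its components into
    the ideal.\<close>
  define X where "X = (\<lambda>d e. S d e - S e d)"
  have 3: "(\<Sum>d=1..n. scal (v (int d) P) * (\<Sum>e=1..n. scal (v (int e) Q) * X d e)) \<in> J"
    if nz: "h ((P - Q) / of_nat n) \<noteq> 0" "h ((P - Q) / of_nat n - w) \<noteq> 0" for P Q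
  proof -
    have "(\<Sum>d=1..n. scal (v (int d) P) * (\<Sum>e=1..n. scal (v (int e) Q) * X d e))
        = (\<Sum>d=1..n. \<Sum>e=1..n. scal (v (int e) Q * v (int d) P) * S d e) - (\<Sum>d=1..n. \<Sum>e=1..n. scal (v (int e) Q * v (int d) P) * S e d)"
      unfolding sum_subtractf[symmetric] sum_distrib_left
      by (intro sum.cong refl) (simp add: X_def scal_mult right_diff_distrib mult.assoc[symmetric] scal_central[of "scal _"])
    also have "(\<Sum>d=1..n. \<Sum>e=1..n. scal (v (int e) Q * v (int d) P) * S d e) = (\<Sum>e=1..n. \<Sum>d=1..n. scal (v (int e) Q * v (int d) P) * S d e)"
      by (rule sum.swap)
    also have "(\<Sum>d=1..n. \<Sum>e=1..n. scal (v (int e) Q * v (int d) P) * S e d) = (\<Sum>e=1..n. \<Sum>d=1..n. scal (v (int e) P * v (int d) Q) * S d e)"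
      by (simp add: mult.commute)
    also have "(\<Sum>e=1..n. \<Sum>d=1..n. scal (v (int e) Q * v (int d) P) * S d e) - (\<Sum>e=1..n. \<Sum>d=1..n. scal (v (int e) P * v (int d) Q) * S d e)
        = (\<Sum>e=1..n. \<Sum>d=1..n. scal (v (int e) Q * v (int d) P - v (int e) P * v (int d) Q) * S d e)"
      unfolding sum_subtractf[symmetric] scal_diff left_diff_distrib ..
    finally show ?thesis
      using 2[OF nz] by (simp add: eqv_def)
  qed
  have "(\<Sum>e=1..n. scal (v (int e) Q) * X d e) \<in> J" if d: "d \<in> {1..n}" for d Q
  proof (rule theta_bar_span_J[where X = "\<lambda>d. \<Sum>e=1..n. scal (v (int e) Q) * X d e" and
        B = "{P. h (- Q / of_nat n + 1 / of_nat n * P) = 0} \<union> {P. h (- Q / of_nat n - w + 1 / of_nat n * P) = 0}", OF _ _ d])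
    show "countable ({P. h (- Q / of_nat n + 1 / of_nat n * P) = 0} \<union> {P. h (- Q / of_nat n - w + 1 / of_nat n * P) = 0})"
      using n_pos by (intro countable_Un countable_h_affine) auto
    show "(\<Sum>d=1..n. scal (v (int d) P) * (\<Sum>e=1..n. scal (v (int e) Q) * X d e)) \<in> J"
      if "P \<notin> {P. h (- Q / of_nat n + 1 / of_nat n * P) = 0} \<union> {P. h (- Q / of_nat n - w + 1 / of_nat n * P) = 0}" for P
      using that by (intro 3) (auto simp: diff_divide_distrib algebra_simps)
  qed
  then have "X b b' \<in> J"
    using b by (intro theta_bar_span_J[where X = "X b" and B = "{}"]) auto
  then have "S b b' \<asymp> S b' b"
    by (simp add: eqv_def X_def)
  moreover have "S d e = (\<Sum>a=1..n. \<Sum>a'=1..n. scal (c a a') * (gen_L (u + w) a d * gen_L u a' e))" for d e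
    unfolding S_def by (subst sum.swap) (simp add: c)
  ultimately show ?thesis by simp
qed

text \<open>As for \<open>R_fused_swap\<close>: the prefix is stripped from the left, and the swap
  of the two leading factors is \<open>L_two_exchange\<close> multiplied by the remaining
  word.\<close>

lemma L_word_swap:
  assumes "symmetric_on N c" and "ys @ b # b' # zs \<in> tidx n N"
  shows "(\<Sum>x\<in>tidx n N. scal (c x) * L_word w u x (ys @ b # b' # zs)) \<asymp> (\<Sum>x\<in>tidx n N. scal (c x) * L_word w u x (ys @ b' # b # zs))"
  using assms
proof (induction ys arbitrary: N c)
  case Nil
  then obtain M where N: "N = Suc (Suc M)"
    by (metis add_2_eq_Suc' append_Nil length_Cons tidx_length add_Suc_right)
  have b: "b \<in> {1..n}" "b' \<in> {1..n}" and zs: "zs \<in> tidx n M"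
    using Nil.prems(2) by (auto simp: N tidx_Cons_iff)
  define u' where "u' = u + of_nat M * w"
  have expand: "(\<Sum>x\<in>tidx n N. scal (c x) * L_word w u x (b # b' # zs))
      = (\<Sum>x\<in>tidx n M. (\<Sum>a=1..n. \<Sum>a'=1..n. scal (c (a # a' # x)) * (gen_L (u' + w) a b * gen_L u' a' b')) * L_word w u x zs)" for b b'
  proof -
    have "(\<Sum>x\<in>tidx n N. scal (c x) * L_word w u x (b # b' # zs))
        = (\<Sum>a=1..n. \<Sum>a'=1..n. \<Sum>x\<in>tidx n M. scal (c (a # a' # x)) * (gen_L (u' + w) a b * gen_L u' a' b') * L_word w u x zs)"
      unfolding N sum_tidx_Suc
      by (intro sum.cong refl) (simp add: tidx_length u'_def algebra_simps)
    also have "\<dots> = (\<Sum>a=1..n. \<Sum>x\<in>tidx n M. \<Sum>a'=1..n. scal (c (a # a' # x)) * (gen_L (u' + w) a b * gen_L u' a' b') * L_word w u x zs)"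
      by (intro sum.cong refl sum.swap)
    also have "\<dots> = (\<Sum>x\<in>tidx n M. \<Sum>a=1..n. \<Sum>a'=1..n. scal (c (a # a' # x)) * (gen_L (u' + w) a b * gen_L u' a' b') * L_word w u x zs)"
      by (rule sum.swap)
    finally show ?thesis
      by (simp only: sum_distrib_right)
  qed
  have "(\<Sum>a=1..n. \<Sum>a'=1..n. scal (c (a # a' # x)) * (gen_L (u' + w) a b * gen_L u' a' b'))
      \<asymp> (\<Sum>a=1..n. \<Sum>a'=1..n. scal (c (a # a' # x)) * (gen_L (u' + w) a b' * gen_L u' a' b))" if "x \<in> tidx n M" for x
    by (rule L_two_exchange[OF _ b]) (use Nil.prems(1) that in \<open>simp add: N symmetric_on_swap tidx_length\<close>)
  then show ?case
    unfolding append_Nil expand by (intro eqv_sum[of "tidx n M"] eqv_right L_word_C[OF _ zs]) auto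
next
  case (Cons d ys)
  then obtain M where N: "N = Suc M"
    by (metis append_Cons length_Cons tidx_length)
  have d: "d \<in> {1..n}"
    using Cons.prems(2) by (simp add: N tidx_Cons_iff)
  have expand: "(\<Sum>x\<in>tidx n N. scal (c x) * L_word w u x (d # y))
      = (\<Sum>a=1..n. gen_L (u + of_nat M * w) a d * (\<Sum>x\<in>tidx n M. scal (c (a # x)) * L_word w u x y))" for y
    unfolding N sum_tidx_Suc sum_distrib_left
    by (intro sum.cong refl) (simp add: tidx_length scal_left_commute)
  have "(\<Sum>x\<in>tidx n M. scal (c (a # x)) * L_word w u x (ys @ b # b' # zs)) \<asymp> (\<Sum>x\<in>tidx n M. scal (c (a # x)) * L_word w u x (ys @ b' # b # zs))" for a
    using Cons.prems by (intro Cons.IH) (auto simp: N tidx_Cons_iff intro: symmetric_on_Cons)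
  then show ?case
    unfolding append_Cons expand by (intro eqv_sum[of "{1..n}"] eqv_left gen_C d)
qed

lemma L_word_symmetric:
  assumes "symmetric_on N c" and "y \<in> tidx n N" and "mset y = mset y'"
  shows "(\<Sum>x\<in>tidx n N. scal (c x) * L_word w u x y) \<asymp> (\<Sum>x\<in>tidx n N. scal (c x) * L_word w u x y')"
proof -
  define f where "f = (\<lambda>y. if length y = N then \<Sum>x\<in>tidx n N. scal (c x) * L_word w u x y else 0)"
  have "f y \<asymp> f y'"
  proof (rule mset_eq_swap_induct[where E = "(\<asymp>)" and A = "{1..n}"])
    show "f (ys @ a # b # zs) \<asymp> f (ys @ b # a # zs)" if "set (ys @ a # b # zs) \<subseteq> {1..n}" for ys a b zs
      using L_word_swap[OF assms(1), of ys a b zs] that by (auto simp: f_def tidx_def)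
  qed (use assms(2,3) in \<open>auto simp: tidx_def intro: eqv_trans\<close>)
  then show ?thesis
    using assms(2) mset_eq_length[OF assms(3)] by (simp add: f_def tidx_length)
qed

text \<open>The generator at \<open>s\<close> is carried through the word by induction: past the
  tail by the induction hypothesis, then past the leading generator by one defining relation. The
  remaining equalities only reorder sums and move scalars.\<close>

lemma fused_RLL:
  assumes "x \<in> tidx n N" "y \<in> tidx n N" "k \<in> {1..n}" "l \<in> {1..n}"
  shows "(\<Sum>z\<in>tidx n N. \<Sum>m=1..n. scal (RF (u - s) x k z m) * (L_word w u z y * gen_L s m l))
    \<asymp> (\<Sum>z\<in>tidx n N. \<Sum>m=1..n. scal (RF (u - s) z m y l) * (gen_L s k m * L_word w u x z))"
  using assms
proof (induction x arbitrary: N y k)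
  case Nil
  then have "N = 0" "y = []" by (auto simp: tidx_def)
  have s: "scal (if P then 1 else 0) = (if P then 1 else 0)" for P
    by simp
  show ?case
    using Nil.prems(3,4) unfolding \<open>N = 0\<close> \<open>y = []\<close>
    by (simp add: s if_distrib[of "\<lambda>t. t * _"] cong: if_cong)
next
  case (Cons a x)
  obtain M where N: "N = Suc M"
    using Cons.prems(1) by (cases N) (auto simp: tidx_def)
  obtain b y' where y: "y = b # y'"
    using Cons.prems(2) by (cases y) (auto simp: N tidx_def)
  have a: "a \<in> {1..n}" "x \<in> tidx n M" and b: "b \<in> {1..n}" "y' \<in> tidx n M"
    using Cons.prems by (auto simp: N y tidx_Cons_iff)
  define U where "U = u + of_nat M * w"
  have \<xi>: "u - s + of_nat M * w = U - s"
    by (simp add: U_def)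
  have "(\<Sum>z\<in>tidx n N. \<Sum>m=1..n. scal (RF (u - s) (a # x) k z m) * (L_word w u z y * gen_L s m l))
      = (\<Sum>c=1..n. \<Sum>z\<in>tidx n M. \<Sum>m=1..n. \<Sum>d=1..n.
          scal (R (U - s) a k c d) * (gen_L U c b * (scal (RF (u - s) x d z m) * (L_word w u z y' * gen_L s m l))))"
    unfolding N sum_tidx_Suc y R_fused.simps scal_sum sum_distrib_right
    by (intro sum.cong refl) (simp add: tidx_length[OF a(2)] tidx_length \<xi> U_def[symmetric] scal_mult mult.assoc scal_left_commute[of "gen_L _ _ _"])
  also have "\<dots> = (\<Sum>(c, z, m, d)\<in>{1..n} \<times> tidx n M \<times> {1..n} \<times> {1..n}.
          scal (R (U - s) a k c d) * (gen_L U c b * (scal (RF (u - s) x d z m) * (L_word w u z y' * gen_L s m l))))"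
    by (simp add: sum.cartesian_product)
  also have "\<dots> = (\<Sum>(c, d, z, m)\<in>{1..n} \<times> {1..n} \<times> tidx n M \<times> {1..n}.
          scal (R (U - s) a k c d) * (gen_L U c b * (scal (RF (u - s) x d z m) * (L_word w u z y' * gen_L s m l))))"
    by (rule sum.reindex_bij_witness[of _ "\<lambda>(c, d, z, m). (c, z, m, d)" "\<lambda>(c, z, m, d). (c, d, z, m)"]) auto
  also have "\<dots> = (\<Sum>c=1..n. \<Sum>d=1..n. scal (R (U - s) a k c d) * (gen_L U c b *
      (\<Sum>z\<in>tidx n M. \<Sum>m=1..n. scal (RF (u - s) x d z m) * (L_word w u z y' * gen_L s m l))))"
    unfolding sum_distrib_left by (simp add: sum.cartesian_product)
  also have "\<dots> \<asymp> (\<Sum>c=1..n. \<Sum>d=1..n. scal (R (U - s) a k c d) * (gen_L U c b *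
      (\<Sum>z\<in>tidx n M. \<Sum>m=1..n. scal (RF (u - s) z m y' l) * (gen_L s d m * L_word w u x z))))"
    by (intro eqv_sum[of "{1..n}"] eqv_scal eqv_left gen_C b(1) Cons.IH a(2) b(2) Cons.prems(4))
  also have "\<dots> = (\<Sum>c=1..n. \<Sum>d=1..n. \<Sum>z\<in>tidx n M. \<Sum>m=1..n.
      scal (R (U - s) a k c d) * (gen_L U c b * (scal (RF (u - s) z m y' l) * (gen_L s d m * L_word w u x z))))"
    unfolding sum_distrib_left ..
  also have "\<dots> = (\<Sum>c=1..n. \<Sum>d=1..n. \<Sum>z\<in>tidx n M. \<Sum>m=1..n.
      scal (RF (u - s) z m y' l) * (scal (R (U - s) a k c d) * (gen_L U c b * gen_L s d m) * L_word w u x z))"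
    by (intro sum.cong refl scal_shuffle)
  also have "\<dots> = (\<Sum>(c, d, z, m)\<in>{1..n} \<times> {1..n} \<times> tidx n M \<times> {1..n}.
      scal (RF (u - s) z m y' l) * (scal (R (U - s) a k c d) * (gen_L U c b * gen_L s d m) * L_word w u x z))"
    by (simp add: sum.cartesian_product)
  also have "\<dots> = (\<Sum>(z, m, c, d)\<in>tidx n M \<times> {1..n} \<times> {1..n} \<times> {1..n}.
      scal (RF (u - s) z m y' l) * (scal (R (U - s) a k c d) * (gen_L U c b * gen_L s d m) * L_word w u x z))"
    by (rule sum.reindex_bij_witness[of _ "\<lambda>(z, m, c, d). (c, d, z, m)" "\<lambda>(c, d, z, m). (z, m, c, d)"]) auto
  also have "\<dots> = (\<Sum>z\<in>tidx n M. \<Sum>m=1..n. scal (RF (u - s) z m y' l) *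
      ((\<Sum>c=1..n. \<Sum>d=1..n. scal (R (U - s) a k c d) * (gen_L U c b * gen_L s d m)) * L_word w u x z))"
    unfolding sum_distrib_left sum_distrib_right by (simp add: sum.cartesian_product)
  also have "\<dots> \<asymp> (\<Sum>z\<in>tidx n M. \<Sum>m=1..n. scal (RF (u - s) z m y' l) *
      ((\<Sum>c=1..n. \<Sum>d=1..n. scal (R (U - s) c d b m) * (gen_L s k d * gen_L U a c)) * L_word w u x z))"
    by (rule eqv_sum, rule eqv_sum, rule eqv_scal, rule eqv_right) (intro RLL L_word_C[OF a(2)] a(1) b(1) Cons.prems(3); assumption)+
  also have "\<dots> = (\<Sum>(z, m, c, d)\<in>tidx n M \<times> {1..n} \<times> {1..n} \<times> {1..n}.
      scal (RF (u - s) z m y' l) * (scal (R (U - s) c d b m) * (gen_L s k d * gen_L U a c) * L_word w u x z))"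
    unfolding sum_distrib_left sum_distrib_right by (simp add: sum.cartesian_product)
  also have "\<dots> = (\<Sum>(c, z, d, m)\<in>{1..n} \<times> tidx n M \<times> {1..n} \<times> {1..n}.
      scal (RF (u - s) z m y' l) * (scal (R (U - s) c d b m) * (gen_L s k d * gen_L U a c) * L_word w u x z))"
    by (rule sum.reindex_bij_witness[of _ "\<lambda>(c, z, d, m). (z, m, c, d)" "\<lambda>(z, m, c, d). (c, z, d, m)"]) auto
  also have "\<dots> = (\<Sum>c=1..n. \<Sum>z\<in>tidx n M. \<Sum>d=1..n. \<Sum>m=1..n.
      scal (RF (u - s) z m y' l) * (scal (R (U - s) c d b m) * (gen_L s k d * gen_L U a c) * L_word w u x z))"
    by (simp add: sum.cartesian_product)
  also have "\<dots> = (\<Sum>z\<in>tidx n N. \<Sum>d=1..n. scal (RF (u - s) z d y l) * (gen_L s k d * L_word w u (a # x) z))"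
    unfolding N sum_tidx_Suc y R_fused.simps scal_sum sum_distrib_right
    by (intro sum.cong refl)
      (simp add: tidx_length[OF a(2)] tidx_length \<xi> U_def[symmetric], simp add: scal_mult[symmetric] mult.assoc[symmetric] mult.commute)
  finally show ?case .
qed

end

section \<open>Symmetrization and the matrix entries\<close>

lemma symmetrizer_eq: "symmetrizer N z y = (\<Sum>\<pi> | \<pi> permutes {..<N}. if z = permute_list \<pi> y then 1 / fact N else 0)"
proof -
  have "(if z = permute_list \<pi> y then 1 else 0) / fact N = (if z = permute_list \<pi> y then 1 / fact N else (0 :: complex))" for \<pi>
    by simp
  then show ?thesis
    unfolding symmetrizer_def sum_divide_distrib by simp
qed

text \<open>Rearranging the column index by \<open>\<rho>\<close> is absorbed by the bijection
  \<open>\<pi> \<mapsto> \<rho> \<circ> \<pi>\<close> of the symmetric group.\<close>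

lemma symmetric_on_symmetrizer: "symmetric_on N (symmetrizer N x)"
  unfolding symmetric_on_def
proof (intro allI impI)
  fix y y' :: "nat list"
  assume len: "length y = N" and eq: "mset y = mset y'"
  obtain \<rho> where \<rho>: "\<rho> permutes {..<length y'}" "permute_list \<rho> y' = y"
    by (rule mset_eq_permutation[OF eq]) (rule that)
  have len': "length y' = N"
    using len mset_eq_length[OF eq] by simp
  have comp: "permute_list \<pi> y = permute_list (\<rho> \<circ> \<pi>) y'" if "\<pi> permutes {..<N}" for \<pi>
    using permute_list_compose[of \<pi> y' \<rho>] that \<rho>(2) len' by simp
  have inv: "\<rho> \<circ> inv_into UNIV \<rho> = id" "inv_into UNIV \<rho> \<circ> \<rho> = id"
    using \<rho>(1) permutes_inv_o by blast+
  have "(\<Sum>\<pi> | \<pi> permutes {..<N}. if x = permute_list \<pi> y then 1 / fact N else (0 :: complex))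
      = (\<Sum>\<pi> | \<pi> permutes {..<N}. if x = permute_list (\<rho> \<circ> \<pi>) y' then 1 / fact N else 0)"
    by (intro sum.cong refl) (simp add: comp)
  also have "\<dots> = (\<Sum>\<pi> | \<pi> permutes {..<N}. if x = permute_list \<pi> y' then 1 / fact N else 0)"
  proof (rule sum.reindex_bij_witness[of _ "\<lambda>\<pi>. inv_into UNIV \<rho> \<circ> \<pi>" "\<lambda>\<pi>. \<rho> \<circ> \<pi>"])
    show "inv_into UNIV \<rho> \<circ> (\<rho> \<circ> \<pi>) = \<pi>" "\<rho> \<circ> (inv_into UNIV \<rho> \<circ> \<pi>) = \<pi>" for \<pi>
      by (simp_all add: o_assoc inv)
    show "\<rho> \<circ> \<pi> \<in> {\<pi>. \<pi> permutes {..<N}}" "inv_into UNIV \<rho> \<circ> \<pi> \<in> {\<pi>. \<pi> permutes {..<N}}" if "\<pi> \<in> {\<pi>. \<pi> permutes {..<N}}" for \<pi>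
      using that \<rho>(1) len' by (auto intro: permutes_compose permutes_inv)
  qed simp
  finally show "symmetrizer N x y = symmetrizer N x y'"
    by (simp add: symmetrizer_eq)
qed

lemma tidx_permute_list:
  assumes "y \<in> tidx n N" "\<pi> permutes {..<N}"
  shows "permute_list \<pi> y \<in> tidx n N" "mset y = mset (permute_list \<pi> y)"
  using assms mset_permute_list[of \<pi> y] set_permute_list[of \<pi> y] by (simp_all add: tidx_def)

lemma card_permutes: "card {\<pi>. \<pi> permutes {..<N}} = fact N"
  by (rule card_permutations) auto

text \<open>A symmetric row vector is fixed by right multiplication with the projector, which allows
  a symmetrizer to be inserted or absorbed.\<close>

lemma symmetrizer_average:
  fixes F :: "nat list \<Rightarrow> complex"
  assumes F: "\<And>y'. mset y = mset y' \<Longrightarrow> F y = F y'" and y: "y \<in> tidx n N"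
  shows "(\<Sum>z\<in>tidx n N. F z * symmetrizer N z y) = F y"
proof -
  have "(\<Sum>z\<in>tidx n N. F z * symmetrizer N z y)
      = (\<Sum>\<pi> | \<pi> permutes {..<N}. \<Sum>z\<in>tidx n N. if z = permute_list \<pi> y then F z / fact N else 0)"
    unfolding symmetrizer_eq sum_distrib_left by (subst sum.swap) (intro sum.cong refl, simp)
  also have "\<dots> = (\<Sum>\<pi> | \<pi> permutes {..<N}. F y / fact N)"
    by (intro sum.cong refl) (use tidx_permute_list[OF y] F in simp)
  also have "\<dots> = F y"
    by (simp add: card_permutes)
  finally show ?thesis .
qed

text \<open>The induction runs downwards from \<open>N\<close>, where the product is empty. Each
  further leg changes a single entry of the index list.\<close>

lemma foldr_leg:
  assumes "i \<le> N" "x \<in> tidx n N" "y \<in> tidx n N"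
  shows "foldr (tmul n N) (map (\<lambda>s. leg N s (M s)) [i..<N]) tone x y
    = (if \<forall>t<i. x ! t = y ! t then prod_list (map (\<lambda>s. M s (x ! s) (y ! s)) [i..<N]) else 0)"
  using assms
proof (induction i arbitrary: x rule: inc_induct)
  case base
  have "x = y \<longleftrightarrow> (\<forall>t<N. x ! t = y ! t)"
    using base by (auto simp: tidx_def list_eq_iff_nth_eq)
  then show ?case by (simp add: tone_def)
next
  case (step i)
  define G where "G = (\<lambda>z. if \<forall>t<Suc i. z ! t = y ! t then prod_list (map (\<lambda>s. M s (z ! s) (y ! s)) [Suc i..<N]) else 0)"
  \<comment> \<open>The only intermediate index that contributes: it agrees with \<open>x\<close>
    off position \<open>i\<close> because of leg \<open>i\<close>, and with \<open>y\<close> at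
    \<open>i\<close> because of the later legs.\<close>
  define z0 where "z0 = x[i := y ! i]"
  have len: "length x = N" "length y = N"
    using step.prems by (simp_all add: tidx_length)
  have "y ! i \<in> {1..n}"
  proof -
    have "set y \<subseteq> {1..n}"
      using step.prems(2) by (simp add: tidx_def)
    then show ?thesis
      by (rule subsetD) (use step.hyps(2) len in simp)
  qed
  then have z0: "z0 \<in> tidx n N"
    using step.prems(1) set_update_subset_insert[of x i "y ! i"] by (auto simp: z0_def tidx_def)
  have "foldr (tmul n N) (map (\<lambda>s. leg N s (M s)) [i..<N]) tone x y
      = (\<Sum>z\<in>tidx n N. leg N i (M i) x z * foldr (tmul n N) (map (\<lambda>s. leg N s (M s)) [Suc i..<N]) tone z y)"
    using step.hyps(2) by (simp add: upt_conv_Cons tmul_def)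
  also have "\<dots> = (\<Sum>z\<in>tidx n N. leg N i (M i) x z * G z)"
    by (intro sum.cong refl) (simp only: step.IH[OF _ step.prems(2)] G_def)
  also have "\<dots> = (\<Sum>z\<in>tidx n N. if z = z0 then leg N i (M i) x z0 * G z0 else 0)"
  proof (intro sum.cong refl)
    fix z assume z: "z \<in> tidx n N"
    show "leg N i (M i) x z * G z = (if z = z0 then leg N i (M i) x z0 * G z0 else 0)"
    proof (cases "(\<forall>t<N. t \<noteq> i \<longrightarrow> x ! t = z ! t) \<and> z ! i = y ! i")
      case True
      have "z ! t = z0 ! t" if "t < N" for t
        using True that len by (cases "t = i") (simp_all add: z0_def)
      then have "z = z0"
        using tidx_length[OF z] tidx_length[OF z0] by (intro nth_equalityI) simp_all
      then show ?thesis by simp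
    next
      case False
      then have "leg N i (M i) x z * G z = 0" "z \<noteq> z0"
        using step.hyps(2) len by (auto simp: leg_def G_def z0_def)
      then show ?thesis by simp
    qed
  qed
  also have "\<dots> = leg N i (M i) x z0 * G z0"
    using z0 by simp
  also have "leg N i (M i) x z0 = M i (x ! i) (y ! i)"
    using len step.hyps(2) by (simp add: leg_def z0_def)
  also have "G z0 = (if \<forall>t<i. x ! t = y ! t then prod_list (map (\<lambda>s. M s (x ! s) (y ! s)) [Suc i..<N]) else 0)"
  proof -
    have "(\<forall>t<Suc i. z0 ! t = y ! t) \<longleftrightarrow> (\<forall>t<i. x ! t = y ! t)"
      using len step.hyps(2) by (auto simp: z0_def less_Suc_eq nth_list_update)
    moreover have "map (\<lambda>s. M s (z0 ! s) (y ! s)) [Suc i..<N] = map (\<lambda>s. M s (x ! s) (y ! s)) [Suc i..<N]"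
      by (simp add: z0_def)
    ultimately show ?thesis by (simp only: G_def)
  qed
  finally show ?case
    using step.hyps(2) by (auto simp: upt_conv_Cons)
qed

lemma prod_list_gen_L:
  assumes "length x = N" "length y = N"
  shows "prod_list (map (\<lambda>s. gen_L (u + of_nat (N - 1 - s) * w) (x ! s) (y ! s)) [0..<N]) = L_word w u x y"
  using assms
proof (induction x arbitrary: y N)
  case (Cons a x)
  obtain M where N: "N = Suc M" using Cons.prems by (cases N) auto
  obtain b y' where y: "y = b # y'" using Cons.prems by (cases y) auto
  have "[0..<N] = 0 # map Suc [0..<M]"
    by (simp add: N upt_conv_Cons map_Suc_upt)
  then have "prod_list (map (\<lambda>s. gen_L (u + of_nat (N - 1 - s) * w) ((a # x) ! s) (y ! s)) [0..<N])
      = gen_L (u + of_nat M * w) a b * prod_list (map (\<lambda>s. gen_L (u + of_nat (M - 1 - s) * w) (x ! s) (y' ! s)) [0..<M])"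
    by (simp add: N y o_def)
  then show ?case
    using Cons.IH[of M y'] Cons.prems by (simp add: N y)
qed simp

lemma fused_L_eq:
  assumes "x \<in> tidx n N" "y \<in> tidx n N"
  shows "fused_L n N w u x y = L_word w u x y"
  using foldr_leg[of 0 N x n y "\<lambda>s. gen_L (u + of_nat (N - 1 - s) * w)"] assms prod_list_gen_L[of x N y u w]
  by (simp add: fused_L_def tidx_length)

text \<open>Dual functionals are built inductively. Independence makes the new vector differ
  somewhere from its projection to the earlier ones, and evaluation at such a place is corrected to
  vanish on those.\<close>

lemma independent_dual:
  fixes f :: "'i \<Rightarrow> 'x \<Rightarrow> complex"
  assumes S: "finite S" and X: "finite X"
    and indep: "\<And>c. (\<forall>x\<in>X. (\<Sum>i\<in>S. c i * f i x) = 0) \<Longrightarrow> \<forall>i\<in>S. c i = 0"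
  shows "\<exists>D. \<forall>i\<in>S. \<forall>j\<in>S. (\<Sum>x\<in>X. D j x * f i x) = (if i = j then 1 else 0)"
  using S indep
proof (induction S rule: finite_induct)
  case (insert s S)
  have "\<exists>D. \<forall>i\<in>S. \<forall>j\<in>S. (\<Sum>x\<in>X. D j x * f i x) = (if i = j then 1 else 0)"
  proof (rule insert.IH)
    fix c assume c: "\<forall>x\<in>X. (\<Sum>i\<in>S. c i * f i x) = 0"
    have "(\<Sum>i\<in>S. (if i = s then 0 else c i) * f i x) = (\<Sum>i\<in>S. c i * f i x)" for x
      using insert.hyps(2) by (intro sum.cong) auto
    then have "\<forall>i\<in>insert s S. (if i = s then 0 else c i) = 0"
      using c insert.hyps by (intro insert.prems) simp
    then show "\<forall>i\<in>S. c i = 0"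
      using insert.hyps(2) by (metis insertI2)
  qed
  then obtain D where D: "\<And>i j. i \<in> S \<Longrightarrow> j \<in> S \<Longrightarrow> (\<Sum>x\<in>X. D j x * f i x) = (if i = j then 1 else 0)"
    by blast
  define p where "p = (\<lambda>j. \<Sum>x\<in>X. D j x * f s x)"
  \<comment> \<open>Otherwise \<open>f s\<close> would be the combination of the earlier vectors
    with coefficients \<open>p\<close>, a nontrivial dependence.\<close>
  have "\<exists>x1\<in>X. f s x1 - (\<Sum>j\<in>S. p j * f j x1) \<noteq> 0"
  proof (rule ccontr)
    assume "\<not> ?thesis"
    then have z: "f s x - (\<Sum>j\<in>S. p j * f j x) = 0" if "x \<in> X" for x
      using that by blast
    have "(\<Sum>i\<in>insert s S. (if i = s then 1 else - p i) * f i x) = f s x - (\<Sum>j\<in>S. p j * f j x)" for x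
    proof -
      have "(\<Sum>i\<in>S. (if i = s then 1 else - p i) * f i x) = (\<Sum>j\<in>S. - (p j * f j x))"
        using insert.hyps(2) by (intro sum.cong) auto
      then show ?thesis
        using insert.hyps by (simp add: sum_negf)
    qed
    then have "\<forall>i\<in>insert s S. (if i = s then 1 else - p i) = 0"
      using z by (intro insert.prems) simp
    then show False by simp
  qed
  then obtain x1 where x1: "x1 \<in> X" and nz: "f s x1 - (\<Sum>j\<in>S. p j * f j x1) \<noteq> 0"
    by blast
  define d where "d = f s x1 - (\<Sum>j\<in>S. p j * f j x1)"
  \<comment> \<open>Evaluation at \<open>x1\<close> minus its part seen by the earlier dual
    functionals, normalized to take the value 1 on \<open>f s\<close>.\<close>
  define E where "E = (\<lambda>x. ((if x = x1 then 1 else 0) - (\<Sum>j\<in>S. f j x1 * D j x)) / d)"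
  have E: "(\<Sum>x\<in>X. E x * g x) = (g x1 - (\<Sum>j\<in>S. f j x1 * (\<Sum>x\<in>X. D j x * g x))) / d" for g
  proof -
    have "(\<Sum>x\<in>X. E x * g x) = ((\<Sum>x\<in>X. if x = x1 then g x else 0) - (\<Sum>x\<in>X. \<Sum>j\<in>S. f j x1 * (D j x * g x))) / d"
      unfolding sum_subtractf[symmetric] sum_divide_distrib
      by (intro sum.cong refl) (simp add: E_def left_diff_distrib sum_distrib_right mult.assoc)
    also have "(\<Sum>x\<in>X. \<Sum>j\<in>S. f j x1 * (D j x * g x)) = (\<Sum>j\<in>S. f j x1 * (\<Sum>x\<in>X. D j x * g x))"
      unfolding sum_distrib_left by (rule sum.swap)
    finally show ?thesis
      using x1 X by simp
  qed
  have Ei: "(\<Sum>x\<in>X. E x * f i x) = 0" if "i \<in> S" for i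
  proof -
    have "(\<Sum>j\<in>S. f j x1 * (\<Sum>x\<in>X. D j x * f i x)) = (\<Sum>j\<in>S. if j = i then f i x1 else 0)"
      using D[OF that] by (intro sum.cong) auto
    then show ?thesis
      using that insert.hyps(1) by (simp add: E)
  qed
  have Es: "(\<Sum>x\<in>X. E x * f s x) = 1"
  proof -
    have "(\<Sum>x\<in>X. D j x * f s x) = p j" for j
      by (simp add: p_def)
    then show ?thesis
      using nz by (simp only: E) (simp add: d_def mult.commute)
  qed
  \<comment> \<open>The earlier functionals are corrected by \<open>E\<close> so that they vanish on
    \<open>f s\<close>; on the earlier vectors \<open>E\<close> is 0, so nothing changes
    there.\<close>
  define D' where "D' = (\<lambda>j x. if j = s then E x else D j x - p j * E x)"
  have "(\<Sum>x\<in>X. D' j x * f i x) = (if i = j then 1 else 0)" if i: "i \<in> insert s S" and j: "j \<in> insert s S" for i j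
  proof (cases "j = s")
    case True
    then show ?thesis
      using i Ei Es insert.hyps(2) by (auto simp: D'_def)
  next
    case False
    then have "j \<in> S" using j by simp
    have "(\<Sum>x\<in>X. D' j x * f i x) = (\<Sum>x\<in>X. D j x * f i x) - p j * (\<Sum>x\<in>X. E x * f i x)"
      unfolding sum_distrib_left sum_subtractf[symmetric]
      by (intro sum.cong refl) (use False in \<open>simp add: D'_def algebra_simps\<close>)
    then show ?thesis
      using i D[OF _ \<open>j \<in> S\<close>] Ei Es False by (auto simp: p_def)
  qed
  then show ?case by blast
qed simp

section \<open>The vectors Psi and the commutation relation\<close>

context fusion_setting
begin

lemma symmetrizer_average_eqv:
  assumes F: "\<And>y'. mset y = mset y' \<Longrightarrow> F y \<asymp> F y'" and y: "y \<in> tidx n N"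
  shows "(\<Sum>z\<in>tidx n N. scal (symmetrizer N z y) * F z) \<asymp> F y"
proof -
  have "(\<Sum>z\<in>tidx n N. scal (symmetrizer N z y) * F z)
      = (\<Sum>\<pi> | \<pi> permutes {..<N}. \<Sum>z\<in>tidx n N. if z = permute_list \<pi> y then scal (1 / fact N) * F z else 0)"
    unfolding symmetrizer_eq scal_sum sum_distrib_right by (subst sum.swap) (intro sum.cong refl, simp)
  also have "\<dots> = (\<Sum>\<pi> | \<pi> permutes {..<N}. scal (1 / fact N) * F (permute_list \<pi> y))"
    by (intro sum.cong refl) (use tidx_permute_list[OF y] in simp)
  also have "\<dots> \<asymp> (\<Sum>\<pi> | \<pi> permutes {..<N}. scal (1 / fact N) * F y)"
    by (intro eqv_sum eqv_scal eqv_sym[OF F]) (use tidx_permute_list(2)[OF y] in simp)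
  also have "\<dots> = scal (\<Sum>\<pi> | \<pi> permutes {..<N}. 1 / fact N) * F y"
    by (simp only: scal_sum sum_distrib_right)
  also have "\<dots> = F y"
    by (simp add: card_permutes)
  finally show ?thesis .
qed

lemma tens_map_rev:
  assumes "length y = m"
  shows "tens (map f (rev [0..<m])) y = (\<Prod>s<m. v (int (y ! s)) (f (m - 1 - s)))"
  using assms
proof (induction m arbitrary: y)
  case (Suc m)
  then obtain b y' where "y = b # y'" "length y' = m" by (cases y) auto
  then show ?case
    using Suc.IH[of y'] by (simp add: prod.lessThan_Suc_shift del: prod.lessThan_Suc)
qed simp

text \<open>Adding \<open>e_i\<close> raises the reduced coordinate by \<open>1 - 1/n\<close>, hence
  lowers the argument by \<open>n w - w\<close>, while the spectral parameter drops by
  \<open>w\<close>. From factor to factor the argument thus decreases by exactly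
  \<open>n w\<close>.\<close>

lemma Psi_eq:
  assumes i: "i \<in> {1..n}"
  shows "Psi n N \<tau> w a u i x
    = tsum (symmetrizer N x) (points (u + of_nat (N - 1) * w - of_nat n * w * bar n a i - of_nat (N - 1) * of_nat n * w) N)"
proof -
  define P where "P = u + of_nat (N - 1) * w - of_nat n * w * bar n a i - of_nat (N - 1) * of_nat n * w"
  have bar: "bar n (shift a i s) i = bar n a i + of_nat s - of_nat s / of_nat n" for s
    using i by (simp add: bar_def shift_def sum.distrib add_divide_distrib)
  have arg: "u + of_nat (N - 1 - s) * w - of_nat n * w * bar n (shift a i s) i = P + of_nat (N - 1 - s) * of_nat n * w"
    if "s < N" for s
  proof -
    have sub: "(of_nat (N - 1 - s) :: complex) = of_nat (N - 1) - of_nat s"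
      using that by (simp add: of_nat_diff)
    have "of_nat n * w * (of_nat s / of_nat n) = of_nat s * w"
      using n_pos by simp
    then show ?thesis
      unfolding bar sub P_def by (simp add: algebra_simps)
  qed
  have "tens (points P N) y = (\<Prod>s<N. ivec n \<tau> w (shift a i s) i (u + of_nat (N - 1 - s) * w) (y ! s))"
    if "y \<in> tidx n N" for y
    unfolding points_def tens_map_rev[OF tidx_length[OF that]]
    by (intro prod.cong refl) (simp only: ivec_def lessThan_iff arg)
  then show ?thesis
    unfolding Psi_def tsum_def P_def[symmetric] by simp
qed

text \<open>Psi is a symmetrized tensor, while \<open>R_fused_points\<close> concerns a plain one.
  Since the left-symmetrized fused R-matrix is symmetric in its column index, the symmetrizer inside
  Psi is absorbed.\<close>

lemma R_fused_Psi:
  assumes N: "N > 0" and cop: "coprime n N" and w: "w = of_nat n / of_nat N"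
    and \<xi>: "\<And>j. j < N \<Longrightarrow> h (\<xi> + of_nat j * w) \<noteq> 0" and k: "k \<in> {1..n}" and l: "l \<in> {1..n}" and i: "i \<in> {1..n}"
  shows "(\<Sum>z\<in>tidx n N. (\<Sum>y\<in>tidx n N. symmetrizer N x y * RF \<xi> y k z l) * Psi n N \<tau> w a u i z)
    = (if k = l then fused_factor N \<xi> * Psi n N \<tau> w a u i x else 0)"
proof -
  define D where "D = (\<lambda>z. \<Sum>y\<in>tidx n N. symmetrizer N x y * RF \<xi> y k z l)"
  define P where "P = u + of_nat (N - 1) * w - of_nat n * w * bar n a i - of_nat (N - 1) * of_nat n * w"
  have Psi: "Psi n N \<tau> w a u i z = (\<Sum>y\<in>tidx n N. symmetrizer N z y * tens (points P N) y)" for z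
    unfolding Psi_eq[OF i] by (simp add: tsum_def P_def)
  have D: "(\<Sum>z\<in>tidx n N. D z * symmetrizer N z y) = D y" if "y \<in> tidx n N" for y
    unfolding D_def
    by (rule symmetrizer_average[OF _ that]) (rule R_fused_symmetric[OF symmetric_on_symmetrizer \<xi> that])
  have "(\<Sum>z\<in>tidx n N. D z * Psi n N \<tau> w a u i z) = (\<Sum>y\<in>tidx n N. (\<Sum>z\<in>tidx n N. D z * symmetrizer N z y) * tens (points P N) y)"
    unfolding Psi sum_distrib_left sum_distrib_right by (subst sum.swap) (simp add: mult.assoc)
  also have "\<dots> = (\<Sum>y\<in>tidx n N. D y * tens (points P N) y)"
    by (intro sum.cong refl) (simp only: D)
  also have "\<dots> = (\<Sum>y\<in>tidx n N. \<Sum>z\<in>tidx n N. symmetrizer N x y * RF \<xi> y k z l * tens (points P N) z)"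
    unfolding D_def sum_distrib_right by (rule sum.swap)
  also have "\<dots> = (if k = l then fused_factor N \<xi> * tsum (symmetrizer N x) (points P N) else 0)"
    by (rule R_fused_points[OF symmetric_on_symmetrizer N cop w \<xi> k l])
  finally show ?thesis
    unfolding D_def Psi_eq[OF i] P_def .
qed

text \<open>By \<open>L_word_symmetric\<close> the left-symmetrized word is symmetric in its column
  index modulo the relations, so the right symmetrizer acts on it as the identity.\<close>

lemma fused_L_sym_eqv:
  assumes x: "x \<in> tidx n N" and y: "y \<in> tidx n N"
  shows "fused_L_sym n N w u x y \<asymp> (\<Sum>z\<in>tidx n N. scal (symmetrizer N x z) * L_word w u z y)"
proof -
  define M where "M = (\<lambda>y. \<Sum>z\<in>tidx n N. scal (symmetrizer N x z) * L_word w u z y)"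
  have "fused_L_sym n N w u x y
      = (\<Sum>z\<in>tidx n N. \<Sum>z'\<in>tidx n N. scal (symmetrizer N z' y) * (scal (symmetrizer N x z) * L_word w u z z'))"
    unfolding fused_L_sym_def tmul_def smat_def sum_distrib_left
    by (intro sum.cong refl) (simp add: fused_L_eq scal_central scal_left_commute[of "scal (symmetrizer N x _)"])
  also have "\<dots> = (\<Sum>z'\<in>tidx n N. scal (symmetrizer N z' y) * M z')"
    unfolding M_def sum_distrib_left by (rule sum.swap)
  also have "\<dots> \<asymp> M y"
  proof (rule symmetrizer_average_eqv[OF _ y])
    show "M y \<asymp> M y'" if "mset y = mset y'" for y'
      unfolding M_def by (rule L_word_symmetric[OF symmetric_on_symmetrizer y that])
  qed
  finally show ?thesis
    unfolding M_def .
qed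

lemma Lambda_relation:
  assumes fused: "(\<Sum>y\<in>tidx n N. fused_L_sym n N w u x y * scal (\<psi> i y)) \<asymp> (\<Sum>j=1..n. lam i j * scal (\<psi> j x))"
    and x: "x \<in> tidx n N"
  shows "(\<Sum>z\<in>tidx n N. scal (symmetrizer N x z) * (\<Sum>y\<in>tidx n N. scal (\<psi> i y) * L_word w u z y))
    \<asymp> (\<Sum>j=1..n. scal (\<psi> j x) * lam i j)"
proof -
  have "(\<Sum>z\<in>tidx n N. scal (symmetrizer N x z) * (\<Sum>y\<in>tidx n N. scal (\<psi> i y) * L_word w u z y))
      = (\<Sum>y\<in>tidx n N. scal (\<psi> i y) * (\<Sum>z\<in>tidx n N. scal (symmetrizer N x z) * L_word w u z y))"
    unfolding sum_distrib_left by (subst sum.swap) (intro sum.cong refl scal_left_commute)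
  also have "\<dots> \<asymp> (\<Sum>y\<in>tidx n N. scal (\<psi> i y) * fused_L_sym n N w u x y)"
    by (intro eqv_sum[of "tidx n N"] eqv_scal eqv_sym[OF fused_L_sym_eqv] x)
  also have "\<dots> = (\<Sum>y\<in>tidx n N. fused_L_sym n N w u x y * scal (\<psi> i y))"
    by (simp only: scal_central)
  also note fused
  also have "(\<Sum>j=1..n. lam i j * scal (\<psi> j x)) = (\<Sum>j=1..n. scal (\<psi> j x) * lam i j)"
    by (simp only: scal_central)
  finally show ?thesis .
qed

text \<open>The fused RLL relation is contracted with a row of the symmetrizer on the left and with
  \<open>\<psi> i\<close> on the right. On one side the R-matrix reaches the vectors
  \<open>\<psi> j\<close> after \<open>lam\<close> has appeared, on the other it meets
  \<open>\<psi> i\<close> before; in both cases it becomes the same scalar \<open>g\<close>.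
  Independence then separates the entries \<open>lam i j\<close>.\<close>

theorem Lambda_commutes:
  fixes \<psi> :: "nat \<Rightarrow> nat list \<Rightarrow> complex" and lam :: "nat \<Rightarrow> nat \<Rightarrow> falg"
  assumes \<xi>: "\<And>m. m < N \<Longrightarrow> h (u - s + of_nat m * w) \<noteq> 0" and g: "g \<noteq> 0"
    and \<psi>: "\<And>x k l i. k \<in> {1..n} \<Longrightarrow> l \<in> {1..n} \<Longrightarrow> i \<in> {1..n} \<Longrightarrow>
      (\<Sum>z\<in>tidx n N. (\<Sum>y\<in>tidx n N. symmetrizer N x y * RF (u - s) y k z l) * \<psi> i z) = (if k = l then g * \<psi> i x else 0)"
    and indep: "\<And>c. (\<forall>x\<in>tidx n N. (\<Sum>i=1..n. c i * \<psi> i x) = 0) \<Longrightarrow> \<forall>i\<in>{1..n}. c i = 0"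
    and fused: "\<And>i x. i \<in> {1..n} \<Longrightarrow> x \<in> tidx n N \<Longrightarrow>
      (\<Sum>y\<in>tidx n N. fused_L_sym n N w u x y * scal (\<psi> i y)) \<asymp> (\<Sum>j=1..n. lam i j * scal (\<psi> j x))"
    and lam: "\<And>i j. i \<in> {1..n} \<Longrightarrow> j \<in> {1..n} \<Longrightarrow> lam i j \<in> C"
    and i: "i \<in> {1..n}" and j: "j \<in> {1..n}" and k: "k \<in> {1..n}" and l: "l \<in> {1..n}"
  shows "lam i j * gen_L s k l \<asymp> gen_L s k l * lam i j"
proof -
  define T where "T = tidx n N"
  define Y where "Y = (\<lambda>z. \<Sum>y\<in>T. scal (\<psi> i y) * L_word w u z y)"
  define Lam where "Lam = (\<lambda>x. \<Sum>j=1..n. scal (\<psi> j x) * lam i j)"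
  have Y_Lam: "(\<Sum>z\<in>T. scal (symmetrizer N x z) * Y z) \<asymp> Lam x" if "x \<in> T" for x
    using that unfolding T_def Y_def Lam_def
    by (intro Lambda_relation[where \<psi> = \<psi> and lam = lam and i = i] fused i)
  have main: "(\<Sum>j=1..n. scal (\<psi> j x0) * (scal g * (lam i j * gen_L s k l)))
      \<asymp> (\<Sum>j=1..n. scal (\<psi> j x0) * (scal g * (gen_L s k l * lam i j)))" if x0: "x0 \<in> T" for x0
  proof -
    define D where "D = (\<lambda>m z. \<Sum>x\<in>T. symmetrizer N x0 x * RF (u - s) x k z m)"
    have D: "(\<Sum>z'\<in>T. D m z' * symmetrizer N z' z) = D m z" if "z \<in> T" for m z
      unfolding T_def
    proof (rule symmetrizer_average)
      show "D m z = D m y" if "mset z = mset y" for y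
        unfolding D_def T_def
        by (rule R_fused_symmetric[OF symmetric_on_symmetrizer \<xi> _ that]) (use \<open>z \<in> T\<close> in \<open>simp_all add: T_def\<close>)
    qed (use that in \<open>simp add: T_def\<close>)
    define M where "M = (\<lambda>z. \<Sum>x\<in>T. scal (symmetrizer N x0 x) * L_word w u x z)"
    define G where "G = (\<lambda>m z. \<Sum>y\<in>T. RF (u - s) z m y l * \<psi> i y)"
    have GP: "(\<Sum>z\<in>T. G m z * symmetrizer N z' z) = (if m = l then g * \<psi> i z' else 0)" if "m \<in> {1..n}" for m z'
    proof -
      have "(\<Sum>z\<in>T. G m z * symmetrizer N z' z) = (\<Sum>y\<in>T. (\<Sum>z\<in>T. symmetrizer N z' z * RF (u - s) z m y l) * \<psi> i y)"
        unfolding G_def sum_distrib_right by (subst sum.swap) (simp add: mult_ac)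
      then show ?thesis
        using \<psi>[OF that l i] by (simp add: T_def)
    qed
    have "(\<Sum>x\<in>T. scal (symmetrizer N x0 x) * (\<Sum>y\<in>T. scal (\<psi> i y) * (\<Sum>z\<in>T. \<Sum>m=1..n. scal (RF (u - s) x k z m) * (L_word w u z y * gen_L s m l))))
        = (\<Sum>(x, y, z, m)\<in>T \<times> T \<times> T \<times> {1..n}. scal (symmetrizer N x0 x) * (scal (\<psi> i y) * (scal (RF (u - s) x k z m) * (L_word w u z y * gen_L s m l))))"
      unfolding sum_distrib_left by (simp add: sum.cartesian_product)
    also have "\<dots> = (\<Sum>(m, z, y, x)\<in>{1..n} \<times> T \<times> T \<times> T. scal (symmetrizer N x0 x) * (scal (\<psi> i y) * (scal (RF (u - s) x k z m) * (L_word w u z y * gen_L s m l))))"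
      by (rule sum.reindex_bij_witness[of _ "\<lambda>(m, z, y, x). (x, y, z, m)" "\<lambda>(x, y, z, m). (m, z, y, x)"]) auto
    also have "\<dots> = (\<Sum>m=1..n. \<Sum>z\<in>T. \<Sum>y\<in>T. \<Sum>x\<in>T. scal (symmetrizer N x0 x) * (scal (\<psi> i y) * (scal (RF (u - s) x k z m) * (L_word w u z y * gen_L s m l))))"
      by (simp add: sum.cartesian_product)
    also have "\<dots> = (\<Sum>m=1..n. \<Sum>z\<in>T. scal (D m z) * (Y z * gen_L s m l))"
      unfolding D_def Y_def scal_sum sum_distrib_right sum_distrib_left
      by (intro sum.cong refl) (simp only: scal_mult mult.assoc scal_left_commute[of "scal (\<psi> _ _)"])
    \<comment> \<open>\<open>D\<close> is symmetric in its list argument, so a symmetrizer can be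
      inserted between the R-matrix and the word, producing the sum that \<open>Y_Lam\<close>
      evaluates.\<close>
    also have "\<dots> = (\<Sum>m=1..n. \<Sum>z\<in>T. \<Sum>z'\<in>T. scal (D m z') * (scal (symmetrizer N z' z) * Y z * gen_L s m l))"
    proof (intro sum.cong refl)
      fix m z assume "z \<in> T"
      have "scal (D m z) * (Y z * gen_L s m l) = scal (\<Sum>z'\<in>T. D m z' * symmetrizer N z' z) * (Y z * gen_L s m l)"
        using D[OF \<open>z \<in> T\<close>] by simp
      then show "scal (D m z) * (Y z * gen_L s m l) = (\<Sum>z'\<in>T. scal (D m z') * (scal (symmetrizer N z' z) * Y z * gen_L s m l))"
        by (simp add: scal_sum scal_mult sum_distrib_right mult.assoc)
    qed
    also have "\<dots> = (\<Sum>m=1..n. \<Sum>z'\<in>T. \<Sum>z\<in>T. scal (D m z') * (scal (symmetrizer N z' z) * Y z * gen_L s m l))"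
      by (intro sum.cong refl sum.swap)
    also have "\<dots> = (\<Sum>m=1..n. \<Sum>z'\<in>T. scal (D m z') * ((\<Sum>z\<in>T. scal (symmetrizer N z' z) * Y z) * gen_L s m l))"
      unfolding sum_distrib_left sum_distrib_right ..
    also have "\<dots> \<asymp> (\<Sum>m=1..n. \<Sum>z'\<in>T. scal (D m z') * (Lam z' * gen_L s m l))"
      by (rule eqv_sum, rule eqv_sum, rule eqv_scal, rule eqv_right[OF Y_Lam], assumption, rule gen_C[OF _ l], assumption)
    also have "\<dots> = (\<Sum>m=1..n. \<Sum>z'\<in>T. \<Sum>j=1..n. scal (D m z' * \<psi> j z') * (lam i j * gen_L s m l))"
      unfolding Lam_def sum_distrib_left sum_distrib_right by (intro sum.cong refl) (simp only: scal_mult mult.assoc)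
    also have "\<dots> = (\<Sum>m=1..n. \<Sum>j=1..n. scal (\<Sum>z'\<in>T. D m z' * \<psi> j z') * (lam i j * gen_L s m l))"
      unfolding scal_sum sum_distrib_right by (intro sum.cong refl sum.swap)
    also have "\<dots> = (\<Sum>m=1..n. \<Sum>j=1..n. if k = m then scal (g * \<psi> j x0) * (lam i j * gen_L s k l) else 0)"
    proof (intro sum.cong refl)
      fix m j assume "m \<in> {1..n}" "j \<in> {1..n}"
      then have "(\<Sum>z'\<in>T. D m z' * \<psi> j z') = (if k = m then g * \<psi> j x0 else 0)"
        using \<psi>[OF k, of m j x0] by (simp add: D_def T_def)
      then show "scal (\<Sum>z'\<in>T. D m z' * \<psi> j z') * (lam i j * gen_L s m l) = (if k = m then scal (g * \<psi> j x0) * (lam i j * gen_L s k l) else 0)"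
        by simp
    qed
    also have "\<dots> = (\<Sum>j=1..n. \<Sum>m=1..n. if k = m then scal (g * \<psi> j x0) * (lam i j * gen_L s k l) else 0)"
      by (rule sum.swap)
    also have "\<dots> = (\<Sum>j=1..n. scal (\<psi> j x0) * (scal g * (lam i j * gen_L s k l)))"
      using k by (intro sum.cong refl) (simp add: scal_mult mult.assoc scal_left_commute[of "scal g"])
    finally have left: "(\<Sum>x\<in>T. scal (symmetrizer N x0 x) * (\<Sum>y\<in>T. scal (\<psi> i y) * (\<Sum>z\<in>T. \<Sum>m=1..n. scal (RF (u - s) x k z m) * (L_word w u z y * gen_L s m l))))
      \<asymp> (\<Sum>j=1..n. scal (\<psi> j x0) * (scal g * (lam i j * gen_L s k l)))" .
    have "(\<Sum>x\<in>T. scal (symmetrizer N x0 x) * (\<Sum>y\<in>T. scal (\<psi> i y) * (\<Sum>z\<in>T. \<Sum>m=1..n. scal (RF (u - s) z m y l) * (gen_L s k m * L_word w u x z))))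
        = (\<Sum>(x, y, z, m)\<in>T \<times> T \<times> T \<times> {1..n}. scal (symmetrizer N x0 x) * (scal (\<psi> i y) * (scal (RF (u - s) z m y l) * (gen_L s k m * L_word w u x z))))"
      unfolding sum_distrib_left by (simp add: sum.cartesian_product)
    also have "\<dots> = (\<Sum>(m, z, x, y)\<in>{1..n} \<times> T \<times> T \<times> T. scal (symmetrizer N x0 x) * (scal (\<psi> i y) * (scal (RF (u - s) z m y l) * (gen_L s k m * L_word w u x z))))"
      by (rule sum.reindex_bij_witness[of _ "\<lambda>(m, z, x, y). (x, y, z, m)" "\<lambda>(x, y, z, m). (m, z, x, y)"]) auto
    also have "\<dots> = (\<Sum>m=1..n. \<Sum>z\<in>T. \<Sum>x\<in>T. \<Sum>y\<in>T. scal (symmetrizer N x0 x) * (scal (\<psi> i y) * (scal (RF (u - s) z m y l) * (gen_L s k m * L_word w u x z))))"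
      by (simp add: sum.cartesian_product)
    also have "\<dots> = (\<Sum>m=1..n. \<Sum>z\<in>T. scal (G m z) * (gen_L s k m * M z))"
      unfolding G_def M_def scal_sum sum_distrib_right sum_distrib_left
      by (intro sum.cong refl)
        (simp only: scal_mult mult.assoc scal_left_commute[of "gen_L _ _ _"] scal_left_commute[of "scal (RF _ _ _ _ _)"] scal_left_commute[of "scal (symmetrizer _ _ _)" "\<psi> _ _"])
    \<comment> \<open>On this side the symmetrizer is inserted by the symmetry of the
      left-symmetrized word \<open>M\<close>, which holds modulo the relations; it gives
      \<open>G\<close> the form required by \<open>GP\<close>.\<close>
    also have "\<dots> \<asymp> (\<Sum>m=1..n. \<Sum>z\<in>T. scal (G m z) * (gen_L s k m * (\<Sum>z'\<in>T. scal (symmetrizer N z' z) * M z')))"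
    proof (rule eqv_sum, rule eqv_sum, rule eqv_scal, rule eqv_left)
      fix m z assume m: "m \<in> {1..n}" and z: "z \<in> T"
      show "gen_L s k m \<in> C"
        by (rule gen_C[OF k m])
      have "M z \<asymp> M y" if "mset z = mset y" for y
        unfolding M_def T_def
        by (rule L_word_symmetric[OF symmetric_on_symmetrizer _ that]) (use z in \<open>simp add: T_def\<close>)
      then show "M z \<asymp> (\<Sum>z'\<in>T. scal (symmetrizer N z' z) * M z')"
        unfolding T_def by (intro eqv_sym[OF symmetrizer_average_eqv]) (use z in \<open>simp_all add: T_def\<close>)
    qed
    also have "(\<Sum>m=1..n. \<Sum>z\<in>T. scal (G m z) * (gen_L s k m * (\<Sum>z'\<in>T. scal (symmetrizer N z' z) * M z')))
        = (\<Sum>m=1..n. \<Sum>z\<in>T. \<Sum>z'\<in>T. scal (G m z * symmetrizer N z' z) * (gen_L s k m * M z'))"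
      unfolding sum_distrib_left by (intro sum.cong refl) (simp only: scal_mult mult.assoc scal_left_commute[of "gen_L _ _ _"])
    also have "\<dots> = (\<Sum>m=1..n. \<Sum>z'\<in>T. scal (\<Sum>z\<in>T. G m z * symmetrizer N z' z) * (gen_L s k m * M z'))"
      unfolding scal_sum sum_distrib_right by (intro sum.cong refl sum.swap)
    also have "\<dots> = (\<Sum>m=1..n. \<Sum>z'\<in>T. if m = l then scal (g * \<psi> i z') * (gen_L s k l * M z') else 0)"
      by (intro sum.cong refl) (simp only: GP, simp)
    also have "\<dots> = (\<Sum>z'\<in>T. \<Sum>m=1..n. if m = l then scal (g * \<psi> i z') * (gen_L s k l * M z') else 0)"
      by (rule sum.swap)
    also have "\<dots> = (\<Sum>z'\<in>T. scal (g * \<psi> i z') * (gen_L s k l * M z'))"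
      using l by simp
    also have "\<dots> = scal g * (gen_L s k l * (\<Sum>z'\<in>T. scal (\<psi> i z') * M z'))"
      unfolding sum_distrib_left by (intro sum.cong refl) (simp only: scal_mult mult.assoc scal_left_commute[of "gen_L _ _ _"])
    also have "(\<Sum>z'\<in>T. scal (\<psi> i z') * M z') = (\<Sum>z\<in>T. scal (symmetrizer N x0 z) * Y z)"
      unfolding M_def Y_def sum_distrib_left by (subst sum.swap) (intro sum.cong refl scal_left_commute)
    also have "scal g * (gen_L s k l * (\<Sum>z\<in>T. scal (symmetrizer N x0 z) * Y z)) \<asymp> scal g * (gen_L s k l * Lam x0)"
      by (intro eqv_scal eqv_left Y_Lam x0 gen_C k l)
    also have "scal g * (gen_L s k l * Lam x0) = (\<Sum>j=1..n. scal (\<psi> j x0) * (scal g * (gen_L s k l * lam i j)))"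
      unfolding Lam_def sum_distrib_left
      by (intro sum.cong refl) (simp only: scal_left_commute[of "gen_L _ _ _"] scal_left_commute[of "scal g"])
    finally have right: "(\<Sum>x\<in>T. scal (symmetrizer N x0 x) * (\<Sum>y\<in>T. scal (\<psi> i y) * (\<Sum>z\<in>T. \<Sum>m=1..n. scal (RF (u - s) z m y l) * (gen_L s k m * L_word w u x z))))
      \<asymp> (\<Sum>j=1..n. scal (\<psi> j x0) * (scal g * (gen_L s k l * lam i j)))" .
    have "(\<Sum>x\<in>T. scal (symmetrizer N x0 x) * (\<Sum>y\<in>T. scal (\<psi> i y) * (\<Sum>z\<in>T. \<Sum>m=1..n. scal (RF (u - s) x k z m) * (L_word w u z y * gen_L s m l))))
        \<asymp> (\<Sum>x\<in>T. scal (symmetrizer N x0 x) * (\<Sum>y\<in>T. scal (\<psi> i y) * (\<Sum>z\<in>T. \<Sum>m=1..n. scal (RF (u - s) z m y l) * (gen_L s k m * L_word w u x z))))"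
      unfolding T_def by (rule eqv_sum, rule eqv_scal, rule eqv_sum, rule eqv_scal, rule fused_RLL[OF _ _ k l])
    then show ?thesis
      using left right eqv_sym eqv_trans by blast
  qed
  \<comment> \<open>So far the relation holds for each component \<open>x0\<close> as a sum over
    \<open>j\<close>; functionals dual to the \<open>\<psi> j\<close> isolate the term with the
    given \<open>j\<close>.\<close>
  have "\<exists>D. \<forall>i\<in>{1..n}. \<forall>j\<in>{1..n}. (\<Sum>x\<in>T. D j x * \<psi> i x) = (if i = j then 1 else 0)"
    unfolding T_def by (rule independent_dual[OF finite_atLeastAtMost finite_tidx indep])
  then obtain D where D: "\<And>i j. i \<in> {1..n} \<Longrightarrow> j \<in> {1..n} \<Longrightarrow> (\<Sum>x\<in>T. D j x * \<psi> i x) = (if i = j then 1 else 0)"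
    by blast
  have contract: "(\<Sum>x\<in>T. scal (D j x) * (\<Sum>j=1..n. scal (\<psi> j x) * f j)) = f j" for f
  proof -
    have "(\<Sum>x\<in>T. scal (D j x) * (\<Sum>j=1..n. scal (\<psi> j x) * f j)) = (\<Sum>j'=1..n. scal (\<Sum>x\<in>T. D j x * \<psi> j' x) * f j')"
      unfolding scal_sum sum_distrib_left sum_distrib_right by (subst sum.swap) (simp only: scal_mult mult.assoc)
    also have "\<dots> = (\<Sum>j'=1..n. if j' = j then f j' else 0)"
      using D j by (intro sum.cong refl) simp
    finally show ?thesis using j by simp
  qed
  have "(\<Sum>x\<in>T. scal (D j x) * (\<Sum>j=1..n. scal (\<psi> j x) * (scal g * (lam i j * gen_L s k l))))
      \<asymp> (\<Sum>x\<in>T. scal (D j x) * (\<Sum>j=1..n. scal (\<psi> j x) * (scal g * (gen_L s k l * lam i j))))"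
    by (rule eqv_sum, rule eqv_scal, rule main)
  then have "scal g * (lam i j * gen_L s k l) \<asymp> scal g * (gen_L s k l * lam i j)"
    unfolding contract .
  then show ?thesis
    using g by (rule eqv_scal_cancel)
qed

end

theorem theorem2:
  fixes n N :: nat and \<tau> w u :: complex and a :: "nat \<Rightarrow> complex"
    and \<Lambda> :: "nat \<Rightarrow> nat \<Rightarrow> falg set"
  assumes "Im \<tau> > 0" and "n \<ge> 2" and "N \<ge> 2" and "coprime n N"
    and "w = of_nat n / of_nat N"
    and "generic_at n N \<tau> w u a"
    and "is_Lambda n N \<tau> w a u \<Lambda>"
  shows "\<forall>i\<in>{1..n}. \<forall>j\<in>{1..n}. \<forall>k\<in>{1..n}. \<forall>l\<in>{1..n}. \<forall>v.
           generic_pair n N \<tau> w u v \<longrightarrow>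
           \<Lambda> i j \<otimes>\<^bsub>mono_alg n \<tau> w\<^esub> L_elt n \<tau> w v k l
             = L_elt n \<tau> w v k l \<otimes>\<^bsub>mono_alg n \<tau> w\<^esub> \<Lambda> i j"
proof (intro ballI allI impI)
  fix i j k l s
  assume i: "i \<in> {1..n}" and j: "j \<in> {1..n}" and k: "k \<in> {1..n}" and l: "l \<in> {1..n}"
    and gp: "generic_pair n N \<tau> w u s"
  interpret T: theta_setting n \<tau>
    using assms(1,2) by unfold_locales auto
  \<comment> \<open>Since \<open>n\<close> and \<open>N\<close> are coprime and
    \<open>N \<ge> 2\<close>, the crossing parameter is real but not an integer, hence off the
    lattice of zeros of \<open>h\<close>.\<close>
  have "real n / real N \<notin> \<int>"
  proof
    assume "real n / real N \<in> \<int>"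
    then obtain m :: int where "real n / real N = of_int m"
      by (elim Ints_cases)
    then have "of_int (int n) = (of_int (int N * m) :: real)"
      using assms(3) by (simp add: field_simps)
    then have "int n = int N * m"
      unfolding of_int_eq_iff .
    then have "N dvd n"
      by (metis dvd_triv_left int_dvd_int_iff)
    then have "N = 1"
      using coprime_common_divisor_nat[OF assms(4), of N] by simp
    then show False
      using assms(3) by simp
  qed
  from T.h_nonzero_real[OF this] have "h_fun n \<tau> w \<noteq> 0"
    by (simp add: assms(5))
  then interpret fusion_setting n \<tau> w
    by unfold_locales
  have \<xi>: "h_fun n \<tau> (u - s + of_nat m * w) \<noteq> 0" if "m < N" for m
    using gp that by (simp add: generic_pair_def algebra_simps)
  have N: "N > 0" using assms(3) by simp
  \<comment> \<open>The conditions in \<open>generic_pair\<close> are exactly the nonvanishing of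
    the numerator factors of \<open>fused_factor\<close>.\<close>
  have g: "fused_factor N (u - s) \<noteq> 0"
    using \<xi> hw by (simp add: fused_factor_def)
  \<comment> \<open>Representatives in the free algebra are chosen for all entries at once; the
    commutation relation is then proved as a congruence and pushed back to the quotient.\<close>
  define lam where "lam = (\<lambda>i j. SOME p. p \<in> carrier (free_alg n) \<and> \<Lambda> i j = cls n \<tau> w p)"
  have "lam i j \<in> carrier (free_alg n) \<and> \<Lambda> i j = cls n \<tau> w (lam i j)" if "i \<in> {1..n}" "j \<in> {1..n}" for i j
  proof -
    have "\<Lambda> i j \<in> carrier (mono_alg n \<tau> w)"
      using assms(7)[unfolded is_Lambda_def, THEN conjunct1] that by simp
    then obtain p where "p \<in> carrier (free_alg n) \<and> \<Lambda> i j = cls n \<tau> w p"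
      using mono_alg_rep[of "\<Lambda> i j"] by metis
    then show ?thesis
      unfolding lam_def by (rule someI)
  qed
  then have lamC: "lam i j \<in> carrier (free_alg n)" and lam: "\<Lambda> i j = cls n \<tau> w (lam i j)"
    if "i \<in> {1..n}" "j \<in> {1..n}" for i j
    using that by simp_all
  have LC: "fused_L_sym n N w u x y \<in> carrier (free_alg n)" if x: "x \<in> tidx n N" and y: "y \<in> tidx n N" for x y
    unfolding fused_L_sym_def tmul_def smat_def
    using x y by (intro C_sum C_mult scal_C) (simp add: fused_L_eq L_word_C)
  have fused: "(\<Sum>y\<in>tidx n N. fused_L_sym n N w u x y * scal (Psi n N \<tau> w a u i y)) \<asymp> (\<Sum>j=1..n. lam i j * scal (Psi n N \<tau> w a u j x))"
    if i: "i \<in> {1..n}" and x: "x \<in> tidx n N" for i x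
  proof -
    have "cls n \<tau> w (\<Sum>y\<in>tidx n N. fused_L_sym n N w u x y * scal (Psi n N \<tau> w a u i y))
        = (\<Oplus>\<^bsub>mono_alg n \<tau> w\<^esub>j\<in>{1..n}. \<Lambda> i j \<otimes>\<^bsub>mono_alg n \<tau> w\<^esub> cls n \<tau> w (scal (Psi n N \<tau> w a u j x)))"
      using assms(7)[unfolded is_Lambda_def, THEN conjunct2] i x by simp
    also have "\<dots> = (\<Oplus>\<^bsub>mono_alg n \<tau> w\<^esub>j\<in>{1..n}. cls n \<tau> w (lam i j * scal (Psi n N \<tau> w a u j x)))"
      using i by (intro cls.S.finsum_cong') (auto simp: lam lamC cls_mult C_mult)
    also have "\<dots> = cls n \<tau> w (\<Sum>j=1..n. lam i j * scal (Psi n N \<tau> w a u j x))"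
      using i by (intro cls_sum C_mult lamC scal_C) auto
    finally show ?thesis
      using i x by (subst (asm) cls_eq_iff) (auto intro!: C_sum C_mult LC lamC scal_C simp del: atLeastAtMost_iff)
  qed
  have "lam i j * gen_L s k l \<asymp> gen_L s k l * lam i j"
  proof (rule Lambda_commutes[where \<psi> = "Psi n N \<tau> w a u", OF \<xi> g _ _ fused lamC i j k l])
    show "\<forall>i\<in>{1..n}. c i = 0" if "\<forall>x\<in>tidx n N. (\<Sum>i=1..n. c i * Psi n N \<tau> w a u i x) = 0" for c
      using assms(6) that unfolding generic_at_def by blast
  qed (use R_fused_Psi[OF N assms(4,5) \<xi>] in auto)
  then show "\<Lambda> i j \<otimes>\<^bsub>mono_alg n \<tau> w\<^esub> L_elt n \<tau> w s k l = L_elt n \<tau> w s k l \<otimes>\<^bsub>mono_alg n \<tau> w\<^esub> \<Lambda> i j"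
    using i j k l by (simp add: L_elt_def lam cls_mult lamC gen_C cls_eq_iff C_mult del: atLeastAtMost_iff)
qed

end
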